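(* Let $(u,\partial_tu):[0,+\infty)\to\dot H^1(\mathbb{R}^5)\times L^2(\mathbb{R}^5)$ be a solution of $\partial_t^2u=\Delta u+|u|^{4/3}u$. Let $K\ge2$ and assume that there exist continuous functions $\mu_k:[0,+\infty)\to(0,+\infty)$, $y_k:[0,+\infty)\to\mathbb{R}^5$, $1\le k\le K$, such that $$\lim_{t\to+\infty}\Big(\Big\|u(t)-\sum_{k=1}^KW_{\mu_k(t),y_k(t)}\Big\|_{\dot H^1(\mathbb{R}^5)}+\|\partial_tu(t)\|_{L^2(\mathbb{R}^5)}\Big)=0.$$ Assume moreover that $$C_1\le\frac{\mu_k(t)}{\mu_j(t)}\le C_2\quad(1\le k,j\le K,\ t\ge0),\qquad\lim_{t\to+\infty}y_k(t)=z_k\quad(1\le k\le K),$$ where $C_1,C_2>0$ and $z_1,\dots,z_K$ are pairwise distinct points of $\mathbb{R}^5$. Then $$\lim_{t\to+\infty}\mu_k(t)=0,\qquad 1\le k\le K.$$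
   Context: $W(x)=\left(1+\frac{|x|^2}{15}\right)^{-3/2}$ on $\mathbb{R}^5$, which solves $\Delta W=-W^{7/3}$; $W_{\lambda,z}(x)=\lambda^{-3/2}W\left(\frac{x-z}{\lambda}\right)$ for $\lambda>0$, $z\in\mathbb{R}^5$. Solutions are the usual energy-space solutions: $(u,\partial_tu)\in C(I;\dot H^1\times L^2)$ with $u\in L^{7/3}_{\rm loc}(I;L^{14/3}(\mathbb{R}^5))$. *)

theory Defs
  imports "HOL-Analysis.Analysis"
begin

text \<open>
  Elements of Lebesgue and Sobolev spaces are represented by functions; the norms, membership
  predicates and integral identities below only depend on classes up to almost-everywhere equality
  in the space variable.
\<close>

definition in_Lp :: "real \<Rightarrow> ('a::euclidean_space \<Rightarrow> 'b::euclidean_space) \<Rightarrow> bool" where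
  "in_Lp p f \<longleftrightarrow>
     f \<in> borel_measurable lebesgue \<and> integrable lebesgue (\<lambda>x. norm (f x) powr p)"

definition Lp_norm :: "real \<Rightarrow> ('a::euclidean_space \<Rightarrow> 'b::euclidean_space) \<Rightarrow> real" where
  "Lp_norm p f = (LINT x|lebesgue. norm (f x) powr p) powr (1 / p)"

definition dir_deriv :: "'a::euclidean_space \<Rightarrow> ('a \<Rightarrow> real) \<Rightarrow> 'a \<Rightarrow> real" where
  "dir_deriv b f x = frechet_derivative f (at x) b"

text \<open>
  Smoothness: all iterated partial derivatives are (Frechet) differentiable everywhere, hence
  also continuous.
\<close>

definition smooth :: "('a::euclidean_space \<Rightarrow> real) \<Rightarrow> bool" where
  "smooth f \<longleftrightarrow> (\<forall>bs. set bs \<subseteq> Basis \<longrightarrow> foldr dir_deriv bs f differentiable_on UNIV)"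

definition test_function :: "'a::euclidean_space set \<Rightarrow> ('a \<Rightarrow> real) \<Rightarrow> bool" where
  "test_function U \<phi> \<longleftrightarrow>
     smooth \<phi> \<and> compact (closure {x. \<phi> x \<noteq> 0}) \<and> closure {x. \<phi> x \<noteq> 0} \<subseteq> U"

definition locally_integrable :: "('a::euclidean_space \<Rightarrow> 'b::euclidean_space) \<Rightarrow> bool" where
  "locally_integrable f \<longleftrightarrow> (\<forall>C. compact C \<longrightarrow> f absolutely_integrable_on C)"

definition weak_gradient :: "('a::euclidean_space \<Rightarrow> real) \<Rightarrow> ('a \<Rightarrow> 'a) \<Rightarrow> bool" where
  "weak_gradient f G \<longleftrightarrow>
     locally_integrable f \<and> locally_integrable G \<and>
     (\<forall>\<phi>. test_function UNIV \<phi> \<longrightarrow> (\<forall>b\<in>Basis.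
        (LINT x|lebesgue. f x * dir_deriv b \<phi> x) = - (LINT x|lebesgue. (G x \<bullet> b) * \<phi> x)))"

text \<open>
  The homogeneous Sobolev space on five-dimensional space, i.e. the completion of the test functions
  for the norm of the gradient in \<open>L\<^sup>2\<close>. By the Sobolev embedding (critical exponent
  \<open>2 * 5 / (5 - 2) = 10 / 3\<close>) it is realised as a space of functions. The weak gradient is unique
  almost everywhere, so the choice made in the norm is immaterial.
\<close>

definition in_Hdot1 :: "(real^5 \<Rightarrow> real) \<Rightarrow> bool" where
  "in_Hdot1 f \<longleftrightarrow> in_Lp (10/3) f \<and> (\<exists>G. weak_gradient f G \<and> in_Lp 2 G)"

definition Hdot1_norm :: "(real^5 \<Rightarrow> real) \<Rightarrow> real" where
  "Hdot1_norm f = Lp_norm 2 (SOME G. weak_gradient f G)"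

text \<open>Derivatives of functions of \<open>(t, x)\<close>, with \<open>t\<close> real and \<open>x\<close> in five-dimensional space.\<close>

definition time_deriv :: "(real \<times> (real^5) \<Rightarrow> real) \<Rightarrow> real \<times> (real^5) \<Rightarrow> real" where
  "time_deriv \<phi> = dir_deriv (1, 0) \<phi>"

definition space_laplacian :: "(real \<times> (real^5) \<Rightarrow> real) \<Rightarrow> real \<times> (real^5) \<Rightarrow> real" where
  "space_laplacian \<phi> p = (\<Sum>b\<in>Basis. dir_deriv (0, b) (dir_deriv (0, b) \<phi>) p)"

text \<open>
  On the time interval \<open>I\<close>, \<open>(u, v)\<close> is a real-valued energy-space solution of the wave equation
  \<open>u_tt = Laplacian u + |u| powr (4/3) * u\<close>, where \<open>v\<close> is the time derivative of \<open>u\<close>: the pair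
  \<open>(u, v)\<close> is continuous in time with values in the energy space, \<open>u\<close> has locally in time finite
  norm in \<open>L^(7/3)\<close> (time) of \<open>L^(14/3)\<close> (space), and both \<open>u_t = v\<close> and the equation hold in the
  sense of distributions on the interior of \<open>I\<close> times space. The distributional pairings are written
  as iterated integrals; the inner ones are continuous in time because continuity in the
  energy space gives continuity of \<open>u\<close> in \<open>L^(10/3)\<close> by the Sobolev inequality.
\<close>

definition energy_wave_solution ::
    "real set \<Rightarrow> (real \<Rightarrow> real^5 \<Rightarrow> real) \<Rightarrow> (real \<Rightarrow> real^5 \<Rightarrow> real) \<Rightarrow> bool" where
  "energy_wave_solution I u v \<longleftrightarrow>
     (\<forall>t\<in>I. in_Hdot1 (u t) \<and> in_Lp 2 (v t)) \<and>
     (\<forall>t\<in>I. ((\<lambda>s. Hdot1_norm (\<lambda>x. u s x - u t x)) \<longlongrightarrow> 0) (at t within I)) \<and>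
     (\<forall>t\<in>I. ((\<lambda>s. Lp_norm 2 (\<lambda>x. v s x - v t x)) \<longlongrightarrow> 0) (at t within I)) \<and>
     (AE t in lebesgue. t \<in> I \<longrightarrow> in_Lp (14/3) (u t)) \<and>
     (\<forall>a b. {a..b} \<subseteq> I \<longrightarrow>
        (\<lambda>t. Lp_norm (14/3) (u t) powr (7/3)) absolutely_integrable_on {a..b}) \<and>
     (\<forall>\<phi>. test_function (interior I \<times> UNIV) \<phi> \<longrightarrow>
        (LINT t|lebesgue. LINT x|lebesgue. u t x * time_deriv \<phi> (t, x))
          = - (LINT t|lebesgue. LINT x|lebesgue. v t x * \<phi> (t, x))) \<and>
     (\<forall>\<phi>. test_function (interior I \<times> UNIV) \<phi> \<longrightarrow>
        (LINT t|lebesgue. LINT x|lebesgue. u t x * time_deriv (time_deriv \<phi>) (t, x))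
          = (LINT t|lebesgue. LINT x|lebesgue.
               u t x * space_laplacian \<phi> (t, x) + \<bar>u t x\<bar> powr (4/3) * u t x * \<phi> (t, x)))"

definition W :: "real^5 \<Rightarrow> real" where
  "W x = (1 + (norm x)\<^sup>2 / 15) powr (-3/2)"

definition bubble :: "real \<Rightarrow> real^5 \<Rightarrow> real^5 \<Rightarrow> real" where
  "bubble l z x = l powr (-3/2) * W ((x - z) /\<^sub>R l)"

end

theory Submission
  imports Defs
begin

text \<open>
  Every bubble solves the elliptic equation \<open>Laplacian W = - W powr (7/3)\<close>, but a sum \<open>S\<close> of at
  least two positive bubbles does not: since the power \<open>7/3\<close> is strictly superadditive on positive
  numbers, \<open>Laplacian S + S powr (7/3)\<close> is strictly positive. If a scale did not tend to zero, this
  would contradict the wave equation on suitable time windows, for the following reason.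

  Let \<open>r = \<mu> 1 t\<close> with \<open>t\<close> large and \<open>r\<close> bounded below along a sequence of times. All estimates are
  made with a cut-off function at the spatial scale \<open>r\<close> and on the time window from \<open>t\<close> to \<open>t + r\<close>,
  where every quantity that matters is of order \<open>r powr (3/2)\<close>; relative to \<open>r\<close> the centres stay
  bounded. Scales that converge along a sequence to a positive number and scales that tend to
  infinity are thereby treated at once.

  \<^item> The pairing of \<open>S\<close> with the Laplacian of the cut-off is minus the local mass of the bubbles, the
    integral of \<open>bubble powr (7/3)\<close> against the cut-off. At time \<open>t\<close> this mass is bounded below. It
    changes little during the window, because \<open>u\<close> is close to \<open>S\<close> and the time derivative of \<open>u\<close> is
    small in \<open>L\<^sup>2\<close> (lemma \<open>pairing_laplacian_increment\<close>).
  \<^item> A bubble has small local mass when it is much more concentrated or much more spread out than \<open>r\<close>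
    (lemma \<open>scale_control\<close>). Hence all scales remain comparable to \<open>r\<close> during the window, and the
    superadditivity is quantitative there: the pairing of \<open>Laplacian u + |u| powr (4/3) * u\<close> with the
    cut-off is bounded below (lemma \<open>wave_defect_lower_bound\<close>).
  \<^item> The wave equation, tested with a cut-off in time and space, says that the time average of this
    pairing equals an integral of the time derivative of \<open>u\<close>, which is small (lemma
    \<open>time_average_bound\<close>).

  In the second point the error \<open>w = u - S\<close> enters through the integral of \<open>|w| powr (7/3)\<close>. It is
  controlled by the gradient of \<open>w\<close> through the Sobolev inequality, which is proved by the method of
  Gagliardo and Nirenberg. A function with a weak gradient is absolutely continuous on almost every
  line (lemma \<open>weak_derivative_along_lines\<close>, a consequence of the fundamental lemma of the calculus
  of variations), so a power of it is bounded by line integrals in all coordinate directions, and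
  the Loomis-Whitney inequality turns these bounds into integrability.
\<close>


section \<open>Smooth functions\<close>

text \<open>
  Smoothness quantifies over lists of directions. Counting the derivatives instead allows induction
  on the order, with the function as an arbitrary parameter.
\<close>

primrec times_differentiable :: "nat \<Rightarrow> ('a::euclidean_space \<Rightarrow> real) \<Rightarrow> bool" where
  "times_differentiable 0 f \<longleftrightarrow> f differentiable_on UNIV"
| "times_differentiable (Suc n) f \<longleftrightarrow>
     f differentiable_on UNIV \<and> (\<forall>b\<in>Basis. times_differentiable n (dir_deriv b f))"

lemma times_differentiable_iff_foldr:
  "times_differentiable n f \<longleftrightarrow>
     (\<forall>bs. set bs \<subseteq> Basis \<and> length bs \<le> n \<longrightarrow> foldr dir_deriv bs f differentiable_on UNIV)"
proof (induction n arbitrary: f)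
  case (Suc n)
  show ?case (is "?L \<longleftrightarrow> ?R")
  proof
    assume L: ?L
    show ?R
    proof (intro allI impI)
      fix bs :: "'a list" assume bs: "set bs \<subseteq> Basis \<and> length bs \<le> Suc n"
      show "foldr dir_deriv bs f differentiable_on UNIV"
      proof (cases bs rule: rev_cases)
        case Nil then show ?thesis using L by simp
      next
        case (snoc bs' b)
        then show ?thesis using L bs Suc.IH[of "dir_deriv b f"] by auto
      qed
    qed
  next
    assume R: ?R
    have "f differentiable_on UNIV" using R[rule_format, of "[]"] by simp
    moreover have "times_differentiable n (dir_deriv b f)" if "b \<in> Basis" for b
      unfolding Suc.IH
    proof (intro allI impI)
      fix bs :: "'a list" assume "set bs \<subseteq> Basis \<and> length bs \<le> n"
      then show "foldr dir_deriv bs (dir_deriv b f) differentiable_on UNIV"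
        using R[rule_format, of "bs @ [b]"] that by simp
    qed
    ultimately show ?L by simp
  qed
qed simp

lemma smooth_iff_times_differentiable: "smooth f \<longleftrightarrow> (\<forall>n. times_differentiable n f)"
  unfolding smooth_def times_differentiable_iff_foldr by blast

lemma times_differentiable_imp_differentiable:
  "times_differentiable n f \<Longrightarrow> f differentiable (at x)"
  by (cases n) (auto simp: differentiable_on_def)

lemma smooth_imp_differentiable: "smooth f \<Longrightarrow> f differentiable (at x)"
  using smooth_iff_times_differentiable times_differentiable_imp_differentiable by blast

lemma smooth_dir_deriv: "smooth f \<Longrightarrow> b \<in> Basis \<Longrightarrow> smooth (dir_deriv b f)"
  unfolding smooth_iff_times_differentiable by (metis times_differentiable.simps(2))

lemma smooth_imp_continuous_on: "smooth f \<Longrightarrow> continuous_on S f"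
  by (meson continuous_at_imp_continuous_on differentiable_imp_continuous_within
      smooth_imp_differentiable)

lemma dir_deriv_eq: "(f has_derivative f') (at x) \<Longrightarrow> dir_deriv b f x = f' b"
  unfolding dir_deriv_def by (metis frechet_derivative_at)

lemma has_derivative_dir_deriv:
  "f differentiable (at x) \<Longrightarrow> (f has_derivative (\<lambda>h. dir_deriv h f x)) (at x)"
  unfolding dir_deriv_def by (simp add: frechet_derivative_works flip: eta_contract_eq)

lemma dir_deriv_sum_Basis:
  assumes "f differentiable (at x)"
  shows "dir_deriv h f x = (\<Sum>i\<in>Basis. (h \<bullet> i) * dir_deriv i f x)"
proof -
  interpret linear "\<lambda>h. dir_deriv h f x"
    using has_derivative_dir_deriv[OF assms] by (rule has_derivative_linear)
  have "dir_deriv h f x = dir_deriv (\<Sum>i\<in>Basis. (h \<bullet> i) *\<^sub>R i) f x"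
    by (simp add: euclidean_representation)
  then show ?thesis by (simp add: sum scale)
qed

lemma dir_deriv_add:
  assumes "f differentiable (at x)" "g differentiable (at x)"
  shows "dir_deriv b (\<lambda>x. f x + g x) x = dir_deriv b f x + dir_deriv b g x"
  by (rule dir_deriv_eq) (intro has_derivative_add has_derivative_dir_deriv assms)

lemma dir_deriv_mult:
  assumes "f differentiable (at x)" "g differentiable (at x)"
  shows "dir_deriv b (\<lambda>x. f x * g x) x = f x * dir_deriv b g x + dir_deriv b f x * g x"
  by (rule dir_deriv_eq[where f' = "\<lambda>b. f x * dir_deriv b g x + dir_deriv b f x * g x"])
     (intro has_derivative_mult has_derivative_dir_deriv assms)

lemma times_differentiable_decrease:
  "times_differentiable (Suc n) f \<Longrightarrow> times_differentiable n f"
  unfolding times_differentiable_iff_foldr by auto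

lemma times_differentiable_const: "times_differentiable n (\<lambda>x. c)"
proof (induction n arbitrary: c)
  case (Suc n)
  have "dir_deriv b (\<lambda>x. c) = (\<lambda>x. 0)" for b :: 'a
    by (rule ext, rule dir_deriv_eq) simp
  then show ?case using Suc by simp
qed simp

lemma times_differentiable_add:
  "times_differentiable n f \<Longrightarrow> times_differentiable n g \<Longrightarrow> times_differentiable n (\<lambda>x. f x + g x)"
proof (induction n arbitrary: f g)
  case (Suc n)
  have "dir_deriv b (\<lambda>x. f x + g x) = (\<lambda>x. dir_deriv b f x + dir_deriv b g x)" for b
    by (rule ext, rule dir_deriv_add)
       (use Suc.prems times_differentiable_imp_differentiable in blast)+
  then show ?case using Suc by (simp add: differentiable_on_add)
qed (simp add: differentiable_on_add)

lemma times_differentiable_mult: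
  "times_differentiable n f \<Longrightarrow> times_differentiable n g \<Longrightarrow> times_differentiable n (\<lambda>x. f x * g x)"
proof (induction n arbitrary: f g)
  case (Suc n)
  have eq: "dir_deriv b (\<lambda>x. f x * g x) = (\<lambda>x. f x * dir_deriv b g x + dir_deriv b f x * g x)" for b
    by (rule ext, rule dir_deriv_mult)
       (use Suc.prems times_differentiable_imp_differentiable in blast)+
  have "times_differentiable n (dir_deriv b (\<lambda>x. f x * g x))" if "b \<in> Basis" for b
    unfolding eq using Suc.prems[THEN times_differentiable_decrease] Suc.prems that
    by (intro times_differentiable_add Suc.IH) auto
  then show ?case using Suc.prems by (simp add: differentiable_on_mult)
qed (simp add: differentiable_on_mult)

lemma times_differentiable_sum:
  "(\<And>i. i \<in> I \<Longrightarrow> times_differentiable n (f i)) \<Longrightarrow> times_differentiable n (\<lambda>x. \<Sum>i\<in>I. f i x)"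
  by (induction I rule: infinite_finite_induct)
     (auto intro: times_differentiable_const times_differentiable_add)

lemma times_differentiable_prod:
  "(\<And>i. i \<in> I \<Longrightarrow> times_differentiable n (f i)) \<Longrightarrow> times_differentiable n (\<lambda>x. \<Prod>i\<in>I. f i x)"
  by (induction I rule: infinite_finite_induct)
     (auto intro: times_differentiable_const times_differentiable_mult)

lemma has_derivative_affine:
  fixes f :: "'a::euclidean_space \<Rightarrow> real" and L :: "'b::euclidean_space \<Rightarrow> 'a"
  assumes "linear L" and f: "f differentiable (at (c + L x))"
  shows "((\<lambda>x. f (c + L x)) has_derivative (\<lambda>h. dir_deriv (L h) f (c + L x))) (at x)"
proof -
  have "(L has_derivative L) (at x)"
    using assms(1) by (simp add: linear_imp_has_derivative)
  then have "((\<lambda>x. c + L x) has_derivative L) (at x)"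
    by (auto intro!: derivative_eq_intros)
  from has_derivative_compose[OF this has_derivative_dir_deriv[OF f]]
  show ?thesis .
qed

lemmas dir_deriv_affine = has_derivative_affine[THEN dir_deriv_eq]

lemma times_differentiable_affine:
  fixes f :: "'a::euclidean_space \<Rightarrow> real" and L :: "'b::euclidean_space \<Rightarrow> 'a"
  assumes L: "linear L"
  shows "times_differentiable n f \<Longrightarrow> times_differentiable n (\<lambda>x. f (c + L x))"
proof (induction n arbitrary: f)
  case 0
  then have "f differentiable (at x)" for x
    by (simp add: differentiable_on_def)
  then have "(\<lambda>x. f (c + L x)) differentiable (at x)" for x
    using has_derivative_affine[OF L] unfolding differentiable_def by blast
  then show ?case by (simp add: differentiable_on_def)
next
  case (Suc n)
  note d = times_differentiable_imp_differentiable[OF Suc.prems]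
  have eq: "dir_deriv b (\<lambda>x. f (c + L x)) =
      (\<lambda>x. \<Sum>i\<in>Basis. (L b \<bullet> i) * dir_deriv i f (c + L x))" for b
    by (rule ext) (simp add: dir_deriv_affine[OF L d] dir_deriv_sum_Basis[OF d, of "L b"])
  have "times_differentiable n (dir_deriv b (\<lambda>x. f (c + L x)))" for b
    unfolding eq using Suc
    by (auto intro!: times_differentiable_sum times_differentiable_mult times_differentiable_const)
  moreover have "(\<lambda>x. f (c + L x)) differentiable_on UNIV"
    using has_derivative_affine[OF L d] unfolding differentiable_on_def
    by (metis differentiable_def)
  ultimately show ?case by simp
qed

lemma smooth_mult: "smooth f \<Longrightarrow> smooth g \<Longrightarrow> smooth (\<lambda>x. f x * g x)"
  and smooth_prod: "(\<And>i. i \<in> I \<Longrightarrow> smooth (h i)) \<Longrightarrow> smooth (\<lambda>x. \<Prod>i\<in>I. h i x)"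
  by (simp_all add: smooth_iff_times_differentiable times_differentiable_mult
      times_differentiable_prod)

lemma smooth_affine:
  "linear L \<Longrightarrow> smooth f \<Longrightarrow> smooth (\<lambda>x. f (c + L x))"
  by (simp add: smooth_iff_times_differentiable times_differentiable_affine)

lemma smooth_linear:
  "linear L \<Longrightarrow> smooth f \<Longrightarrow> smooth (\<lambda>x. f (L x))"
  using smooth_affine[of L f 0] by simp

text \<open>
  The flat function \<open>exp (- 1 / t)\<close>, extended by zero. The powers of \<open>1 / t\<close> in front make the family
  closed under differentiation up to linear combinations.
\<close>

definition flat_exp :: "nat \<Rightarrow> real \<Rightarrow> real" where
  "flat_exp k t = (if t > 0 then inverse t ^ k * exp (- inverse t) else 0)"

lemma flat_exp_tendsto_0: "(flat_exp k \<longlongrightarrow> 0) (at_right 0)"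
proof -
  have "((\<lambda>x::real. x ^ k / exp x) \<longlongrightarrow> 0) at_top"
    by (rule tendsto_power_div_exp_0)
  from filterlim_compose[OF this filterlim_inverse_at_top_right]
  have "((\<lambda>t::real. inverse t ^ k / exp (inverse t)) \<longlongrightarrow> 0) (at_right 0)" .
  then show ?thesis
    by (rule Lim_transform_eventually)
       (auto simp: flat_exp_def exp_minus field_simps eventually_at_right_less
         intro!: eventually_mono[OF eventually_at_right_less[of 0]])
qed

lemma flat_exp_has_derivative:
  "(flat_exp k has_real_derivative flat_exp (k + 2) t - real k * flat_exp (k + 1) t) (at t)"
proof -
  consider "t > 0" | "t < 0" | "t = 0" by linarith
  then show ?thesis
  proof cases
    case 1
    have "((\<lambda>t. inverse t ^ k * exp (- inverse t)) has_real_derivative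
        flat_exp (k + 2) t - real k * flat_exp (k + 1) t) (at t)"
      using 1 by (auto intro!: derivative_eq_intros simp: flat_exp_def)
        (cases k; simp add: field_simps power2_eq_square)
    then show ?thesis
      by (rule DERIV_cong_ev[THEN iffD1, rotated -1, OF _ refl _ refl])
         (use 1 in \<open>auto simp: flat_exp_def intro!: eventually_mono[OF eventually_nhds_in_open[of "{0<..}"]]\<close>)
  next
    case 2
    have "((\<lambda>t. 0) has_real_derivative flat_exp (k + 2) t - real k * flat_exp (k + 1) t) (at t)"
      using 2 by (auto simp: flat_exp_def)
    then show ?thesis
      by (rule DERIV_cong_ev[THEN iffD1, rotated -1, OF _ refl _ refl])
         (use 2 in \<open>auto simp: flat_exp_def intro!: eventually_mono[OF eventually_nhds_in_open[of "{..<0}"]]\<close>)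
  next
    case 3
    \<comment> \<open>On the right of the origin the difference quotient is the next member of the family.\<close>
    have "((\<lambda>h. flat_exp k h / h) \<longlongrightarrow> 0) (at_right 0)"
      by (rule Lim_transform_eventually[OF flat_exp_tendsto_0[of "k + 1"]])
         (auto simp: flat_exp_def field_simps intro!: eventually_mono[OF eventually_at_right_less[of 0]])
    moreover have "((\<lambda>h. flat_exp k h / h) \<longlongrightarrow> 0) (at_left 0)"
      by (rule Lim_transform_eventually[OF tendsto_const])
         (auto simp: flat_exp_def eventually_at_left_field intro!: exI[of _ "-1"])
    ultimately have "((\<lambda>h. flat_exp k h / h) \<longlongrightarrow> 0) (at 0)"
      by (simp add: filterlim_at_split)
    then show ?thesis
      using 3 by (simp add: DERIV_def flat_exp_def)
  qed
qed

lemma smooth_flat_exp: "smooth (flat_exp k)"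
proof -
  have d: "dir_deriv 1 (flat_exp k) = (\<lambda>t. flat_exp (k + 2) t + (- real k) * flat_exp (k + 1) t)" for k
    by (rule ext, subst dir_deriv_eq[OF flat_exp_has_derivative[unfolded has_field_derivative_def]]) simp
  have diff: "flat_exp k differentiable_on UNIV" for k
    using flat_exp_has_derivative[of k]
    by (auto simp: differentiable_on_def real_differentiable_def)
  have "times_differentiable n (flat_exp k)" for n k
  proof (induction n arbitrary: k)
    case (Suc n)
    have "times_differentiable n (\<lambda>t. flat_exp (k + 2) t + (- real k) * flat_exp (k + 1) t)"
      by (intro times_differentiable_add times_differentiable_mult times_differentiable_const Suc)
    with Suc show ?case by (simp add: diff d[unfolded One_nat_def])
  qed (simp add: diff)
  then show ?thesis by (simp add: smooth_iff_times_differentiable)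
qed

lemma flat_exp_nonneg: "flat_exp k t \<ge> 0" by (simp add: flat_exp_def)
lemma flat_exp_0_le_1: "flat_exp 0 t \<le> 1" by (simp add: flat_exp_def)
lemma flat_exp_pos_iff: "flat_exp k t > 0 \<longleftrightarrow> t > 0" by (simp add: flat_exp_def)
lemma flat_exp_eq_0_iff: "flat_exp k t = 0 \<longleftrightarrow> t \<le> 0" by (simp add: flat_exp_def)

section \<open>Test functions and the fundamental lemma\<close>

lemma test_functionI:
  assumes "smooth \<phi>" "compact C" "C \<subseteq> U" "\<And>x. x \<notin> C \<Longrightarrow> \<phi> x = 0"
  shows "test_function U \<phi>"
proof -
  have "closure {x. \<phi> x \<noteq> 0} \<subseteq> C"
    using assms by (intro closure_minimal) (auto intro: compact_imp_closed)
  moreover have "compact (closure {x. \<phi> x \<noteq> 0})"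
    using calculation assms(2) by (metis closed_closure compact_Int_closed inf.absorb_iff2)
  ultimately show ?thesis
    using assms by (auto simp: test_function_def)
qed

lemma dir_deriv_outside_support:
  assumes "x \<notin> closure {x. f x \<noteq> 0}"
  shows "dir_deriv b f x = 0"
proof -
  have "((\<lambda>x. 0) has_derivative (\<lambda>_. 0)) (at x)" by simp
  then have "(f has_derivative (\<lambda>_. 0)) (at x)"
    by (rule has_derivative_transform_within_open[of _ _ _ _ "- closure {x. f x \<noteq> 0}"])
       (use assms closure_subset[of "{x. f x \<noteq> 0}"] in auto)
  then show ?thesis by (rule dir_deriv_eq)
qed

lemma test_function_dir_deriv:
  assumes "test_function U \<phi>" "b \<in> Basis"
  shows "test_function U (dir_deriv b \<phi>)"
  by (rule test_functionI[where C = "closure {x. \<phi> x \<noteq> 0}"])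
     (use assms in \<open>auto simp: test_function_def smooth_dir_deriv dir_deriv_outside_support\<close>)

lemma test_function_support:
  assumes "test_function U \<phi>"
  obtains C where "compact C" "C \<subseteq> U" "\<And>x. x \<notin> C \<Longrightarrow> \<phi> x = 0"
proof
  show "\<phi> x = 0" if "x \<notin> closure {x. \<phi> x \<noteq> 0}" for x
    using that closure_subset[of "{x. \<phi> x \<noteq> 0}"] by auto
qed (use assms in \<open>auto simp: test_function_def\<close>)

lemma test_function_bounded:
  assumes "test_function U \<phi>"
  obtains M where "M > 0" "\<And>x. \<bar>\<phi> x\<bar> \<le> M"
proof -
  obtain C where C: "compact C" "\<And>x. x \<notin> C \<Longrightarrow> \<phi> x = 0"
    using test_function_support[OF assms] by metis
  have "continuous_on C \<phi>"
    using assms by (simp add: test_function_def smooth_imp_continuous_on)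
  from compact_imp_bounded[OF compact_continuous_image[OF this C(1)]]
  obtain B where "B > 0" "\<And>x. x \<in> C \<Longrightarrow> \<bar>\<phi> x\<bar> \<le> B"
    by (auto simp: bounded_pos)
  then have "\<bar>\<phi> x\<bar> \<le> B" for x
    using C(2)[of x] by (cases "x \<in> C") auto
  with \<open>B > 0\<close> show ?thesis by (rule that)
qed

lemma continuous_borel_measurable_lebesgue:
  fixes f :: "'a::euclidean_space \<Rightarrow> 'b::euclidean_space"
  assumes "continuous_on UNIV f"
  shows "f \<in> borel_measurable lebesgue"
  by (intro measurable_completion) (simp add: borel_measurable_continuous_onI assms)

lemma smooth_borel_measurable [measurable_dest]:
  "smooth f \<Longrightarrow> f \<in> borel_measurable borel"
  by (intro borel_measurable_continuous_onI smooth_imp_continuous_on)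

lemma integrable_mult_test_function:
  fixes f :: "'a::euclidean_space \<Rightarrow> real"
  assumes "locally_integrable f" "test_function U \<phi>"
  shows "integrable lebesgue (\<lambda>x. f x * \<phi> x)"
proof -
  obtain C where C: "compact C" "\<And>x. x \<notin> C \<Longrightarrow> \<phi> x = 0"
    using test_function_support[OF assms(2)] by metis
  obtain M where M: "M > 0" "\<And>x. \<bar>\<phi> x\<bar> \<le> M"
    using test_function_bounded[OF assms(2)] by metis
  have f: "integrable lebesgue (\<lambda>x. indicator C x * f x)"
    using assms(1) C(1) by (auto simp: locally_integrable_def set_integrable_def)
  have "\<phi> \<in> borel_measurable lebesgue"
    using assms(2)
    by (intro continuous_borel_measurable_lebesgue)
       (simp add: test_function_def smooth_imp_continuous_on)
  then have "integrable lebesgue (\<lambda>x. (indicator C x * f x) * \<phi> x)"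
    using f M
    by (intro Bochner_Integration.integrable_bound[OF integrable_mult_right[OF f, of M]]
          borel_measurable_times borel_measurable_integrable[OF f])
       (auto simp: abs_mult mult.commute intro!: mult_right_mono)
  moreover have "(indicator C x * f x) * \<phi> x = f x * \<phi> x" for x
    using C(2)[of x] by (auto simp: indicator_def)
  ultimately show ?thesis by simp
qed

lemma continuous_imp_locally_integrable:
  fixes f :: "'a::euclidean_space \<Rightarrow> 'b::euclidean_space"
  assumes "continuous_on UNIV f"
  shows "locally_integrable f"
  unfolding locally_integrable_def set_integrable_def
proof (intro allI impI)
  fix C :: "'a set" assume "compact C"
  then have "integrable lborel (\<lambda>x. indicator C x *\<^sub>R f x)"
    using borel_integrable_compact[of C f] assms
    by (simp add: continuous_on_subset indicator_scaleR_eq_if)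
  then show "integrable lebesgue (\<lambda>x. indicator C x *\<^sub>R f x)"
    by (simp add: integrable_completion borel_measurable_integrable)
qed

text \<open>
  For fixed \<open>k\<close> this is a test function, and for \<open>k \<rightarrow> \<infinity>\<close> it tends to the indicator of the open box
  while staying between 0 and 1.
\<close>

definition box_bump :: "nat \<Rightarrow> 'a \<Rightarrow> 'a \<Rightarrow> 'a::euclidean_space \<Rightarrow> real" where
  "box_bump k l r x =
     (\<Prod>b\<in>Basis. flat_exp 0 (real k * (x \<bullet> b - l \<bullet> b)) * flat_exp 0 (real k * (r \<bullet> b - x \<bullet> b)))"

lemma box_bump_outside:
  assumes "x \<notin> cbox l r"
  shows "box_bump k l r x = 0"
proof -
  obtain b where "b \<in> Basis" "x \<bullet> b < l \<bullet> b \<or> r \<bullet> b < x \<bullet> b"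
    using assms by (auto simp: mem_box not_le)
  then show ?thesis unfolding box_bump_def
    by (intro prod_zero) (auto simp: flat_exp_eq_0_iff mult_nonneg_nonpos intro!: bexI[of _ b])
qed

lemma test_function_box_bump:
  fixes l r :: "'a::euclidean_space"
  shows "test_function UNIV (box_bump k l r)"
proof (rule test_functionI[where C = "cbox l r"])
  have "smooth (\<lambda>x::'a. flat_exp 0 (- real k * (l \<bullet> b) + real k * (x \<bullet> b)) *
      flat_exp 0 (real k * (r \<bullet> b) + (- real k) * (x \<bullet> b)))" for b
    by (intro smooth_mult smooth_affine smooth_flat_exp)
       (auto intro!: linearI simp: inner_simps algebra_simps)
  then show "smooth (box_bump k l r)"
    unfolding box_bump_def[abs_def] by (intro smooth_prod) (simp add: algebra_simps)
qed (auto simp: box_bump_outside)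

lemma box_bump_bounds: "0 \<le> box_bump k l r x" "box_bump k l r x \<le> 1"
  unfolding box_bump_def
  by (auto intro!: prod_nonneg prod_le_1 mult_le_one simp: flat_exp_nonneg flat_exp_0_le_1)

lemma flat_exp_dilate_tendsto:
  "(\<lambda>k. flat_exp 0 (real k * s)) \<longlonglongrightarrow> (if s > 0 then 1 else 0)"
proof (cases "s > 0")
  case True
  have "(\<lambda>k. exp (- (inverse (real k) * inverse s))) \<longlonglongrightarrow> exp (- (0 * inverse s))"
    by (intro tendsto_intros lim_inverse_n)
  then have "(\<lambda>k. exp (- inverse (real k * s))) \<longlonglongrightarrow> 1"
    by (simp add: inverse_mult_distrib)
  then have "(\<lambda>k. flat_exp 0 (real k * s)) \<longlonglongrightarrow> 1"
    by (rule Lim_transform_eventually)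
       (use True in \<open>auto simp: flat_exp_def intro!: eventually_mono[OF eventually_gt_at_top[of 0]]\<close>)
  then show ?thesis using True by simp
next
  case False
  then have "real k * s \<le> 0" for k by (simp add: mult_nonneg_nonpos)
  then have "flat_exp 0 (real k * s) = 0" for k by (simp add: flat_exp_eq_0_iff)
  then show ?thesis using False by simp
qed

lemma box_bump_tendsto_indicator:
  "(\<lambda>k. box_bump k l r x) \<longlonglongrightarrow> indicator (box l r) x"
proof -
  have "(\<lambda>k. box_bump k l r x) \<longlonglongrightarrow>
      (\<Prod>b\<in>Basis. (if x \<bullet> b - l \<bullet> b > 0 then 1 else 0) * (if r \<bullet> b - x \<bullet> b > 0 then 1 else 0))"
    unfolding box_bump_def by (intro tendsto_prod tendsto_mult flat_exp_dilate_tendsto)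
  also have "(\<Prod>b\<in>Basis. (if x \<bullet> b - l \<bullet> b > 0 then 1 else 0) * (if r \<bullet> b - x \<bullet> b > 0 then 1 else 0))
      = (indicator (box l r) x :: real)"
  proof (cases "x \<in> box l r")
    case False
    then obtain b where "b \<in> Basis" "\<not> (l \<bullet> b < x \<bullet> b \<and> x \<bullet> b < r \<bullet> b)"
      by (auto simp: mem_box)
    then show ?thesis using False by (auto intro!: prod_zero bexI[of _ b])
  qed (auto simp: mem_box)
  finally show ?thesis .
qed

text \<open>
  Open boxes are stable under intersection and generate the Borel sets, so the integral of \<open>h\<close>
  vanishes on every Borel set. The hypothesis on the total integral serves for complements.
\<close>

lemma integral_box_zero_imp_AE_zero:
  fixes h :: "'a::euclidean_space \<Rightarrow> real"
  assumes h: "integrable lborel h"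
    and box0: "\<And>l r. (LINT x|lborel. indicator (box l r) x * h x) = 0"
    and tot: "(LINT x|lborel. h x) = 0"
  shows "AE x in lborel. h x = 0"
proof (rule sigma_finite_measure.density_zero[OF sigma_finite_lborel h])
  fix A :: "'a set" assume "A \<in> sets lborel"
  then have *: "A \<in> sigma_sets UNIV (range (\<lambda>(a, b). box a b))"
    by (simp add: borel_eq_box)
  have "Int_stable (range (\<lambda>(a, b). box a b :: 'a set))"
  proof (rule Int_stableI)
    fix A B :: "'a set"
    assume "A \<in> range (\<lambda>(a, b). box a b)" "B \<in> range (\<lambda>(a, b). box a b)"
    then obtain a b c d where "A = box a b" "B = box c d" by auto
    then show "A \<inter> B \<in> range (\<lambda>(a, b). box a b)"
      unfolding box_Int_box by (simp add: box_Int_box) blast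
  qed
  moreover have "range (\<lambda>(a, b). box a b :: 'a set) \<subseteq> Pow UNIV" by simp
  ultimately show "set_lebesgue_integral lborel A h = 0" using *
  proof (induction rule: sigma_sets_induct_disjoint)
    case (compl A)
    then have A: "A \<in> sets lborel" by (simp add: borel_eq_box)
    have "set_lebesgue_integral lborel (UNIV - A) h = (LINT x|lborel. h x - indicator A x * h x)"
      unfolding set_lebesgue_integral_def
      by (intro Bochner_Integration.integral_cong) (auto simp: indicator_def)
    also have "\<dots> = 0"
      using compl(2) tot h A integrable_mult_indicator[OF A h]
      by (subst Bochner_Integration.integral_diff) (auto simp: set_lebesgue_integral_def)
    finally show ?case .
  next
    case (union A)
    then have A: "A i \<in> sets lborel" for i by (auto simp: borel_eq_box)
    have "set_integrable lborel (\<Union>i. A i) h"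
      unfolding set_integrable_def using A
      by (intro integrable_mult_indicator h) auto
    then show ?case
      using union A by (subst lebesgue_integral_countable_add) (auto simp: disjoint_family_on_def)
  qed (use box0 in \<open>auto simp: set_lebesgue_integral_def\<close>)
qed

text \<open>
  The fundamental lemma of the calculus of variations: test functions converge boundedly to
  indicators of boxes, and integrals over boxes determine a function.
\<close>

lemma locally_integrable_AE_zeroI:
  fixes h :: "'a::euclidean_space \<Rightarrow> real"
  assumes h: "locally_integrable h"
    and h0: "\<And>\<phi>. test_function UNIV \<phi> \<Longrightarrow> (LINT x|lebesgue. h x * \<phi> x) = 0"
  shows "AE x in lebesgue. h x = 0"
proof -
  have int: "integrable lebesgue (\<lambda>x. indicator (box l r) x * h x)" for l r :: 'a
  proof -
    have "set_integrable lebesgue (cbox l r) h"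
      using h by (auto simp: locally_integrable_def)
    then have "set_integrable lebesgue (box l r) h"
      by (rule set_integrable_subset) (auto simp: box_subset_cbox)
    then show ?thesis by (simp add: set_integrable_def)
  qed
  have intc: "integrable lebesgue (\<lambda>x. indicator (cbox l r) x * h x)" for l r :: 'a
    using h by (auto simp: locally_integrable_def set_integrable_def)
  have box0: "(LINT x|lebesgue. indicator (box l r) x * h x) = 0" for l r :: 'a
  proof -
    have "(\<lambda>k. LINT x|lebesgue. h x * box_bump k l r x) \<longlonglongrightarrow>
        (LINT x|lebesgue. indicator (box l r) x * h x)"
    proof (rule integral_dominated_convergence[where w = "\<lambda>x. \<bar>indicator (cbox l r) x * h x\<bar>"])
      show "AE x in lebesgue. (\<lambda>k. h x * box_bump k l r x) \<longlonglongrightarrow> indicator (box l r) x * h x"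
        by (subst mult.commute) (intro AE_I2 tendsto_mult box_bump_tendsto_indicator tendsto_const)
      show "AE x in lebesgue. norm (h x * box_bump k l r x) \<le> \<bar>indicator (cbox l r) x * h x\<bar>" for k
      proof (rule AE_I2)
        fix x
        have "box_bump k l r x = 0" if "x \<notin> cbox l r"
          using that by (rule box_bump_outside)
        then show "norm (h x * box_bump k l r x) \<le> \<bar>indicator (cbox l r) x * h x\<bar>"
          using box_bump_bounds[of k l r x]
          by (cases "x \<in> cbox l r") (auto simp: abs_mult mult_left_le)
      qed
    qed (use int intc borel_measurable_integrable integrable_mult_test_function[OF h test_function_box_bump] in auto)
    moreover have "(LINT x|lebesgue. h x * box_bump k l r x) = 0" for k
      by (rule h0[OF test_function_box_bump])
    ultimately show ?thesis by (simp add: LIMSEQ_const_iff)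
  qed
  have "AE x in lebesgue. indicator (box l r) x * h x = 0" for l r :: 'a
  proof -
    \<comment> \<open>The restriction of \<open>h\<close> to a box is integrable and is replaced by a Borel representative.\<close>
    define g where "g x = indicator (box l r) x * h x" for x
    have g: "integrable lebesgue g" using int unfolding g_def .
    obtain g' where g': "g' \<in> borel_measurable lborel" "AE x in lborel. g x = g' x"
      using completion_ex_borel_measurable_real[OF borel_measurable_integrable[OF g]] by auto
    have g'': "AE x in lebesgue. g x = g' x"
      using g'(2) by (rule AE_completion)
    have mg': "g' \<in> borel_measurable lebesgue" using g'(1) by (rule measurable_completion)
    have ig': "integrable lborel g'"
      using integrable_cong_AE[OF borel_measurable_integrable[OF g] mg' g''] g g'(1)
      by (simp add: integrable_completion)
    have *: "(LINT x|lborel. indicator (box a b) x * g' x) = 0" for a b :: 'a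
    proof -
      have "(LINT x|lborel. indicator (box a b) x * g' x) = (LINT x|lebesgue. indicator (box a b) x * g' x)"
        by (rule integral_completion[symmetric]) (use g' in measurable)
      also have "\<dots> = (LINT x|lebesgue. indicator (box a b) x * g x)"
        by (rule integral_cong_AE)
           (use g'' in \<open>auto intro!: borel_measurable_times mg' borel_measurable_integrable[OF g]
              borel_measurable_indicator\<close>)
      also have "\<dots> = (LINT x|lebesgue. indicator (box a b \<inter> box l r) x * h x)"
        by (auto simp: g_def indicator_def intro!: Bochner_Integration.integral_cong)
      also have "\<dots> = 0" unfolding box_Int_box by (rule box0)
      finally show ?thesis .
    qed
    have "(LINT x|lborel. g' x) = (LINT x|lebesgue. g' x)"
      by (rule integral_completion[symmetric]) (use g' in measurable)
    also have "\<dots> = (LINT x|lebesgue. g x)"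
      by (rule integral_cong_AE) (use g'' in \<open>auto intro!: mg' borel_measurable_integrable[OF g]\<close>)
    also have "\<dots> = 0" using box0 by (simp add: g_def)
    finally have "AE x in lborel. g' x = 0"
      by (rule integral_box_zero_imp_AE_zero[OF ig' *])
    then have "AE x in lebesgue. g' x = 0" by (rule AE_completion)
    with g'' show ?thesis unfolding g_def by eventually_elim simp
  qed
  then have "AE x in lebesgue. \<forall>N::nat. indicator (box (- real N *\<^sub>R One) (real N *\<^sub>R One)) x * h x = 0"
    by (subst AE_all_countable) auto
  then show ?thesis
  proof eventually_elim
    case (elim x)
    obtain N :: nat where N: "norm x < real N" using reals_Archimedean2 by blast
    have "x \<in> box (- real N *\<^sub>R One) (real N *\<^sub>R One)"
      using N Basis_le_norm[where x = x] by (force simp: mem_box inner_sum_left_Basis abs_le_iff)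
    then show ?case using elim[rule_format, of N] by auto
  qed
qed

lemma locally_integrable_inner:
  fixes G :: "'a::euclidean_space \<Rightarrow> 'b::euclidean_space"
  assumes "locally_integrable G"
  shows "locally_integrable (\<lambda>x. G x \<bullet> b)"
  unfolding locally_integrable_def
proof (intro allI impI)
  fix C :: "'a set" assume "compact C"
  then have "G absolutely_integrable_on C"
    using assms by (simp add: locally_integrable_def)
  from absolutely_integrable_linear[OF this bounded_linear_inner_left[of b]]
  show "(\<lambda>x. G x \<bullet> b) absolutely_integrable_on C" by (simp add: o_def)
qed

text \<open>
  The norm of the homogeneous Sobolev space is computed from an arbitrarily chosen weak gradient;
  uniqueness is what makes this choice harmless.
\<close>

lemma weak_gradient_unique:
  fixes f :: "'a::euclidean_space \<Rightarrow> real"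
  assumes G: "weak_gradient f G" and G': "weak_gradient f G'"
  shows "AE x in lebesgue. G x = G' x"
proof -
  have loc: "locally_integrable (\<lambda>x. G x \<bullet> b)" "locally_integrable (\<lambda>x. G' x \<bullet> b)" for b
    using G G' by (simp_all add: weak_gradient_def locally_integrable_inner)
  have "AE x in lebesgue. G x \<bullet> b - G' x \<bullet> b = 0" if b: "b \<in> Basis" for b
  proof (rule locally_integrable_AE_zeroI)
    show "locally_integrable (\<lambda>x. G x \<bullet> b - G' x \<bullet> b)"
      using loc[of b] unfolding locally_integrable_def
      by (auto intro: set_integral_diff)
    fix \<phi> :: "'a \<Rightarrow> real" assume t: "test_function UNIV \<phi>"
    have "(LINT x|lebesgue. (G x \<bullet> b - G' x \<bullet> b) * \<phi> x) =
        (LINT x|lebesgue. (G x \<bullet> b) * \<phi> x) - (LINT x|lebesgue. (G' x \<bullet> b) * \<phi> x)"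
      unfolding left_diff_distrib
      by (intro Bochner_Integration.integral_diff integrable_mult_test_function[OF _ t] loc)
    also have "\<dots> = 0"
      using G G' t b unfolding weak_gradient_def by force
    finally show "(LINT x|lebesgue. (G x \<bullet> b - G' x \<bullet> b) * \<phi> x) = 0" .
  qed
  then have "AE x in lebesgue. \<forall>b\<in>Basis. G x \<bullet> b - G' x \<bullet> b = 0"
    by (subst AE_finite_all) auto
  then show ?thesis
    by eventually_elim (auto intro: euclidean_eqI)
qed

section \<open>Integration by parts and weak derivatives along lines\<close>

lemma
  fixes f :: "'a::euclidean_space \<Rightarrow> 'b::{banach, second_countable_topology}"
  shows lborel_integral_translate: "(LINT x|lborel. f (x + a)) = (LINT x|lborel. f x)"
    and lborel_integrable_translate: "integrable lborel (\<lambda>x. f (x + a)) \<longleftrightarrow> integrable lborel f"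
proof -
  have *: "integrable lborel (\<lambda>x. g (x + c))" if "integrable lborel g" for g :: "'a \<Rightarrow> 'b" and c
  proof -
    have "integrable (distr lborel borel ((+) c)) g" using that by (simp add: lborel_distr_plus)
    from integrable_distr[OF _ this] show ?thesis by (simp add: add.commute)
  qed
  show 1: "integrable lborel (\<lambda>x. f (x + a)) \<longleftrightarrow> integrable lborel f"
    using *[of f a] *[of "\<lambda>x. f (x + a)" "-a"] by auto
  show "(LINT x|lborel. f (x + a)) = (LINT x|lborel. f x)"
  proof (cases "integrable lborel f")
    case True
    have "(LINT x|lborel. f x) = (LINT x|distr lborel borel ((+) a). f x)"
      by (simp add: lborel_distr_plus)
    also have "\<dots> = (LINT x|lborel. f (x + a))"
      using borel_measurable_integrable[OF True] by (subst integral_distr) (auto simp: add.commute)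
    finally show ?thesis by simp
  next
    case False
    then show ?thesis using 1 by (simp add: not_integrable_integral_eq)
  qed
qed

lemma nn_integral_lborel_translate:
  assumes [measurable]: "f \<in> borel_measurable borel"
  shows "(\<integral>\<^sup>+x. f (x + a) \<partial>lborel) = (\<integral>\<^sup>+x. f x \<partial>lborel)"
proof -
  have "(\<integral>\<^sup>+x. f x \<partial>lborel) = (\<integral>\<^sup>+x. f x \<partial>distr lborel borel ((+) a))"
    by (simp add: lborel_distr_plus)
  also have "\<dots> = (\<integral>\<^sup>+x. f (x + a) \<partial>lborel)"
    by (subst nn_integral_distr) (auto simp: add.commute)
  finally show ?thesis by simp
qed

lemma integrable_pair_times:
  fixes f :: "'a::euclidean_space \<Rightarrow> real" and g :: "'b::euclidean_space \<Rightarrow> real"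
  assumes "integrable lborel f" "integrable lborel g"
  shows "integrable (lborel \<Otimes>\<^sub>M lborel) (\<lambda>(x, y). f x * g y)"
proof (rule lborel_pair.Fubini_integrable)
  have [measurable]: "f \<in> borel_measurable borel" "g \<in> borel_measurable borel"
    using assms[THEN borel_measurable_integrable] by auto
  show "(\<lambda>(x, y). f x * g y) \<in> borel_measurable (lborel \<Otimes>\<^sub>M lborel)" by measurable
qed (use assms in \<open>auto simp: abs_mult\<close>)

text \<open>
  For fixed \<open>s\<close> the substitution is a translation, so Tonelli's theorem with \<open>s\<close> outermost applies.
\<close>

lemma integrable_shear:
  fixes F :: "'a::euclidean_space \<Rightarrow> real \<Rightarrow> real" and b :: 'a
  assumes "integrable (lborel \<Otimes>\<^sub>M lborel) (\<lambda>(x, s). F x s)"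
  shows "integrable (lborel \<Otimes>\<^sub>M lborel) (\<lambda>(x, s). F (x + s *\<^sub>R b) s)"
proof (rule integrableI_bounded)
  have m: "(\<lambda>p. F (fst p) (snd p)) \<in> borel_measurable (borel \<Otimes>\<^sub>M borel)"
    using borel_measurable_integrable[OF assms] by (simp add: split_beta' cong: measurable_cong_sets)
  have m': "(\<lambda>p. F (fst p + snd p *\<^sub>R b) (snd p)) \<in> borel_measurable (borel \<Otimes>\<^sub>M borel)"
    using measurable_compose[OF _ m, of "\<lambda>p. (fst p + snd p *\<^sub>R b, snd p)"] by simp
  show "(\<lambda>(x, s). F (x + s *\<^sub>R b) s) \<in> borel_measurable (lborel \<Otimes>\<^sub>M lborel)"
    using m' by (simp add: split_beta' cong: measurable_cong_sets)
  have ms: "(\<lambda>x. F x s) \<in> borel_measurable borel" for s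
    using measurable_compose[OF _ m, of "\<lambda>x. (x, s)"] by simp
  have "(\<integral>\<^sup>+p. ennreal (norm (case p of (x, s) \<Rightarrow> F (x + s *\<^sub>R b) s)) \<partial>(lborel \<Otimes>\<^sub>M lborel))
      = (\<integral>\<^sup>+s. \<integral>\<^sup>+x. ennreal (norm (F (x + s *\<^sub>R b) s)) \<partial>lborel \<partial>lborel)"
    using m' by (subst lborel_pair.nn_integral_snd[symmetric])
      (auto simp: split_beta' cong: measurable_cong_sets)
  also have "\<dots> = (\<integral>\<^sup>+s. \<integral>\<^sup>+x. ennreal (norm (F x s)) \<partial>lborel \<partial>lborel)"
    using ms by (intro nn_integral_cong nn_integral_lborel_translate) auto
  also have "\<dots> = (\<integral>\<^sup>+p. ennreal (norm (case p of (x, s) \<Rightarrow> F x s)) \<partial>(lborel \<Otimes>\<^sub>M lborel))"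
    using m by (subst lborel_pair.nn_integral_snd[symmetric])
      (auto simp: split_beta' cong: measurable_cong_sets)
  also have "\<dots> < \<infinity>"
    using assms by (simp add: integrable_iff_bounded)
  finally show "(\<integral>\<^sup>+p. ennreal (norm (case p of (x, s) \<Rightarrow> F (x + s *\<^sub>R b) s)) \<partial>(lborel \<Otimes>\<^sub>M lborel)) < \<infinity>" .
qed

lemma integral_derivative_along_line:
  fixes f :: "'a::euclidean_space \<Rightarrow> real"
  assumes diff: "\<And>x. f differentiable (at x)"
    and cont: "continuous_on UNIV (dir_deriv b f)" and "0 \<le> t"
  shows "(LINT s|lborel. indicator {0..t} s * dir_deriv b f (x + s *\<^sub>R b)) = f (x + t *\<^sub>R b) - f x"
proof -
  have "((\<lambda>s. f (x + s *\<^sub>R b)) has_real_derivative dir_deriv b f (x + s *\<^sub>R b)) (at s)" for s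
  proof -
    have "linear (\<lambda>s::real. s *\<^sub>R b)" by (simp add: linearI algebra_simps)
    from has_derivative_affine[OF this diff, of x s]
    have "((\<lambda>s. f (x + s *\<^sub>R b)) has_derivative (\<lambda>h. dir_deriv (h *\<^sub>R b) f (x + s *\<^sub>R b))) (at s)" .
    moreover have "dir_deriv (h *\<^sub>R b) f y = h * dir_deriv b f y" for h y
      using linear_scale[OF has_derivative_linear[OF has_derivative_dir_deriv[OF diff[of y]]], of h b]
      by simp
    ultimately show ?thesis by (simp add: has_field_derivative_def mult_commute_abs)
  qed
  moreover have "isCont (\<lambda>s. dir_deriv b f (x + s *\<^sub>R b)) s" for s
    by (rule isCont_o2[where f = "\<lambda>s. x + s *\<^sub>R b" and g = "dir_deriv b f"])
       (use cont in \<open>auto simp: continuous_on_eq_continuous_at\<close>)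
  ultimately have "(LINT s|lborel. dir_deriv b f (x + s *\<^sub>R b) * indicator {0..t} s)
      = f (x + t *\<^sub>R b) - f (x + 0 *\<^sub>R b)"
    using \<open>0 \<le> t\<close> by (intro integral_FTC_Icc_real)
  then show ?thesis by (simp add: mult.commute)
qed

lemma integrable_compact_support:
  fixes f :: "'a::euclidean_space \<Rightarrow> real"
  assumes "continuous_on UNIV f" "compact C" "\<And>x. x \<notin> C \<Longrightarrow> f x = 0"
  shows "integrable lborel f"
proof -
  have "integrable lborel (\<lambda>x. indicator C x *\<^sub>R f x)"
    by (rule borel_integrable_compact[OF assms(2) continuous_on_subset[OF assms(1)]]) simp
  also have "(\<lambda>x. indicator C x *\<^sub>R f x) = f"
    using assms(3) by (force simp: fun_eq_iff indicator_def)
  finally show ?thesis .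
qed

text \<open>
  The integral of \<open>f (x + b) - f x\<close> vanishes by translation invariance. The integrand is the mean over
  \<open>s\<close> in the unit interval of the derivative at \<open>x + s *\<^sub>R b\<close>, and after exchanging the integrals each
  \<open>s\<close> contributes the same amount.
\<close>

lemma integral_dir_deriv_compact_support:
  fixes f :: "'a::euclidean_space \<Rightarrow> real"
  assumes diff: "\<And>x. f differentiable (at x)" and cont: "continuous_on UNIV (dir_deriv b f)"
    and C: "compact C" "\<And>x. x \<notin> C \<Longrightarrow> f x = 0"
  shows "(LINT x|lborel. dir_deriv b f x) = 0"
proof -
  have "dir_deriv b f x = 0" if "x \<notin> C" for x
  proof -
    have "closure {x. f x \<noteq> 0} \<subseteq> C"
      using C by (intro closure_minimal) (auto intro: compact_imp_closed)
    with that show ?thesis by (auto intro: dir_deriv_outside_support)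
  qed
  then have D: "integrable lborel (dir_deriv b f)"
    by (rule integrable_compact_support[OF cont C(1)])
  have f: "integrable lborel f"
    by (rule integrable_compact_support[OF _ C])
       (use diff differentiable_imp_continuous_within in \<open>auto simp: continuous_on_eq_continuous_within\<close>)
  have "integrable (lborel \<Otimes>\<^sub>M lborel) (\<lambda>(x, s). dir_deriv b f x * indicator {0..1::real} s)"
    by (rule integrable_pair_times[OF D]) simp
  then have I: "integrable (lborel \<Otimes>\<^sub>M lborel) (\<lambda>(x, s). dir_deriv b f (x + s *\<^sub>R b) * indicator {0..1::real} s)"
    by (rule integrable_shear)
  have "0 = (LINT x|lborel. f (x + 1 *\<^sub>R b) - f x)"
    using f by (subst Bochner_Integration.integral_diff)
      (simp_all add: lborel_integral_translate lborel_integrable_translate del: scaleR_one)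
  also have "\<dots> = (LINT x|lborel. LINT s|lborel. dir_deriv b f (x + s *\<^sub>R b) * indicator {0..1} s)"
    using integral_derivative_along_line[OF diff cont, of 1] by (simp add: mult.commute)
  also have "\<dots> = (LINT s|lborel. LINT x|lborel. dir_deriv b f (x + s *\<^sub>R b) * indicator {0..1} s)"
    using lborel_pair.Fubini_integral[OF I] by simp
  also have "\<dots> = (LINT s|lborel. (LINT x|lborel. dir_deriv b f x) * indicator {0..1::real} s)"
    by (simp add: lborel_integral_translate)
  also have "\<dots> = (LINT x|lborel. dir_deriv b f x)" by simp
  finally show ?thesis by simp
qed

lemma integral_by_parts_test_function:
  fixes f :: "'a::euclidean_space \<Rightarrow> real"
  assumes diff: "\<And>x. f differentiable (at x)" and cont: "continuous_on UNIV (dir_deriv b f)"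
    and t: "test_function UNIV \<phi>" and b: "b \<in> Basis"
  shows "(LINT x|lebesgue. f x * dir_deriv b \<phi> x) = - (LINT x|lebesgue. dir_deriv b f x * \<phi> x)"
proof -
  have \<phi>: "smooth \<phi>" using t by (simp add: test_function_def)
  obtain C where C: "compact C" "\<And>x. x \<notin> C \<Longrightarrow> \<phi> x = 0"
    using test_function_support[OF t] by metis
  have cf: "continuous_on UNIV f"
    using diff differentiable_imp_continuous_within by (auto simp: continuous_on_eq_continuous_within)
  have eq: "dir_deriv b (\<lambda>x. f x * \<phi> x) = (\<lambda>x. f x * dir_deriv b \<phi> x + dir_deriv b f x * \<phi> x)"
    by (rule ext, rule dir_deriv_mult) (auto simp: diff smooth_imp_differentiable[OF \<phi>])
  have "(LINT x|lborel. dir_deriv b (\<lambda>x. f x * \<phi> x) x) = 0"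
  proof (rule integral_dir_deriv_compact_support[OF _ _ C(1)])
    show "continuous_on UNIV (dir_deriv b (\<lambda>x. f x * \<phi> x))"
      unfolding eq by (intro continuous_intros cf cont smooth_imp_continuous_on smooth_dir_deriv \<phi> b)
  qed (auto simp: C diff smooth_imp_differentiable[OF \<phi>] intro!: differentiable_mult)
  moreover have "(\<lambda>x. f x * dir_deriv b \<phi> x + dir_deriv b f x * \<phi> x) \<in> borel_measurable borel"
    by (intro borel_measurable_continuous_onI continuous_intros cf cont smooth_imp_continuous_on
        smooth_dir_deriv \<phi> b)
  ultimately have "(LINT x|lebesgue. f x * dir_deriv b \<phi> x + dir_deriv b f x * \<phi> x) = 0"
    unfolding eq by (subst integral_completion) auto
  then show ?thesis
    using integrable_mult_test_function[OF continuous_imp_locally_integrable[OF cf] test_function_dir_deriv[OF t b]]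
      integrable_mult_test_function[OF continuous_imp_locally_integrable[OF cont] t]
    by simp
qed

text \<open>
  Tested against \<open>\<phi>\<close>, the increment of \<open>f\<close> becomes an increment of \<open>\<phi>\<close>, that is, an integral of
  translated derivatives of \<open>\<phi>\<close>. The weak derivative moves these to \<open>g\<close>, and the fundamental lemma
  removes \<open>\<phi>\<close>. In this way functions with a weak derivative are seen to be absolutely continuous on
  almost every line without regularising them.
\<close>

lemma weak_derivative_along_lines:
  fixes f g :: "'a::euclidean_space \<Rightarrow> real"
  assumes f: "f \<in> borel_measurable borel" "\<And>C. compact C \<Longrightarrow> integrable lborel (\<lambda>x. indicator C x * f x)"
    and g: "g \<in> borel_measurable borel" "\<And>C. compact C \<Longrightarrow> integrable lborel (\<lambda>x. indicator C x * g x)"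
    and weak: "\<And>\<phi>. test_function UNIV \<phi> \<Longrightarrow>
      (LINT x|lborel. f x * dir_deriv b \<phi> x) = - (LINT x|lborel. g x * \<phi> x)"
    and b: "b \<in> Basis" and t: "0 \<le> t"
  shows "AE x in lborel. f (x + t *\<^sub>R b) - f x = (LINT s|lborel. indicator {0..t} s * g (x + s *\<^sub>R b))"
    and "AE x in lborel. integrable lborel (\<lambda>s. indicator {0..t} s * g (x + s *\<^sub>R b))"
proof -
  note [measurable] = f(1) g(1)
  have joint': "integrable (lborel \<Otimes>\<^sub>M lborel) (\<lambda>(x, s). h x * (\<psi> (x - s *\<^sub>R b) * indicator {0..t} s))"
    if [measurable]: "h \<in> borel_measurable borel" "\<psi> \<in> borel_measurable borel"
      and h: "\<And>C. compact C \<Longrightarrow> integrable lborel (\<lambda>x. indicator C x * h x)"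
      and C: "compact C" "\<And>x. x \<notin> C \<Longrightarrow> \<psi> x = 0" and M: "\<And>x. \<bar>\<psi> x\<bar> \<le> M"
    for h \<psi> :: "'a \<Rightarrow> real" and C M
  proof -
    \<comment> \<open>The set swept out by the support of \<open>\<psi>\<close> under the translations; it carries the integrand.\<close>
    define C' where "C' = (\<lambda>(x, s). x + s *\<^sub>R b) ` (C \<times> {0..t})"
    have "compact C'" unfolding C'_def split_beta
      by (intro compact_continuous_image compact_Times C compact_Icc continuous_intros)
    from h[OF this] have "integrable lborel (\<lambda>x. M * \<bar>indicator C' x * h x\<bar>)"
      by (intro integrable_mult_right integrable_abs)
    moreover have "integrable lborel (indicator {0..t} :: real \<Rightarrow> real)"
      by (rule integrable_real_indicator) (simp_all add: emeasure_lborel_Icc_eq)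
    ultimately have *: "integrable (lborel \<Otimes>\<^sub>M lborel)
        (\<lambda>(x, s). M * \<bar>indicator C' x * h x\<bar> * indicator {0..t} s)"
      by (rule integrable_pair_times)
    show ?thesis
    proof (rule Bochner_Integration.integrable_bound[OF *])
      have "\<bar>h x * (\<psi> (x - s *\<^sub>R b) * indicator {0..t} s)\<bar>
          \<le> \<bar>M * \<bar>indicator C' x * h x\<bar> * indicator {0..t} s\<bar>" for x s
      proof (cases "s \<in> {0..t} \<and> x - s *\<^sub>R b \<in> C")
        case True
        then have "(x - s *\<^sub>R b) + s *\<^sub>R b \<in> C'" unfolding C'_def by (auto intro!: image_eqI[of _ _ "(x - s *\<^sub>R b, s)"])
        moreover have "M \<ge> 0" using M[of x] by linarith
        ultimately show ?thesis using True M[of "x - s *\<^sub>R b"]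
          by (auto simp: abs_mult mult.commute[of M] intro!: mult_left_mono)
      qed (use C(2)[of "x - s *\<^sub>R b"] in \<open>auto simp: indicator_def\<close>)
      then show "AE p in lborel \<Otimes>\<^sub>M lborel. norm (case p of (x, s) \<Rightarrow> h x * (\<psi> (x - s *\<^sub>R b) * indicator {0..t} s))
          \<le> norm (case p of (x, s) \<Rightarrow> M * \<bar>indicator C' x * h x\<bar> * indicator {0..t} s)"
        by (intro AE_I2) auto
    qed measurable
  qed
  have joint: "integrable (lborel \<Otimes>\<^sub>M lborel) (\<lambda>(x, s). \<psi> x * (indicator {0..t} s * g (x + s *\<^sub>R b)))"
    if "\<psi> \<in> borel_measurable borel"
      and C: "compact C" "\<And>x. x \<notin> C \<Longrightarrow> \<psi> x = 0" and M: "\<And>x. \<bar>\<psi> x\<bar> \<le> M"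
    for \<psi> :: "'a \<Rightarrow> real" and C M
    using integrable_shear[OF joint'[OF g(1) that(1) g(2) C M], of b]
    by (simp add: ac_simps)
  define A where "A x = (LINT s|lborel. indicator {0..t} s * g (x + s *\<^sub>R b))" for x
  have A_int: "integrable lborel (\<lambda>x. \<psi> x * A x)"
    if "\<psi> \<in> borel_measurable borel"
      and C: "compact C" "\<And>x. x \<notin> C \<Longrightarrow> \<psi> x = 0" and M: "\<And>x. \<bar>\<psi> x\<bar> \<le> M"
    for \<psi> :: "'a \<Rightarrow> real" and C M
    using lborel_pair.integrable_fst[OF joint[OF that]] unfolding A_def by simp
  have A_meas [measurable]: "A \<in> borel_measurable borel"
    unfolding A_def by measurable
  have loc: "locally_integrable (\<lambda>x. f (x + t *\<^sub>R b) - f x - A x)"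
    unfolding locally_integrable_def set_integrable_def
  proof (intro allI impI)
    fix C :: "'a set" assume C: "compact C"
    have [measurable]: "C \<in> sets borel" using C by (simp add: borel_compact)
    have CC: "compact ((\<lambda>x. x + t *\<^sub>R b) ` C)"
      by (intro compact_continuous_image C continuous_intros)
    have "integrable lborel (\<lambda>x. indicator ((\<lambda>x. x + t *\<^sub>R b) ` C) (x + t *\<^sub>R b) * f (x + t *\<^sub>R b))"
      using lborel_integrable_translate[of "\<lambda>x. indicator ((\<lambda>x. x + t *\<^sub>R b) ` C) x * f x" "t *\<^sub>R b"] f(2)[OF CC]
      by simp
    moreover have "indicator ((\<lambda>x. x + t *\<^sub>R b) ` C) (x + t *\<^sub>R b) = (indicator C x :: real)" for x
      by (auto simp: indicator_def)
    moreover have "integrable lborel (\<lambda>x. indicator C x * A x)"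
      by (rule A_int[OF _ C, of _ 1]) auto
    ultimately have "integrable lborel (\<lambda>x. indicator C x * f (x + t *\<^sub>R b) - indicator C x * f x - indicator C x * A x)"
      using f(2)[OF C] by auto
    then show "integrable lebesgue (\<lambda>x. indicat_real C x *\<^sub>R (f (x + t *\<^sub>R b) - f x - A x))"
      by (subst integrable_completion) (auto simp: algebra_simps)
  qed
  have "AE x in lebesgue. f (x + t *\<^sub>R b) - f x - A x = 0"
  proof (rule locally_integrable_AE_zeroI[OF loc])
    fix \<phi> :: "'a \<Rightarrow> real" assume test: "test_function UNIV \<phi>"
    then have \<phi>: "smooth \<phi>" by (simp add: test_function_def)
    obtain C where C: "compact C" "\<And>x. x \<notin> C \<Longrightarrow> \<phi> x = 0"
      using test_function_support[OF test] by metis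
    obtain M where M: "\<And>x. \<bar>\<phi> x\<bar> \<le> M"
      using test_function_bounded[OF test] by metis
    note test' = test_function_dir_deriv[OF test b]
    obtain C' where C': "compact C'" "\<And>x. x \<notin> C' \<Longrightarrow> dir_deriv b \<phi> x = 0"
      using test_function_support[OF test'] by metis
    obtain M' where M': "\<And>x. \<bar>dir_deriv b \<phi> x\<bar> \<le> M'"
      using test_function_bounded[OF test'] by metis
    have [measurable]: "\<phi> \<in> borel_measurable borel" using \<phi> by measurable
    have m' [measurable]: "dir_deriv b \<phi> \<in> borel_measurable borel" using smooth_dir_deriv[OF \<phi> b] by measurable
    have shift_test: "test_function UNIV (\<lambda>x. \<phi> (x - s *\<^sub>R b))" for s
    proof (rule test_functionI[where C = "(\<lambda>x. x + s *\<^sub>R b) ` C"])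
      show "smooth (\<lambda>x. \<phi> (x - s *\<^sub>R b))"
        using smooth_affine[OF linear_ident \<phi>, of "- s *\<^sub>R b"] by simp
      show "compact ((\<lambda>x. x + s *\<^sub>R b) ` C)"
        by (intro compact_continuous_image C continuous_intros)
      show "\<phi> (x - s *\<^sub>R b) = 0" if "x \<notin> (\<lambda>x. x + s *\<^sub>R b) ` C" for x
        using that C(2)[of "x - s *\<^sub>R b"] by (metis diff_add_cancel imageI)
    qed simp
    have shift_deriv: "dir_deriv b (\<lambda>x. \<phi> (x - s *\<^sub>R b)) = (\<lambda>x. dir_deriv b \<phi> (x - s *\<^sub>R b))" for s
      using dir_deriv_affine[OF linear_ident smooth_imp_differentiable[OF \<phi>], of b "- s *\<^sub>R b"]
      by (auto simp: fun_eq_iff)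
    have lint: "integrable lborel (\<lambda>x. f x * \<psi> x)" if "test_function UNIV \<psi>" for \<psi>
    proof -
      obtain C where C: "compact C" "\<And>x. x \<notin> C \<Longrightarrow> \<psi> x = 0"
        using test_function_support[OF \<open>test_function UNIV \<psi>\<close>] by metis
      obtain M where M: "\<And>x. \<bar>\<psi> x\<bar> \<le> M"
        using test_function_bounded[OF \<open>test_function UNIV \<psi>\<close>] by metis
      have [measurable]: "\<psi> \<in> borel_measurable borel"
        using that by (auto simp: test_function_def)
      have "M \<ge> 0" using M[of 0] by linarith
      show ?thesis
        using C(2) M \<open>M \<ge> 0\<close>
        by (intro Bochner_Integration.integrable_bound[OF integrable_mult_right[OF f(2)[OF C(1)], of M]])
           (auto simp: abs_mult indicator_def mult.commute intro!: mult_right_mono)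
    qed
    have "(LINT x|lborel. f (x + t *\<^sub>R b) * \<phi> x - f x * \<phi> x)
        = (LINT x|lborel. f x * (\<phi> (x - t *\<^sub>R b) - \<phi> x))"
    proof -
      have "(LINT x|lborel. f (x + t *\<^sub>R b) * \<phi> x) = (LINT x|lborel. f x * \<phi> (x - t *\<^sub>R b))"
        using lborel_integral_translate[of "\<lambda>x. f x * \<phi> (x - t *\<^sub>R b)" "t *\<^sub>R b"] by simp
      moreover have "integrable lborel (\<lambda>x. f (x + t *\<^sub>R b) * \<phi> x)"
        using lborel_integrable_translate[of "\<lambda>x. f x * \<phi> (x - t *\<^sub>R b)" "t *\<^sub>R b"] lint[OF shift_test[of t]]
        by simp
      ultimately show ?thesis
        using lint[OF test] lint[OF shift_test[of t]] by (simp add: right_diff_distrib)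
    qed
    also have "\<dots> = - (LINT x|lborel. LINT s|lborel. f x * (dir_deriv b \<phi> (x - s *\<^sub>R b) * indicator {0..t} s))"
    proof -
      have "\<phi> (x - t *\<^sub>R b) - \<phi> x = - (LINT s|lborel. dir_deriv b \<phi> (x - s *\<^sub>R b) * indicator {0..t} s)" for x
      proof -
        have "(LINT s|lborel. dir_deriv b \<phi> (x - s *\<^sub>R b) * indicator {0..t} s)
            = (LINT s|lborel. indicator {0..t} s * dir_deriv b \<phi> ((x - t *\<^sub>R b) + s *\<^sub>R b))"
          using t by (subst lborel_integral_real_affine[where c = "-1" and t = t])
            (auto simp: algebra_simps indicator_def intro!: Bochner_Integration.integral_cong)
        also have "\<dots> = \<phi> x - \<phi> (x - t *\<^sub>R b)"
          using integral_derivative_along_line[OF smooth_imp_differentiable[OF \<phi>]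
              smooth_imp_continuous_on[OF smooth_dir_deriv[OF \<phi> b]] t, of "x - t *\<^sub>R b"] by simp
        finally show ?thesis by simp
      qed
      then show ?thesis by simp
    qed
    also have "\<dots> = - (LINT s|lborel. LINT x|lborel. f x * (dir_deriv b \<phi> (x - s *\<^sub>R b) * indicator {0..t} s))"
      using lborel_pair.Fubini_integral[OF joint'[OF f(1) m' f(2) C' M']] by simp
    also have "\<dots> = (LINT s|lborel. LINT x|lborel. g x * (\<phi> (x - s *\<^sub>R b) * indicator {0..t} s))"
      using weak[OF shift_test] by (simp add: shift_deriv flip: mult.assoc)
    also have "\<dots> = (LINT s|lborel. LINT x|lborel. \<phi> x * (indicator {0..t} s * g (x + s *\<^sub>R b)))"
    proof (rule Bochner_Integration.integral_cong[OF refl])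
      fix s :: real
      show "(LINT x|lborel. g x * (\<phi> (x - s *\<^sub>R b) * indicator {0..t} s))
          = (LINT x|lborel. \<phi> x * (indicator {0..t} s * g (x + s *\<^sub>R b)))"
        using lborel_integral_translate[of "\<lambda>x. g x * (\<phi> (x - s *\<^sub>R b) * indicator {0..t} s)" "s *\<^sub>R b"]
        by (simp add: ac_simps)
    qed
    also have "\<dots> = (LINT x|lborel. LINT s|lborel. \<phi> x * (indicator {0..t} s * g (x + s *\<^sub>R b)))"
      using lborel_pair.Fubini_integral[OF joint[OF _ C M]] by simp
    also have "\<dots> = (LINT x|lborel. \<phi> x * A x)" by (simp add: A_def)
    finally have key: "(LINT x|lborel. f (x + t *\<^sub>R b) * \<phi> x - f x * \<phi> x) = (LINT x|lborel. \<phi> x * A x)" .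
    have "(LINT x|lebesgue. (f (x + t *\<^sub>R b) - f x - A x) * \<phi> x)
        = (LINT x|lborel. (f (x + t *\<^sub>R b) * \<phi> x - f x * \<phi> x) - \<phi> x * A x)"
      by (subst integral_completion) (auto simp: algebra_simps)
    also have "\<dots> = 0"
    proof (subst Bochner_Integration.integral_diff)
      show "integrable lborel (\<lambda>x. f (x + t *\<^sub>R b) * \<phi> x - f x * \<phi> x)"
        using lborel_integrable_translate[of "\<lambda>x. f x * \<phi> (x - t *\<^sub>R b)" "t *\<^sub>R b"] lint[OF shift_test[of t]] lint[OF test]
        by simp
    qed (use A_int[OF _ C M] key in auto)
    finally show "(LINT x|lebesgue. (f (x + t *\<^sub>R b) - f x - A x) * \<phi> x) = 0" .
  qed
  then have "AE x in lborel. f (x + t *\<^sub>R b) - f x - A x = 0"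
    by (subst (asm) AE_completion_iff) auto
  then show "AE x in lborel. f (x + t *\<^sub>R b) - f x = (LINT s|lborel. indicator {0..t} s * g (x + s *\<^sub>R b))"
    unfolding A_def by eventually_elim simp
  have "AE x in lborel. integrable lborel (\<lambda>s. indicator (cball 0 (real N)) x * (indicator {0..t} s * g (x + s *\<^sub>R b)))" for N
  proof -
    have "(indicator (cball 0 (real N)) :: 'a \<Rightarrow> real) \<in> borel_measurable borel"
      by (intro borel_measurable_indicator) simp
    from lborel_pair.AE_integrable_fst[OF joint[OF this, of "cball 0 (real N)" 1]]
    show ?thesis by auto
  qed
  then have "AE x in lborel. \<forall>N. integrable lborel (\<lambda>s. indicator (cball 0 (real N)) x * (indicator {0..t} s * g (x + s *\<^sub>R b)))"
    by (subst AE_all_countable) auto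
  then show "AE x in lborel. integrable lborel (\<lambda>s. indicator {0..t} s * g (x + s *\<^sub>R b))"
  proof eventually_elim
    case (elim x)
    obtain N :: nat where "norm x < real N" using reals_Archimedean2 by blast
    then show ?case using elim[rule_format, of N] by (simp add: mem_cball)
  qed
qed

section \<open>The Loomis-Whitney inequality\<close>

text \<open>
  The inequality between geometric and arithmetic means, by convexity of the exponential.
\<close>

lemma prod_le_mean_power:
  fixes a :: "'i \<Rightarrow> real"
  assumes J: "finite J" "J \<noteq> {}" and a: "\<And>i. i \<in> J \<Longrightarrow> 0 \<le> a i"
  shows "(\<Prod>i\<in>J. a i) \<le> (\<Sum>i\<in>J. a i ^ card J) / card J"
proof (cases "\<exists>i\<in>J. a i = 0")
  case True
  then have "(\<Prod>i\<in>J. a i) = 0" using J by (simp add: prod_zero_iff)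
  then show ?thesis using a by (simp add: sum_nonneg divide_nonneg_nonneg)
next
  case False
  then have pos: "0 < a i" if "i \<in> J" for i using a that by (metis less_eq_real_def)
  have m: "real (card J) > 0" using J by (simp add: card_gt_0_iff)
  have "exp (\<Sum>i\<in>J. (1 / card J) *\<^sub>R (card J * ln (a i))) \<le> (\<Sum>i\<in>J. (1 / card J) * exp (card J * ln (a i)))"
    using J m by (intro convex_on_sum[OF _ _ exp_convex]) auto
  moreover have "(\<Sum>i\<in>J. (1 / card J) *\<^sub>R (card J * ln (a i))) = (\<Sum>i\<in>J. ln (a i))"
    using m by simp
  moreover have "exp (\<Sum>i\<in>J. ln (a i)) = (\<Prod>i\<in>J. a i)"
    using pos J by (simp add: exp_sum)
  moreover have "exp (card J * ln (a i)) = a i ^ card J" if "i \<in> J" for i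
    using pos[OF that] by (simp add: exp_of_nat_mult)
  ultimately show ?thesis by (simp add: sum_divide_distrib)
qed

lemma ennreal_power_le_imp_le:
  fixes x y :: ennreal
  assumes "x ^ m \<le> y ^ m" "m > 0"
  shows "x \<le> y"
proof (cases x; cases y)
  fix r s :: real assume rs: "0 \<le> r" "x = ennreal r" "0 \<le> s" "y = ennreal s"
  then have "r ^ m \<le> s ^ m" using assms by (simp add: ennreal_power)
  then show ?thesis using rs assms(2) by (simp add: power_mono_iff)
qed (use assms in \<open>auto simp: ennreal_power top_unique\<close>)

definition ennroot :: "nat \<Rightarrow> ennreal \<Rightarrow> ennreal" where
  "ennroot m x = (if x = \<infinity> then \<infinity> else ennreal (enn2real x powr (1 / m)))"

lemma powr_inverse_power: "m > 0 \<Longrightarrow> 0 \<le> r \<Longrightarrow> (r powr (1 / real m)) ^ m = r"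
  by (cases "r = 0") (auto simp: powr_power)

lemma ennroot_power: "m > 0 \<Longrightarrow> ennroot m x ^ m = x"
  by (cases x) (auto simp: ennroot_def ennreal_power powr_inverse_power)

lemma measurable_ennroot [measurable]: "ennroot m \<in> borel_measurable borel"
  unfolding ennroot_def by measurable

text \<open>
  Hoelder's inequality with equal exponents, raised to the power \<open>card J\<close> so that no roots of
  extended numbers occur. After normalising every factor it is the integrated inequality of means.
\<close>

lemma nn_integral_prod_power_le:
  fixes h :: "'i \<Rightarrow> 'a \<Rightarrow> ennreal"
  assumes J: "finite J" "J \<noteq> {}" and [measurable]: "\<And>i. i \<in> J \<Longrightarrow> h i \<in> borel_measurable M"
  shows "(\<integral>\<^sup>+x. (\<Prod>i\<in>J. h i x) \<partial>M) ^ card J \<le> (\<Prod>i\<in>J. \<integral>\<^sup>+x. h i x ^ card J \<partial>M)"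
proof -
  define m where "m = card J"
  have m: "m > 0" using J by (simp add: m_def card_gt_0_iff)
  define N where "N i = (\<integral>\<^sup>+x. h i x ^ m \<partial>M)" for i
  have goal: "(\<integral>\<^sup>+x. (\<Prod>i\<in>J. h i x) \<partial>M) ^ m \<le> (\<Prod>i\<in>J. N i)"
  proof (cases "\<exists>i\<in>J. N i = 0")
    case True
    then obtain j where j: "j \<in> J" "N j = 0" by blast
    then have "AE x in M. h j x ^ m = 0"
      unfolding N_def by (subst (asm) nn_integral_0_iff_AE) auto
    then have "AE x in M. (\<Prod>i\<in>J. h i x) = 0"
      using j J m by (auto simp: prod_zero_iff elim!: eventually_mono)
    then have "(\<integral>\<^sup>+x. (\<Prod>i\<in>J. h i x) \<partial>M) = 0"
      by (subst nn_integral_0_iff_AE) auto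
    then show ?thesis using m by (simp add: zero_power)
  next
    case False
    show ?thesis
    proof (cases "\<exists>i\<in>J. N i = \<infinity>")
      case True
      then have "(\<Prod>i\<in>J. N i) = \<infinity>"
        using False J by (auto simp: ennreal_prod_eq_top)
      then show ?thesis by simp
    next
      case finN: False
      define c where "c i = enn2real (N i) powr (1 / m)" for i
      have Npos: "enn2real (N i) > 0" if "i \<in> J" for i
      proof -
        have "N i \<noteq> 0" "N i \<noteq> top" using False finN that by auto
        then show ?thesis by (cases "N i") (auto simp: less_le)
      qed
      have cpos: "c i > 0" if "i \<in> J" for i
        using Npos[OF that] by (simp add: c_def)
      have cm: "ennreal (c i ^ m) = N i" if "i \<in> J" for i
      proof -
        have "c i ^ m = enn2real (N i)" using m by (simp add: c_def powr_inverse_power)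
        then show ?thesis using finN that by (simp add: less_top)
      qed
      have pt: "(\<Prod>i\<in>J. h i x) \<le> ennreal ((\<Prod>i\<in>J. c i) / m) * (\<Sum>i\<in>J. h i x ^ m / N i)" for x
      proof (cases "\<exists>i\<in>J. h i x = \<infinity>")
        case True
        then obtain j where j: "j \<in> J" "h j x = \<infinity>" by blast
        have "h j x ^ m / N j = \<infinity>"
          using j finN m by (auto simp: ennreal_top_divide power_eq_top_ennreal_iff)
        then have "(\<Sum>i\<in>J. h i x ^ m / N i) = \<infinity>"
          using j(1) J by auto
        moreover have "(\<Prod>i\<in>J. c i) / m > 0" using cpos m by (simp add: prod_pos)
        ultimately show ?thesis by (auto simp: ennreal_mult_top ennreal_eq_0_iff)
      next
        case fin: False
        define r where "r i = enn2real (h i x)" for i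
        have r: "h i x = ennreal (r i)" "0 \<le> r i" if "i \<in> J" for i
          using fin that by (auto simp: r_def less_top)
        have "(\<Prod>i\<in>J. r i) = (\<Prod>i\<in>J. c i) * (\<Prod>i\<in>J. r i / c i)"
          using cpos by (simp add: prod_dividef prod_pos less_imp_neq[symmetric] prod_zero_iff J)
        also have "\<dots> \<le> (\<Prod>i\<in>J. c i) * ((\<Sum>i\<in>J. (r i / c i) ^ m) / m)"
          unfolding m_def using cpos r J
          by (intro mult_left_mono prod_le_mean_power prod_nonneg) (auto intro: less_imp_le divide_nonneg_pos)
        finally have "(\<Prod>i\<in>J. r i) \<le> (\<Prod>i\<in>J. c i) / m * (\<Sum>i\<in>J. r i ^ m / c i ^ m)"
          by (simp add: power_divide)
        then have "ennreal (\<Prod>i\<in>J. r i) \<le> ennreal ((\<Prod>i\<in>J. c i) / m * (\<Sum>i\<in>J. r i ^ m / c i ^ m))"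
          by (rule ennreal_leI)
        also have "\<dots> = ennreal ((\<Prod>i\<in>J. c i) / m) * (\<Sum>i\<in>J. ennreal (r i ^ m / c i ^ m))"
        proof -
          have nn: "0 \<le> r i ^ m / c i ^ m" if "i \<in> J" for i
            using cpos[OF that] r(2)[OF that] by simp
          then show ?thesis by (subst ennreal_mult'') (auto intro: sum_nonneg simp: sum_ennreal)
        qed
        also have "(\<Sum>i\<in>J. ennreal (r i ^ m / c i ^ m)) = (\<Sum>i\<in>J. h i x ^ m / N i)"
          using cpos r by (intro sum.cong) (auto simp: cm[symmetric] divide_ennreal ennreal_power)
        also have "ennreal (\<Prod>i\<in>J. r i) = (\<Prod>i\<in>J. h i x)"
          using r by (subst prod_ennreal[symmetric]) auto
        finally show ?thesis .
      qed
      have "(\<integral>\<^sup>+x. (\<Prod>i\<in>J. h i x) \<partial>M) \<le> (\<integral>\<^sup>+x. ennreal ((\<Prod>i\<in>J. c i) / m) * (\<Sum>i\<in>J. h i x ^ m / N i) \<partial>M)"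
        by (intro nn_integral_mono pt)
      also have "\<dots> = ennreal ((\<Prod>i\<in>J. c i) / m) * (\<Sum>i\<in>J. \<integral>\<^sup>+x. h i x ^ m / N i \<partial>M)"
        by (simp add: nn_integral_cmult nn_integral_sum)
      also have "(\<Sum>i\<in>J. \<integral>\<^sup>+x. h i x ^ m / N i \<partial>M) = (\<Sum>i\<in>J. 1)"
      proof (rule sum.cong[OF refl])
        fix i assume i: "i \<in> J"
        then have "(\<integral>\<^sup>+x. h i x ^ m / N i \<partial>M) = N i / N i"
          unfolding N_def by (subst nn_integral_divide) auto
        also have "\<dots> = 1" using False finN i by (auto simp: ennreal_divide_self less_top)
        finally show "(\<integral>\<^sup>+x. h i x ^ m / N i \<partial>M) = 1" .
      qed
      also have "ennreal ((\<Prod>i\<in>J. c i) / m) * (\<Sum>i\<in>J. 1) = ennreal (\<Prod>i\<in>J. c i)"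
        using m cpos
        by (simp add: m_def ennreal_of_nat_eq_real_of_nat ennreal_mult''[symmetric])
      finally have "(\<integral>\<^sup>+x. (\<Prod>i\<in>J. h i x) \<partial>M) ^ m \<le> ennreal (\<Prod>i\<in>J. c i) ^ m"
        by (rule power_mono) simp
      also have "\<dots> = (\<Prod>i\<in>J. N i)"
        using cpos by (simp add: ennreal_power prod_nonneg less_imp_le prod_power_distrib
          cm[symmetric] prod_ennreal cong: prod.cong)
      finally show ?thesis .
    qed
  qed
  then show ?thesis by (simp add: m_def N_def)
qed

interpretation lborel_product: product_sigma_finite "\<lambda>_::'i. lborel :: real measure"
  by standard

text \<open>
  The coordinates are integrated out one at a time. In the direction \<open>a\<close> the factor \<open>h (\<sigma> a)\<close> is
  constant, and Hoelder's inequality bounds the integral of the product of the other \<open>m\<close> factors by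
  the product of their \<open>L\<^sup>m\<close> norms in that direction. These norms depend on one coordinate less and
  inherit the independence assumption. The map \<open>\<sigma>\<close> keeps the set of factors fixed while the set of
  coordinates shrinks.
\<close>

lemma nn_integral_prod_independent_le:
  fixes h :: "'j \<Rightarrow> ('i \<Rightarrow> real) \<Rightarrow> ennreal"
  assumes "finite A" and J: "finite J" "card J = Suc m" "m > 0"
    and "\<And>a. a \<in> A \<Longrightarrow> \<sigma> a \<in> J"
    and "\<And>i. i \<in> J \<Longrightarrow> h i \<in> borel_measurable (PiM A (\<lambda>_. lborel))"
    and "\<And>a x s. a \<in> A \<Longrightarrow> h (\<sigma> a) (x(a := s)) = h (\<sigma> a) x"
  shows "(\<integral>\<^sup>+x. (\<Prod>i\<in>J. h i x) \<partial>PiM A (\<lambda>_. lborel)) ^ m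
    \<le> (\<Prod>i\<in>J. \<integral>\<^sup>+x. h i x ^ m \<partial>PiM (A - {a. \<sigma> a = i}) (\<lambda>_. lborel))"
  using assms(1,5-)
proof (induction A arbitrary: h rule: finite_induct)
  case empty
  have point: "(\<integral>\<^sup>+x. f x \<partial>PiM {} (\<lambda>_. lborel :: real measure)) = f (\<lambda>_. undefined)"
    for f :: "('i \<Rightarrow> real) \<Rightarrow> ennreal"
    by (simp add: PiM_empty nn_integral_count_space_finite)
  show ?case
    by (simp add: point prod_power_distrib)
next
  case (insert a B)
  note [measurable] = insert.prems(2)
  have upd [measurable]: "(\<lambda>x. (fst x)(a := snd x)) \<in> measurable (PiM B (\<lambda>_. lborel) \<Otimes>\<^sub>M lborel) (PiM (insert a B) (\<lambda>_. lborel))"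
    using measurable_add_dim[of a B "\<lambda>_. lborel :: real measure"] by (simp add: split_beta')
  have upd1 [measurable]: "(\<lambda>x. x(a := s)) \<in> measurable (PiM B (\<lambda>_. lborel)) (PiM (insert a B) (\<lambda>_. lborel :: real measure))" for s
    using measurable_compose[OF measurable_Pair2'[of s lborel] upd] by simp
  define j where "j = \<sigma> a"
  have j: "j \<in> J" using insert.prems(1) by (simp add: j_def)
  define k where "k i = (if i = j then h i else (\<lambda>x. ennroot m (\<integral>\<^sup>+s. h i (x(a := s)) ^ m \<partial>lborel)))" for i
  have hj: "h j (x(a := s)) = h j x" for x s
    unfolding j_def by (rule insert.prems(3)) simp
  have mk [measurable]: "k i \<in> borel_measurable (PiM B (\<lambda>_. lborel))" if i: "i \<in> J" for i
  proof (cases "i = j")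
    case True
    have "(\<lambda>x. h j (x(a := 0))) \<in> borel_measurable (PiM B (\<lambda>_. lborel))"
      using insert.prems(2)[OF j] upd1 by measurable
    then show ?thesis using True by (simp add: k_def hj)
  next
    case False
    have "(\<lambda>p. h i ((fst p)(a := snd p)) ^ m) \<in> borel_measurable (PiM B (\<lambda>_. lborel) \<Otimes>\<^sub>M lborel)"
      using insert.prems(2)[OF i] upd by measurable
    then have "(\<lambda>x. \<integral>\<^sup>+s. h i (x(a := s)) ^ m \<partial>lborel) \<in> borel_measurable (PiM B (\<lambda>_. lborel))"
      by (intro lborel.borel_measurable_nn_integral) (simp add: split_beta')
    then show ?thesis using False by (simp add: k_def)
  qed
  have "(\<integral>\<^sup>+x. (\<Prod>i\<in>J. h i x) \<partial>PiM (insert a B) (\<lambda>_. lborel))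
      = (\<integral>\<^sup>+x. \<integral>\<^sup>+s. (\<Prod>i\<in>J. h i (x(a := s))) \<partial>lborel \<partial>PiM B (\<lambda>_. lborel))"
    using insert.hyps by (subst lborel_product.product_nn_integral_insert) auto
  also have "\<dots> \<le> (\<integral>\<^sup>+x. (\<Prod>i\<in>J. k i x) \<partial>PiM B (\<lambda>_. lborel))"
  proof (rule nn_integral_mono)
    fix x assume x: "x \<in> space (PiM B (\<lambda>_. lborel :: real measure))"
    have mx [measurable]: "(\<lambda>s. h i (x(a := s))) \<in> borel_measurable lborel" if "i \<in> J" for i
      using measurable_compose[OF measurable_Pair1'[OF x] measurable_compose[OF upd insert.prems(2)[OF that]]]
      by (simp add: fun_upd_def)
    have card: "card (J - {j}) = m" using J j by simp
    then have ne: "J - {j} \<noteq> {}" using J(3) by (metis card.empty less_irrefl)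
    have "(\<integral>\<^sup>+s. (\<Prod>i\<in>J - {j}. h i (x(a := s))) \<partial>lborel) ^ m
        \<le> (\<Prod>i\<in>J - {j}. \<integral>\<^sup>+s. h i (x(a := s)) ^ m \<partial>lborel)"
      using nn_integral_prod_power_le[of "J - {j}" "\<lambda>i s. h i (x(a := s))" lborel] J ne mx card by simp
    also have "\<dots> = (\<Prod>i\<in>J - {j}. k i x) ^ m"
      using J by (subst prod_power_distrib) (simp add: k_def ennroot_power)
    finally have "(\<integral>\<^sup>+s. (\<Prod>i\<in>J - {j}. h i (x(a := s))) \<partial>lborel) \<le> (\<Prod>i\<in>J - {j}. k i x)"
      using J by (rule_tac ennreal_power_le_imp_le) auto
    moreover have "(\<integral>\<^sup>+s. (\<Prod>i\<in>J. h i (x(a := s))) \<partial>lborel)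
        = h j x * (\<integral>\<^sup>+s. (\<Prod>i\<in>J - {j}. h i (x(a := s))) \<partial>lborel)"
      using j J by (subst nn_integral_cmult[symmetric]) (auto simp: prod.remove[of J j] hj)
    ultimately show "(\<integral>\<^sup>+s. (\<Prod>i\<in>J. h i (x(a := s))) \<partial>lborel) \<le> (\<Prod>i\<in>J. k i x)"
      using j J by (simp add: prod.remove[of J j] k_def mult_left_mono)
  qed
  finally have "(\<integral>\<^sup>+x. (\<Prod>i\<in>J. h i x) \<partial>PiM (insert a B) (\<lambda>_. lborel)) ^ m
      \<le> (\<integral>\<^sup>+x. (\<Prod>i\<in>J. k i x) \<partial>PiM B (\<lambda>_. lborel)) ^ m"
    by (rule power_mono) simp
  also have "\<dots> \<le> (\<Prod>i\<in>J. \<integral>\<^sup>+x. k i x ^ m \<partial>PiM (B - {a. \<sigma> a = i}) (\<lambda>_. lborel))"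
  proof (rule insert.IH)
    fix b :: 'i and x s assume b: "b \<in> B"
    then have ab: "a \<noteq> b" using insert.hyps by auto
    show "k (\<sigma> b) (x(b := s)) = k (\<sigma> b) x"
    proof (cases "\<sigma> b = j")
      case True then show ?thesis using insert.prems(3)[of b x s] b by (simp add: k_def fun_upd_def)
    next
      case False
      have "h (\<sigma> b) (x(b := s, a := t)) = h (\<sigma> b) (x(a := t))" for t
        unfolding fun_upd_twist[OF ab[symmetric]] by (rule insert.prems(3)) (simp add: b)
      then show ?thesis using False by (simp add: k_def)
    qed
  qed (use insert.prems mk in auto)
  also have "\<dots> = (\<Prod>i\<in>J. \<integral>\<^sup>+x. h i x ^ m \<partial>PiM (insert a B - {a. \<sigma> a = i}) (\<lambda>_. lborel))"
  proof (rule prod.cong[OF refl])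
    fix i assume i: "i \<in> J"
    show "(\<integral>\<^sup>+x. k i x ^ m \<partial>PiM (B - {a. \<sigma> a = i}) (\<lambda>_. lborel))
        = (\<integral>\<^sup>+x. h i x ^ m \<partial>PiM (insert a B - {a. \<sigma> a = i}) (\<lambda>_. lborel))"
    proof (cases "i = j")
      case True
      then show ?thesis by (simp add: k_def j_def insert_Diff_if)
    next
      case False
      define B' where "B' = B - {a. \<sigma> a = i}"
      have eq: "insert a B - {a. \<sigma> a = i} = insert a B'"
        using False by (auto simp: B'_def j_def)
      \<comment> \<open>The factor is measurable on all coordinates; setting those that it ignores to 0 shows that it is
        measurable on the remaining ones.\<close>
      have hB: "(\<lambda>x. h i x ^ m) \<in> borel_measurable (PiM (insert a B') (\<lambda>_. lborel))"
      proof -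
        define e where "e x = (\<lambda>c. if c \<in> insert a B' then x c else if c \<in> B then 0 else undefined)" for x :: "'i \<Rightarrow> real"
        have "e \<in> measurable (PiM (insert a B') (\<lambda>_. lborel)) (PiM (insert a B) (\<lambda>_. lborel))"
        proof (rule measurable_PiM_single')
          fix c assume "c \<in> insert a B"
          then show "(\<lambda>x. e x c) \<in> measurable (PiM (insert a B') (\<lambda>_. lborel)) lborel"
            by (cases "c \<in> insert a B'") (auto simp: e_def)
        qed (auto simp: e_def B'_def space_PiM PiE_iff extensional_def)
        then have "(\<lambda>x. h i (e x)) \<in> borel_measurable (PiM (insert a B') (\<lambda>_. lborel))"
          using insert.prems(2)[OF i] by measurable
        moreover have "h i (e x) = h i x" if "x \<in> space (PiM (insert a B') (\<lambda>_. lborel))" for x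
        proof -
          note indep = insert.prems(3)
          have zero: "h i (\<lambda>c. if c \<in> S then 0 else x c) = h i x" if "finite S" "S \<subseteq> {b\<in>B. \<sigma> b = i}" for S
            using that
          proof (induction S rule: finite_induct)
            case (insert c S)
            have "h i (\<lambda>d. if d \<in> insert c S then 0 else x d) = h (\<sigma> c) ((\<lambda>d. if d \<in> S then 0 else x d)(c := 0))"
              using insert.prems by (intro arg_cong2[where f = h]) auto
            also have "\<dots> = h (\<sigma> c) (\<lambda>d. if d \<in> S then 0 else x d)"
              by (rule indep) (use insert.prems in auto)
            also have "\<dots> = h i x" using insert.prems insert.IH by auto
            finally show ?case .
          qed simp
          have "e x = (\<lambda>c. if c \<in> {b\<in>B. \<sigma> b = i} then 0 else x c)"
            using that eq False by (auto simp: e_def B'_def j_def space_PiM PiE_iff extensional_def fun_eq_iff)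
          then show ?thesis using zero[of "{b\<in>B. \<sigma> b = i}"] insert.hyps by (simp del: mem_Collect_eq)
        qed
        ultimately have "h i \<in> borel_measurable (PiM (insert a B') (\<lambda>_. lborel))"
          by (simp cong: measurable_cong)
        then show ?thesis by measurable
      qed
      have "(\<integral>\<^sup>+x. h i x ^ m \<partial>PiM (insert a B') (\<lambda>_. lborel))
          = (\<integral>\<^sup>+x. \<integral>\<^sup>+s. h i (x(a := s)) ^ m \<partial>lborel \<partial>PiM B' (\<lambda>_. lborel))"
        using insert.hyps hB by (subst lborel_product.product_nn_integral_insert) (auto simp: B'_def)
      then show ?thesis
        using False J by (simp add: eq k_def ennroot_power B'_def)
    qed
  qed
  finally show ?case .
qed

theorem loomis_whitney:
  fixes h :: "'i \<Rightarrow> ('i \<Rightarrow> real) \<Rightarrow> ennreal"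
  assumes "finite I" "card I = Suc m" "m > 0"
    and "\<And>i. i \<in> I \<Longrightarrow> h i \<in> borel_measurable (PiM I (\<lambda>_. lborel))"
    and "\<And>i x s. i \<in> I \<Longrightarrow> h i (x(i := s)) = h i x"
  shows "(\<integral>\<^sup>+x. (\<Prod>i\<in>I. h i x) \<partial>PiM I (\<lambda>_. lborel)) ^ m
    \<le> (\<Prod>i\<in>I. \<integral>\<^sup>+x. h i x ^ m \<partial>PiM (I - {i}) (\<lambda>_. lborel))"
  using nn_integral_prod_independent_le[of I I m "\<lambda>i. i" h] assms by simp

text \<open>
  The line integral of \<open>f\<close> in the direction \<open>b\<close> does not depend on the coordinate \<open>b\<close> of the point, so
  the Loomis-Whitney inequality applies to the \<open>m\<close>-th roots of the line integrals in all directions.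
\<close>

lemma nn_integral_power_le_line_integrals:
  fixes f u :: "'a::euclidean_space \<Rightarrow> ennreal"
  assumes [measurable]: "f \<in> borel_measurable borel" "u \<in> borel_measurable borel"
    and n: "DIM('a) = Suc m" "m > 0"
    and le: "\<And>b. b \<in> Basis \<Longrightarrow> AE x in lborel. u x ^ m \<le> (\<integral>\<^sup>+s. f (x + s *\<^sub>R b) \<partial>lborel)"
  shows "(\<integral>\<^sup>+x. u x ^ Suc m \<partial>lborel) ^ m \<le> (\<integral>\<^sup>+x. f x \<partial>lborel) ^ Suc m"
proof -
  define E where "E y = (\<Sum>b\<in>Basis. y b *\<^sub>R b)" for y :: "'a \<Rightarrow> real"
  have E [measurable]: "E \<in> measurable (PiM Basis (\<lambda>_. lborel)) borel"
    unfolding E_def[abs_def] by measurable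
  have lb: "(\<integral>\<^sup>+x. g x \<partial>lborel) = (\<integral>\<^sup>+y. g (E y) \<partial>PiM Basis (\<lambda>_. lborel))"
    if "g \<in> borel_measurable borel" for g :: "'a \<Rightarrow> ennreal"
    by (subst lborel_eq, subst nn_integral_distr) (use that E in \<open>auto simp: E_def[abs_def]\<close>)
  have Eupd: "E (y(b := s)) = E y + (s - y b) *\<^sub>R b" if "b \<in> Basis" for y b s
  proof -
    have "E (y(b := s)) = (\<Sum>c\<in>Basis. y c *\<^sub>R c + (if c = b then (s - y b) *\<^sub>R b else 0))"
      unfolding E_def by (intro sum.cong) (auto simp: algebra_simps)
    also have "\<dots> = E y + (s - y b) *\<^sub>R b"
      unfolding E_def sum.distrib using that by simp
    finally show ?thesis .
  qed
  define F where "F b x = (\<integral>\<^sup>+s. f (x + s *\<^sub>R b) \<partial>lborel)" for b x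
  have F_meas [measurable]: "F b \<in> borel_measurable borel" for b
    unfolding F_def by measurable
  have F_shift: "F b (x + t *\<^sub>R b) = F b x" for b x t
  proof -
    have "(\<integral>\<^sup>+s. f (x + s *\<^sub>R b) \<partial>lborel) = (\<integral>\<^sup>+s. f (x + (t + s) *\<^sub>R b) \<partial>lborel)"
      using nn_integral_real_affine[of "\<lambda>s. f (x + s *\<^sub>R b)" 1 t] by simp
    then show ?thesis by (simp add: F_def algebra_simps)
  qed
  have "(\<integral>\<^sup>+x. u x ^ Suc m \<partial>lborel) \<le> (\<integral>\<^sup>+x. (\<Prod>b\<in>(Basis :: 'a set). ennroot m (F b x)) \<partial>lborel)"
  proof (rule nn_integral_mono_AE)
    have "AE x in lborel. \<forall>b\<in>(Basis :: 'a set). u x ^ m \<le> F b x"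
      using le by (subst AE_finite_all) (auto simp: F_def)
    then show "AE x in lborel. u x ^ Suc m \<le> (\<Prod>b\<in>(Basis :: 'a set). ennroot m (F b x))"
    proof eventually_elim
      case (elim x)
      have "u x \<le> ennroot m (F b x)" if "b \<in> Basis" for b
      proof (rule ennreal_power_le_imp_le)
        show "u x ^ m \<le> ennroot m (F b x) ^ m"
          unfolding ennroot_power[OF n(2)] using elim that by blast
      qed (rule n(2))
      then have "(\<Prod>b\<in>(Basis :: 'a set). u x) \<le> (\<Prod>b\<in>(Basis :: 'a set). ennroot m (F b x))"
        by (intro prod_mono_ennreal) auto
      then show ?case by (simp only: prod_constant n(1))
    qed
  qed
  also have "\<dots> = (\<integral>\<^sup>+y. (\<Prod>b\<in>(Basis :: 'a set). ennroot m (F b (E y))) \<partial>PiM Basis (\<lambda>_. lborel))"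
    by (rule lb) measurable
  finally have "(\<integral>\<^sup>+x. u x ^ Suc m \<partial>lborel) ^ m
      \<le> (\<integral>\<^sup>+y. (\<Prod>b\<in>(Basis :: 'a set). ennroot m (F b (E y))) \<partial>PiM Basis (\<lambda>_. lborel)) ^ m"
    by (rule power_mono) simp
  also have "\<dots> \<le> (\<Prod>b\<in>(Basis :: 'a set). \<integral>\<^sup>+y. ennroot m (F b (E y)) ^ m \<partial>PiM (Basis - {b}) (\<lambda>_. lborel))"
    using n by (intro loomis_whitney) (auto simp: Eupd F_shift)
  also have "\<dots> = (\<Prod>b\<in>(Basis :: 'a set). \<integral>\<^sup>+x. f x \<partial>lborel)"
  proof (rule prod.cong[OF refl])
    fix b :: 'a assume b: "b \<in> Basis"
    have ins: "insert b (Basis - {b}) = Basis" using b by auto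
    have "(\<integral>\<^sup>+x. f x \<partial>lborel) = (\<integral>\<^sup>+y. f (E y) \<partial>PiM (insert b (Basis - {b})) (\<lambda>_. lborel))"
      unfolding ins by (rule lb) measurable
    also have "\<dots> = (\<integral>\<^sup>+y. \<integral>\<^sup>+s. f (E (y(b := s))) \<partial>lborel \<partial>PiM (Basis - {b}) (\<lambda>_. lborel))"
    proof (rule lborel_product.product_nn_integral_insert)
      show "(\<lambda>y. f (E y)) \<in> borel_measurable (PiM (insert b (Basis - {b})) (\<lambda>_. lborel))"
        unfolding ins by measurable
    qed auto
    also have "\<dots> = (\<integral>\<^sup>+y. F b (E y) \<partial>PiM (Basis - {b}) (\<lambda>_. lborel))"
    proof (rule nn_integral_cong)
      fix y :: "'a \<Rightarrow> real"
      have "(\<integral>\<^sup>+s. f (E (y(b := s))) \<partial>lborel) = F b (E y + (- y b) *\<^sub>R b)"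
        unfolding F_def by (simp add: Eupd[OF b] algebra_simps)
      then show "(\<integral>\<^sup>+s. f (E (y(b := s))) \<partial>lborel) = F b (E y)" by (simp only: F_shift)
    qed
    finally show "(\<integral>\<^sup>+y. ennroot m (F b (E y)) ^ m \<partial>PiM (Basis - {b}) (\<lambda>_. lborel)) = (\<integral>\<^sup>+x. f x \<partial>lborel)"
      using n by (simp add: ennroot_power)
  qed
  finally show ?thesis using n by simp
qed

section \<open>Powers of functions with controlled increments\<close>

lemma powr_difference_le:
  fixes a b \<gamma> :: real
  assumes "0 \<le> a" "0 \<le> b" "1 < \<gamma>"
  shows "a powr \<gamma> - b powr \<gamma> \<le> \<gamma> * max a b powr (\<gamma> - 1) * \<bar>a - b\<bar>"
proof (cases "a \<le> b")
  case True
  then have "a powr \<gamma> \<le> b powr \<gamma>" using assms by (intro powr_mono2) auto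
  moreover have "0 \<le> \<gamma> * max a b powr (\<gamma> - 1) * \<bar>a - b\<bar>" using assms by simp
  ultimately show ?thesis by linarith
next
  case False
  show ?thesis
  proof (cases "b = 0")
    case True
    have "a powr \<gamma> = a powr (\<gamma> - 1) * a"
      using False assms by (simp add: powr_diff)
    also have "\<dots> \<le> \<gamma> * (a powr (\<gamma> - 1) * a)"
      using assms by (simp add: mult_le_cancel_right1 mult_nonneg_nonneg not_less)
    finally show ?thesis using True False assms by (simp add: max_def mult.assoc)
  next
    case b: False
    have "\<exists>z>b. z < a \<and> a powr \<gamma> - b powr \<gamma> = (a - b) * (\<gamma> * z powr (\<gamma> - 1))"
      using False b assms by (intro MVT2) (auto intro!: derivative_eq_intros)
    then obtain z where z: "b < z" "z < a" "a powr \<gamma> - b powr \<gamma> = (a - b) * (\<gamma> * z powr (\<gamma> - 1))"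
      by blast
    have "z powr (\<gamma> - 1) \<le> a powr (\<gamma> - 1)" using z assms by (intro powr_mono2) auto
    then have "(a - b) * (\<gamma> * z powr (\<gamma> - 1)) \<le> (a - b) * (\<gamma> * a powr (\<gamma> - 1))"
      using z assms by (intro mult_left_mono) auto
    then show ?thesis using z False by (simp add: max_def ac_simps)
  qed
qed

text \<open>
  A substitute for integrating the derivative of \<open>\<bar>h\<bar> powr \<gamma>\<close> when only the increments of \<open>h\<close> are
  controlled. The estimate is additive over adjacent intervals. By continuity of \<open>h\<close> it holds on all
  short intervals around a given point if the weight \<open>\<bar>h\<bar> powr (\<gamma> - 1)\<close> is enlarged by \<open>\<delta>\<close>; bisection
  gives it on \<open>{0..T}\<close>, and the finite total variation allows \<open>\<delta> \<rightarrow> 0\<close>.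
\<close>

lemma powr_abs_increment_bound:
  fixes h g :: "real \<Rightarrow> real"
  assumes T: "0 \<le> T" and \<gamma>: "1 < \<gamma>" and cont: "continuous_on {0..T} h"
    and [measurable]: "g \<in> borel_measurable borel"
    and fin: "(\<integral>\<^sup>+s. indicator {0<..T} s * ennreal \<bar>g s\<bar> \<partial>lborel) < \<infinity>"
    and inc: "\<And>a b. 0 \<le> a \<Longrightarrow> a \<le> b \<Longrightarrow> b \<le> T \<Longrightarrow>
      ennreal \<bar>h b - h a\<bar> \<le> (\<integral>\<^sup>+s. indicator {a<..b} s * ennreal \<bar>g s\<bar> \<partial>lborel)"
  shows "ennreal (\<bar>h 0\<bar> powr \<gamma>) \<le> ennreal (\<bar>h T\<bar> powr \<gamma>)
    + (\<integral>\<^sup>+s. indicator {0<..T} s * ennreal (\<gamma> * \<bar>h s\<bar> powr (\<gamma> - 1) * \<bar>g s\<bar>) \<partial>lborel)"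
proof -
  define k where "k s = (if s \<in> {0..T} then \<gamma> * \<bar>h s\<bar> powr (\<gamma> - 1) else 0)" for s
  have kcont: "continuous_on {0..T} (\<lambda>s. \<gamma> * \<bar>h s\<bar> powr (\<gamma> - 1))"
    using \<gamma> by (intro continuous_intros cont continuous_on_powr') auto
  have "(\<lambda>s. if s \<in> {0..T} then \<gamma> * \<bar>h s\<bar> powr (\<gamma> - 1) else 0) \<in> borel_measurable borel"
    using kcont by (intro borel_measurable_continuous_on_if) auto
  then have [measurable]: "k \<in> borel_measurable borel" by (simp add: k_def[abs_def])
  have k0: "0 \<le> k s" for s using \<gamma> by (simp add: k_def)
  have approx: "ennreal (\<bar>h 0\<bar> powr \<gamma>) \<le> ennreal (\<bar>h T\<bar> powr \<gamma>)
      + (\<integral>\<^sup>+s. indicator {0<..T} s * ennreal ((k s + \<delta>) * \<bar>g s\<bar>) \<partial>lborel)"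
    if \<delta>: "\<delta> > 0" for \<delta>
  proof -
    define J where "J a b = (\<integral>\<^sup>+s. indicator {a<..b} s * ennreal ((k s + \<delta>) * \<bar>g s\<bar>) \<partial>lborel)" for a b
    define P where "P a b \<longleftrightarrow> (0 \<le> a \<and> b \<le> T \<longrightarrow>
      ennreal (\<bar>h a\<bar> powr \<gamma>) \<le> ennreal (\<bar>h b\<bar> powr \<gamma>)
      + J a b)" for a b
    have "P 0 T" using T
    proof (induction rule: Bolzano)
      case (trans a b c)
      show ?case unfolding P_def
      proof
        assume ac: "0 \<le> a \<and> c \<le> T"
        have "J a b + J b c = (\<integral>\<^sup>+s. indicator {a<..b} s * ennreal ((k s + \<delta>) * \<bar>g s\<bar>)
                  + indicator {b<..c} s * ennreal ((k s + \<delta>) * \<bar>g s\<bar>) \<partial>lborel)"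
          unfolding J_def by (rule nn_integral_add[symmetric]) measurable
        also have "\<dots> = J a c"
          unfolding J_def using trans(3,4) by (intro nn_integral_cong) (auto simp: indicator_def)
        finally have add: "J a b + J b c = J a c" .
        have "ennreal (\<bar>h a\<bar> powr \<gamma>) \<le> ennreal (\<bar>h b\<bar> powr \<gamma>) + J a b"
          using trans ac by (auto simp: P_def)
        also have "\<dots> \<le> (ennreal (\<bar>h c\<bar> powr \<gamma>)
            + J b c)
            + J a b"
          using trans ac by (intro add_right_mono) (auto simp: P_def)
        finally show "ennreal (\<bar>h a\<bar> powr \<gamma>) \<le> ennreal (\<bar>h c\<bar> powr \<gamma>)
            + J a c"
          unfolding add[symmetric] by (simp only: add.assoc add.commute add.left_commute)
      qed
    next
      case (local x)
      obtain d where d: "d > 0" "\<And>s. s \<in> {0..T} \<Longrightarrow> dist s x < d \<Longrightarrow>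
          \<bar>\<gamma> * \<bar>h s\<bar> powr (\<gamma> - 1) - \<gamma> * \<bar>h x\<bar> powr (\<gamma> - 1)\<bar> < \<delta> / 2"
        using kcont[unfolded continuous_on_iff, rule_format, of x "\<delta> / 2"] local \<delta>
        by (auto simp: dist_real_def)
      have "P a b" if ab: "a \<le> x" "x \<le> b" "b - a < d" for a b
        unfolding P_def
      proof
        assume ab': "0 \<le> a \<and> b \<le> T"
        define \<kappa> where "\<kappa> = \<gamma> * max \<bar>h a\<bar> \<bar>h b\<bar> powr (\<gamma> - 1)"
        have \<kappa>: "\<kappa> \<le> k s + \<delta>" if s: "s \<in> {a<..b}" for s
        proof -
          define q where "q c = \<gamma> * \<bar>h c\<bar> powr (\<gamma> - 1)" for c
          have near: "\<bar>q c - q x\<bar> < \<delta> / 2" if "c \<in> {a..b}" for c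
            unfolding q_def by (rule d(2)) (use that ab ab' in \<open>auto simp: dist_real_def\<close>)
          have "\<kappa> = q a \<or> \<kappa> = q b" by (auto simp: \<kappa>_def q_def max_def)
          moreover have "q a < q s + \<delta>" "q b < q s + \<delta>"
            using near[of a, unfolded abs_less_iff] near[of b, unfolded abs_less_iff]
              near[of s, unfolded abs_less_iff] s ab by auto
          moreover have "k s = q s" using s ab ab' by (auto simp: k_def q_def)
          ultimately show ?thesis by auto
        qed
        have \<kappa>0: "0 \<le> \<kappa>" using \<gamma> by (simp add: \<kappa>_def)
        have "\<bar>h a\<bar> powr \<gamma> - \<bar>h b\<bar> powr \<gamma> \<le> \<kappa> * \<bar>\<bar>h a\<bar> - \<bar>h b\<bar>\<bar>"
          unfolding \<kappa>_def using \<gamma> by (intro powr_difference_le) auto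
        also have "\<dots> \<le> \<kappa> * \<bar>h b - h a\<bar>"
          using \<kappa>0 by (intro mult_left_mono) auto
        finally have "ennreal (\<bar>h a\<bar> powr \<gamma>) \<le> ennreal (\<bar>h b\<bar> powr \<gamma> + \<kappa> * \<bar>h b - h a\<bar>)"
          by (intro ennreal_leI) linarith
        also have "\<dots> = ennreal (\<bar>h b\<bar> powr \<gamma>) + ennreal \<kappa> * ennreal \<bar>h b - h a\<bar>"
          using \<kappa>0 by (simp add: ennreal_plus ennreal_mult'')
        also have "\<dots> \<le> ennreal (\<bar>h b\<bar> powr \<gamma>)
            + ennreal \<kappa> * (\<integral>\<^sup>+s. indicator {a<..b} s * ennreal \<bar>g s\<bar> \<partial>lborel)"
          using ab ab' by (intro add_left_mono mult_left_mono inc) auto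
        also have "ennreal \<kappa> * (\<integral>\<^sup>+s. indicator {a<..b} s * ennreal \<bar>g s\<bar> \<partial>lborel)
            = (\<integral>\<^sup>+s. ennreal \<kappa> * (indicator {a<..b} s * ennreal \<bar>g s\<bar>) \<partial>lborel)"
          by (rule nn_integral_cmult[symmetric]) measurable
        also have "\<dots> \<le> J a b"
          unfolding J_def
        proof (rule nn_integral_mono)
          fix s
          show "ennreal \<kappa> * (indicator {a<..b} s * ennreal \<bar>g s\<bar>)
              \<le> indicator {a<..b} s * ennreal ((k s + \<delta>) * \<bar>g s\<bar>)"
            using \<kappa>[of s] \<kappa>0
            by (cases "s \<in> {a<..b}")
               (auto simp: ennreal_mult''[symmetric] intro!: ennreal_leI mult_right_mono)
        qed
        finally show "ennreal (\<bar>h a\<bar> powr \<gamma>) \<le> ennreal (\<bar>h b\<bar> powr \<gamma>) + J a b"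
          by (simp add: add_left_mono)
      qed
      then show ?case using d(1) by blast
    qed
    then show ?thesis using T by (simp add: P_def J_def)
  qed
  define I where "I = (\<integral>\<^sup>+s. indicator {0<..T} s * ennreal (k s * \<bar>g s\<bar>) \<partial>lborel)"
  define V where "V = (\<integral>\<^sup>+s. indicator {0<..T} s * ennreal \<bar>g s\<bar> \<partial>lborel)"
  have "ennreal (\<bar>h 0\<bar> powr \<gamma>) \<le> ennreal (\<bar>h T\<bar> powr \<gamma>) + I"
  proof (rule ennreal_le_epsilon)
    fix e :: real assume e: "0 < e"
    define v where "v = enn2real V"
    have v: "V = ennreal v" "0 \<le> v" using fin by (auto simp: v_def V_def less_top)
    define \<delta> where "\<delta> = e / (v + 1)"
    have \<delta>: "\<delta> > 0" "\<delta> * v \<le> e" using e v by (auto simp: \<delta>_def field_simps)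
    have "(\<integral>\<^sup>+s. indicator {0<..T} s * ennreal ((k s + \<delta>) * \<bar>g s\<bar>) \<partial>lborel)
        = (\<integral>\<^sup>+s. indicator {0<..T} s * ennreal (k s * \<bar>g s\<bar>)
            + ennreal \<delta> * (indicator {0<..T} s * ennreal \<bar>g s\<bar>) \<partial>lborel)"
      using k0 \<delta>(1)
      by (intro nn_integral_cong)
         (auto simp: indicator_def distrib_right ennreal_plus ennreal_mult'')
    also have "\<dots> = I + ennreal \<delta> * V"
      unfolding I_def V_def by (subst nn_integral_add) (auto simp: nn_integral_cmult)
    also have "ennreal \<delta> * V \<le> ennreal e"
      using \<delta> v by (simp add: ennreal_mult''[symmetric] ennreal_leI)
    finally have "(\<integral>\<^sup>+s. indicator {0<..T} s * ennreal ((k s + \<delta>) * \<bar>g s\<bar>) \<partial>lborel) \<le> I + ennreal e"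
      by (simp add: add_left_mono)
    with approx[OF \<delta>(1)] show "ennreal (\<bar>h 0\<bar> powr \<gamma>) \<le> ennreal (\<bar>h T\<bar> powr \<gamma>) + I + ennreal e"
      by (metis (no_types, lifting) add.assoc add_left_mono order_trans)
  qed
  moreover have "I = (\<integral>\<^sup>+s. indicator {0<..T} s * ennreal (\<gamma> * \<bar>h s\<bar> powr (\<gamma> - 1) * \<bar>g s\<bar>) \<partial>lborel)"
    unfolding I_def by (intro nn_integral_cong) (auto simp: k_def indicator_def)
  ultimately show ?thesis by simp
qed

section \<open>The Sobolev inequality\<close>

text \<open>
  Integrated over a ball of radius \<open>N\<close>, the line integrals amount to at most \<open>2 * N\<close> times the integral
  of \<open>f\<close>, because a line spends at most that long in a ball.
\<close>

lemma AE_line_integral_finite: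
  fixes f :: "'a::euclidean_space \<Rightarrow> ennreal"
  assumes [measurable]: "f \<in> borel_measurable borel" and fin: "(\<integral>\<^sup>+x. f x \<partial>lborel) < \<infinity>"
    and b: "b \<in> Basis"
  shows "AE x in lborel. (\<integral>\<^sup>+s. f (x + s *\<^sub>R b) \<partial>lborel) < \<infinity>"
proof -
  have "AE x in lborel. indicator (cball 0 (real N)) x * (\<integral>\<^sup>+s. f (x + s *\<^sub>R b) \<partial>lborel) \<noteq> \<infinity>" for N
  proof (rule nn_integral_PInf_AE)
    have [measurable]: "cball (0::'a) (real N) \<in> sets borel" by simp
    show "(\<lambda>x. indicator (cball 0 (real N)) x * (\<integral>\<^sup>+s. f (x + s *\<^sub>R b) \<partial>lborel)) \<in> borel_measurable lborel"
      by measurable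
    have "(\<integral>\<^sup>+x. indicator (cball 0 (real N)) x * (\<integral>\<^sup>+s. f (x + s *\<^sub>R b) \<partial>lborel) \<partial>lborel)
        = (\<integral>\<^sup>+x. \<integral>\<^sup>+s. indicator (cball 0 (real N)) x * f (x + s *\<^sub>R b) \<partial>lborel \<partial>lborel)"
      by (intro nn_integral_cong nn_integral_cmult[symmetric]) measurable
    also have "\<dots> = (\<integral>\<^sup>+s. \<integral>\<^sup>+x. indicator (cball 0 (real N)) x * f (x + s *\<^sub>R b) \<partial>lborel \<partial>lborel)"
      by (rule lborel_pair.Fubini'[symmetric]) measurable
    also have "\<dots> = (\<integral>\<^sup>+s. \<integral>\<^sup>+x. indicator (cball 0 (real N)) (x - s *\<^sub>R b) * f x \<partial>lborel \<partial>lborel)"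
    proof (rule nn_integral_cong)
      fix s :: real
      show "(\<integral>\<^sup>+x. indicator (cball 0 (real N)) x * f (x + s *\<^sub>R b) \<partial>lborel)
          = (\<integral>\<^sup>+x. indicator (cball 0 (real N)) (x - s *\<^sub>R b) * f x \<partial>lborel)"
        using nn_integral_lborel_translate[of "\<lambda>x. indicator (cball 0 (real N)) (x - s *\<^sub>R b) * f x" "s *\<^sub>R b"]
        by simp
    qed
    also have "\<dots> = (\<integral>\<^sup>+x. \<integral>\<^sup>+s. indicator (cball 0 (real N)) (x - s *\<^sub>R b) * f x \<partial>lborel \<partial>lborel)"
      by (rule lborel_pair.Fubini') measurable
    also have "\<dots> \<le> (\<integral>\<^sup>+x. \<integral>\<^sup>+s. f x * indicator {x \<bullet> b - N..x \<bullet> b + N} s \<partial>lborel \<partial>lborel)"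
    proof (intro nn_integral_mono)
      fix x s
      have "\<bar>(x - s *\<^sub>R b) \<bullet> b\<bar> \<le> norm (x - s *\<^sub>R b)" by (rule Basis_le_norm[OF b])
      then show "indicator (cball 0 (real N)) (x - s *\<^sub>R b) * f x \<le> f x * indicator {x \<bullet> b - N..x \<bullet> b + N} s"
        using b by (auto simp: indicator_def inner_diff_left mult.commute)
    qed
    also have "\<dots> = (\<integral>\<^sup>+x. f x * ennreal (2 * N) \<partial>lborel)"
      by (intro nn_integral_cong) (simp add: nn_integral_cmult_indicator)
    also have "\<dots> = (\<integral>\<^sup>+x. f x \<partial>lborel) * ennreal (2 * N)"
      by (rule nn_integral_multc) measurable
    also have "\<dots> < \<infinity>" using fin by (simp add: ennreal_mult_less_top)
    finally show "(\<integral>\<^sup>+x. indicator (cball 0 (real N)) x * (\<integral>\<^sup>+s. f (x + s *\<^sub>R b) \<partial>lborel) \<partial>lborel) \<noteq> \<infinity>"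
      by simp
  qed
  then have "AE x in lborel. \<forall>N. indicator (cball 0 (real N)) x * (\<integral>\<^sup>+s. f (x + s *\<^sub>R b) \<partial>lborel) \<noteq> \<infinity>"
    by (subst AE_all_countable) auto
  then show ?thesis
  proof eventually_elim
    case (elim x)
    obtain N :: nat where "norm x < real N" using reals_Archimedean2 by blast
    then show ?case using elim[rule_format, of N] by (simp add: less_top)
  qed
qed

text \<open>
  On almost every line, \<open>w\<close> coincides almost everywhere with a continuous function \<open>h\<close> that starts from
  the value of \<open>w\<close> at \<open>x\<close>. Since \<open>\<bar>w\<bar> powr p\<close> is integrable along the line, \<open>\<bar>h\<bar>\<close> becomes arbitrarily
  small, so the value at \<open>x\<close> is bounded by the variation of \<open>\<bar>h\<bar> powr \<gamma>\<close> on a half line.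
\<close>

lemma weak_derivative_powr_bound:
  fixes w g :: "'a::euclidean_space \<Rightarrow> real"
  assumes w: "w \<in> borel_measurable borel" "\<And>C. compact C \<Longrightarrow> integrable lborel (\<lambda>x. indicator C x * w x)"
    and g: "g \<in> borel_measurable borel" "\<And>C. compact C \<Longrightarrow> integrable lborel (\<lambda>x. indicator C x * g x)"
    and weak: "\<And>\<phi>. test_function UNIV \<phi> \<Longrightarrow>
      (LINT x|lborel. w x * dir_deriv b \<phi> x) = - (LINT x|lborel. g x * \<phi> x)"
    and b: "b \<in> Basis" and \<gamma>: "1 < \<gamma>" and p: "0 < p"
    and fin: "(\<integral>\<^sup>+x. ennreal (\<bar>w x\<bar> powr p) \<partial>lborel) < \<infinity>"
  shows "AE x in lborel. ennreal (\<bar>w x\<bar> powr \<gamma>)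
    \<le> (\<integral>\<^sup>+s. ennreal (\<gamma> * \<bar>w (x + s *\<^sub>R b)\<bar> powr (\<gamma> - 1) * \<bar>g (x + s *\<^sub>R b)\<bar>) \<partial>lborel)"
proof -
  note [measurable] = w(1) g(1)
  define A where "A x t = (LINT s|lborel. indicator {0..t} s * g (x + s *\<^sub>R b))" for x t
  have A_meas: "(\<lambda>q. A (fst q) (snd q)) \<in> borel_measurable (borel \<Otimes>\<^sub>M borel)"
  proof -
    have "(\<lambda>(q, s). (if 0 \<le> s \<and> s \<le> snd q then 1 else 0) * g (fst q + s *\<^sub>R b))
        \<in> borel_measurable ((borel \<Otimes>\<^sub>M borel) \<Otimes>\<^sub>M lborel)"
      by measurable
    from lborel.borel_measurable_lebesgue_integral[OF this]
    have "(\<lambda>q. LINT s|lborel. (if 0 \<le> s \<and> s \<le> snd q then 1 else 0) * g (fst q + s *\<^sub>R b))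
        \<in> borel_measurable (borel \<Otimes>\<^sub>M borel)" by simp
    moreover have "(LINT s|lborel. (if 0 \<le> s \<and> s \<le> snd q then 1 else 0) * g (fst q + s *\<^sub>R b)) = A (fst q) (snd q)" for q
      unfolding A_def by (intro Bochner_Integration.integral_cong) (auto simp: indicator_def)
    ultimately show ?thesis by simp
  qed
  have "AE t in lborel. AE x in lborel. 0 \<le> t \<longrightarrow> w (x + t *\<^sub>R b) - w x = A x t"
  proof (rule AE_I2)
    fix t :: real
    show "AE x in lborel. 0 \<le> t \<longrightarrow> w (x + t *\<^sub>R b) - w x = A x t"
    proof (cases "0 \<le> t")
      case True
      have "AE x in lborel. w (x + t *\<^sub>R b) - w x = A x t"
        unfolding A_def by (rule weak_derivative_along_lines(1)) (use w g weak b True in auto)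
      then show ?thesis by eventually_elim simp
    qed simp
  qed
  moreover have "{q \<in> space (lborel \<Otimes>\<^sub>M lborel).
      0 \<le> snd q \<longrightarrow> w (fst q + snd q *\<^sub>R b) - w (fst q) = A (fst q) (snd q)} \<in> sets (lborel \<Otimes>\<^sub>M (lborel :: real measure))"
  proof -
    have [measurable]: "(\<lambda>q. A (fst q) (snd q)) \<in> borel_measurable (lborel \<Otimes>\<^sub>M (lborel :: real measure))"
      using A_meas by (simp cong: measurable_cong_sets)
    show ?thesis by measurable
  qed
  ultimately have line: "AE x in lborel. AE t in lborel. 0 \<le> t \<longrightarrow> w (x + t *\<^sub>R b) - w x = A x t"
    by (subst lborel_pair.AE_commute) auto
  have "AE x in lborel. integrable lborel (\<lambda>s. indicator {0..real N} s * g (x + s *\<^sub>R b))" for N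
    by (rule weak_derivative_along_lines(2)[where f = w]) (use w g weak b in auto)
  then have intg: "AE x in lborel. \<forall>N. integrable lborel (\<lambda>s. indicator {0..real N} s * g (x + s *\<^sub>R b))"
    by (subst AE_all_countable) auto
  have "AE x in lborel. (\<integral>\<^sup>+s. ennreal (\<bar>w (x + s *\<^sub>R b)\<bar> powr p) \<partial>lborel) < \<infinity>"
    by (rule AE_line_integral_finite[OF _ fin b]) measurable
  with line intg show ?thesis
  proof eventually_elim
    case (elim x)
    define h where "h t = w x + A x t" for t
    define gx where "gx s = g (x + s *\<^sub>R b)" for s
    have gx_meas [measurable]: "gx \<in> borel_measurable borel" unfolding gx_def by measurable
    have h_eq: "AE t in lborel. 0 \<le> t \<longrightarrow> w (x + t *\<^sub>R b) = h t"
      using elim(1) by eventually_elim (auto simp: h_def diff_eq_eq add.commute)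
    have gint: "set_integrable lborel {0..t} gx" for t
    proof -
      obtain N :: nat where N: "t \<le> real N" using real_arch_simple by blast
      have "set_integrable lborel {0..real N} gx"
        using elim(2) by (simp add: set_integrable_def gx_def)
      then show ?thesis by (rule set_integrable_subset) (use N in auto)
    qed
    have A_HK: "A x t = integral {0..t} gx" for t
      using set_borel_integral_eq_integral(2)[OF gint]
      by (simp add: A_def gx_def set_lebesgue_integral_def)
    have hcont: "continuous_on {0..T} h" for T
      unfolding h_def A_HK
      by (intro continuous_intros indefinite_integral_continuous_1 set_borel_integral_eq_integral(1)[OF gint])
    have bound: "ennreal (\<bar>w x\<bar> powr \<gamma>) \<le> ennreal (\<bar>h T\<bar> powr \<gamma>)
        + (\<integral>\<^sup>+s. ennreal (\<gamma> * \<bar>w (x + s *\<^sub>R b)\<bar> powr (\<gamma> - 1) * \<bar>g (x + s *\<^sub>R b)\<bar>) \<partial>lborel)"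
      if T: "0 \<le> T" for T
    proof -
      have "ennreal (\<bar>h 0\<bar> powr \<gamma>) \<le> ennreal (\<bar>h T\<bar> powr \<gamma>)
          + (\<integral>\<^sup>+s. indicator {0<..T} s * ennreal (\<gamma> * \<bar>h s\<bar> powr (\<gamma> - 1) * \<bar>gx s\<bar>) \<partial>lborel)"
      proof (rule powr_abs_increment_bound[OF T \<gamma> hcont])
        have "(\<integral>\<^sup>+s. indicator {0<..T} s * ennreal \<bar>gx s\<bar> \<partial>lborel)
            \<le> (\<integral>\<^sup>+s. ennreal (norm (indicator {0..T} s *\<^sub>R gx s)) \<partial>lborel)"
          by (intro nn_integral_mono) (auto simp: indicator_def)
        also have "\<dots> < \<infinity>"
          using gint[of T] by (simp add: set_integrable_def integrable_iff_bounded)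
        finally show "(\<integral>\<^sup>+s. indicator {0<..T} s * ennreal \<bar>gx s\<bar> \<partial>lborel) < \<infinity>" .
        fix a c :: real assume ac: "0 \<le> a" "a \<le> c" "c \<le> T"
        have i: "integrable lborel (\<lambda>s. indicator {0..t} s * gx s)" for t
          using gint by (simp add: set_integrable_def)
        have "h c - h a = (LINT s|lborel. indicator {0..c} s * gx s - indicator {0..a} s * gx s)"
          using i by (simp add: h_def A_def gx_def)
        also have "\<dots> = (LINT s|lborel. indicator {a<..c} s * gx s)"
          using ac by (intro Bochner_Integration.integral_cong) (auto simp: indicator_def)
        finally have eq: "h c - h a = (LINT s|lborel. indicator {a<..c} s * gx s)" .
        have "integrable lborel (\<lambda>s. indicator {a<..c} s * gx s)"
        proof -
          have "{a<..c} \<subseteq> {0..c}" using ac by auto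
          with set_integrable_subset[OF gint[of c], of "{a<..c}"] show ?thesis
            by (simp add: set_integrable_def)
        qed
        from integral_norm_bound_ennreal[OF this]
        show "ennreal \<bar>h c - h a\<bar> \<le> (\<integral>\<^sup>+s. indicator {a<..c} s * ennreal \<bar>gx s\<bar> \<partial>lborel)"
          by (simp add: eq abs_mult ennreal_mult'' ennreal_indicator)
      qed measurable
      also have "h 0 = w x"
      proof -
        have "A x 0 = 0" using A_HK[of 0] by simp
        then show ?thesis by (simp add: h_def)
      qed
      also have "(\<integral>\<^sup>+s. indicator {0<..T} s * ennreal (\<gamma> * \<bar>h s\<bar> powr (\<gamma> - 1) * \<bar>gx s\<bar>) \<partial>lborel)
          \<le> (\<integral>\<^sup>+s. ennreal (\<gamma> * \<bar>w (x + s *\<^sub>R b)\<bar> powr (\<gamma> - 1) * \<bar>g (x + s *\<^sub>R b)\<bar>) \<partial>lborel)"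
      proof (rule nn_integral_mono_AE)
        show "AE s in lborel. indicator {0<..T} s * ennreal (\<gamma> * \<bar>h s\<bar> powr (\<gamma> - 1) * \<bar>gx s\<bar>)
            \<le> ennreal (\<gamma> * \<bar>w (x + s *\<^sub>R b)\<bar> powr (\<gamma> - 1) * \<bar>g (x + s *\<^sub>R b)\<bar>)"
          using h_eq by eventually_elim (auto simp: indicator_def gx_def)
      qed
      finally show ?thesis by (simp add: add_left_mono)
    qed
    show ?case
    proof (rule ennreal_le_epsilon)
      fix e :: real assume e: "0 < e"
      have "\<exists>T\<ge>0. \<bar>h T\<bar> powr \<gamma> \<le> e"
      proof (rule ccontr)
        assume "\<not> ?thesis"
        then have big: "e < \<bar>h T\<bar> powr \<gamma>" if "0 \<le> T" for T using that by force
        define c where "c = (e powr (1 / \<gamma>)) powr p"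
        have c: "c > 0" using e by (simp add: c_def)
        have hc: "c \<le> \<bar>h T\<bar> powr p" if "0 \<le> T" for T
        proof -
          have "e powr (1 / \<gamma>) \<le> (\<bar>h T\<bar> powr \<gamma>) powr (1 / \<gamma>)"
            using big[OF that] e \<gamma> by (intro powr_mono2) auto
          then have "e powr (1 / \<gamma>) \<le> \<bar>h T\<bar>" using \<gamma> by (simp add: powr_powr)
          then show ?thesis unfolding c_def using p by (intro powr_mono2) auto
        qed
        have "\<infinity> = (\<integral>\<^sup>+s. ennreal c * indicator {0::real..} s \<partial>lborel)"
        proof -
          have "emeasure lborel {0::real..} = \<infinity>"
          proof (rule ccontr)
            assume "emeasure lborel {0::real..} \<noteq> \<infinity>"
            then obtain r where r: "emeasure lborel {0::real..} = ennreal r" "0 \<le> r"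
              by (cases "emeasure lborel {0::real..}") auto
            have "ennreal (r + 1) = emeasure lborel {0..r + 1}" using r by simp
            also have "\<dots> \<le> emeasure lborel {0::real..}" by (intro emeasure_mono) auto
            finally show False using r by simp
          qed
          then show ?thesis using c by (subst nn_integral_cmult_indicator) (auto simp: ennreal_mult_top)
        qed
        also have "\<dots> \<le> (\<integral>\<^sup>+s. ennreal (\<bar>w (x + s *\<^sub>R b)\<bar> powr p) \<partial>lborel)"
        proof (rule nn_integral_mono_AE)
          show "AE s in lborel. ennreal c * indicator {0::real..} s \<le> ennreal (\<bar>w (x + s *\<^sub>R b)\<bar> powr p)"
            using h_eq by eventually_elim (auto simp: indicator_def intro!: ennreal_leI hc)
        qed
        finally show False using elim(3) by simp
      qed
      then obtain T where T: "0 \<le> T" "\<bar>h T\<bar> powr \<gamma> \<le> e" by blast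
      have "ennreal (\<bar>w x\<bar> powr \<gamma>) \<le> ennreal (\<bar>h T\<bar> powr \<gamma>)
          + (\<integral>\<^sup>+s. ennreal (\<gamma> * \<bar>w (x + s *\<^sub>R b)\<bar> powr (\<gamma> - 1) * \<bar>g (x + s *\<^sub>R b)\<bar>) \<partial>lborel)"
        by (rule bound[OF T(1)])
      also have "\<dots> \<le> ennreal e
          + (\<integral>\<^sup>+s. ennreal (\<gamma> * \<bar>w (x + s *\<^sub>R b)\<bar> powr (\<gamma> - 1) * \<bar>g (x + s *\<^sub>R b)\<bar>) \<partial>lborel)"
        by (intro add_right_mono ennreal_leI T)
      finally show "ennreal (\<bar>w x\<bar> powr \<gamma>)
          \<le> (\<integral>\<^sup>+s. ennreal (\<gamma> * \<bar>w (x + s *\<^sub>R b)\<bar> powr (\<gamma> - 1) * \<bar>g (x + s *\<^sub>R b)\<bar>) \<partial>lborel) + ennreal e"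
        by (simp add: add.commute)
    qed
  qed
qed

text \<open>
  With \<open>\<gamma> = p / 2 + 1\<close> and dimension \<open>n\<close> one has \<open>\<gamma> * n / (n - 1) = p\<close>. The bound of \<open>\<bar>w\<bar> powr \<gamma>\<close> by
  line integrals of \<open>\<gamma> * \<bar>w\<bar> powr (p / 2) * norm G\<close> thus estimates the integral \<open>X\<close> of \<open>\<bar>w\<bar> powr p\<close>, and
  by the Cauchy-Schwarz inequality a lower power of \<open>X\<close> appears on the right. It can be divided out
  because \<open>X\<close> is finite.
\<close>

theorem sobolev_inequality_borel:
  fixes w :: "'a::euclidean_space \<Rightarrow> real" and G :: "'a \<Rightarrow> 'a"
  assumes n: "2 < DIM('a)" and p: "p = 2 * real DIM('a) / (real DIM('a) - 2)"
    and [measurable]: "w \<in> borel_measurable borel" "G \<in> borel_measurable borel"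
    and w_int: "integrable lborel (\<lambda>x. \<bar>w x\<bar> powr p)"
    and G_int: "integrable lborel (\<lambda>x. (norm (G x))\<^sup>2)"
    and weak: "\<And>b \<phi>. b \<in> Basis \<Longrightarrow> test_function UNIV \<phi> \<Longrightarrow>
      (LINT x|lborel. w x * dir_deriv b \<phi> x) = - (LINT x|lborel. (G x \<bullet> b) * \<phi> x)"
  shows "(LINT x|lborel. \<bar>w x\<bar> powr p) powr (1 / p)
    \<le> (p / 2 + 1) * sqrt (LINT x|lborel. (norm (G x))\<^sup>2)"
proof -
  obtain m where m: "DIM('a) = Suc m" "m > 0" using n by (cases "DIM('a)") auto
  define \<gamma> where "\<gamma> = p / 2 + 1"
  have p2: "p > 2" using n by (simp add: p field_simps)
  have \<gamma>: "1 < \<gamma>" "\<gamma> - 1 = p / 2" using p2 by (auto simp: \<gamma>_def)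
  have \<gamma>p: "\<gamma> / m * Suc m = p"
    using n m by (simp add: \<gamma>_def p field_simps)
  define X where "X = (LINT x|lborel. \<bar>w x\<bar> powr p)"
  define Y where "Y = (LINT x|lborel. (norm (G x))\<^sup>2)"
  have X0: "0 \<le> X" and Y0: "0 \<le> Y" by (auto simp: X_def Y_def)
  have X: "(\<integral>\<^sup>+x. ennreal (\<bar>w x\<bar> powr p) \<partial>lborel) = ennreal X"
    unfolding X_def by (intro nn_integral_eq_integral w_int) auto
  have Y: "(\<integral>\<^sup>+x. ennreal ((norm (G x))\<^sup>2) \<partial>lborel) = ennreal Y"
    unfolding Y_def by (intro nn_integral_eq_integral G_int) auto
  have loc: "integrable lborel (\<lambda>x. indicator C x * f x)"
    if C: "compact C" and [measurable]: "f \<in> borel_measurable borel"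
      and f: "integrable lborel v" "\<And>x. \<bar>f x\<bar> \<le> 1 + v x"
    for C :: "'a set" and f v :: "'a \<Rightarrow> real"
  proof -
    have [measurable]: "C \<in> sets borel" using C by (simp add: borel_compact)
    have "emeasure lborel C < \<infinity>" using emeasure_bounded_finite[OF compact_imp_bounded[OF C]] by simp
    then have "integrable lborel (indicator C :: 'a \<Rightarrow> real)"
      by (intro integrable_real_indicator) auto
    with f(1) have i: "integrable lborel (\<lambda>x. indicator C x + v x)" by simp
    show ?thesis
    proof (rule Bochner_Integration.integrable_bound[OF i])
      show "AE x in lborel. norm (indicator C x * f x) \<le> norm (indicator C x + v x)"
      proof (rule AE_I2)
        fix x show "norm (indicator C x * f x) \<le> norm (indicator C x + v x)"
          using f(2)[of x] by (cases "x \<in> C") auto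
      qed
    qed measurable
  qed
  have le_powr: "a \<le> 1 + a powr q" if "0 \<le> a" "1 \<le> q" for a q :: real
  proof (cases "a \<le> 1")
    case False
    then have "a powr 1 \<le> a powr q" using that by (intro powr_mono) auto
    then show ?thesis using False by simp
  qed (use powr_ge_zero[of a q] in linarith)
  have w_loc: "integrable lborel (\<lambda>x. indicator C x * w x)" if "compact C" for C
    by (rule loc[OF that _ w_int]) (use p2 le_powr in auto)
  have G_loc: "integrable lborel (\<lambda>x. indicator C x * (G x \<bullet> b))" if "compact C" "b \<in> Basis" for C b
  proof (rule loc[OF that(1) _ G_int])
    fix x
    have "\<bar>G x \<bullet> b\<bar> \<le> norm (G x)" using that by (simp add: Basis_le_norm)
    also have "\<dots> \<le> 1 + (norm (G x))\<^sup>2"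
      using le_powr[of "norm (G x)" 2] by simp
    finally show "\<bar>G x \<bullet> b\<bar> \<le> 1 + (norm (G x))\<^sup>2" .
  qed measurable
  define f where "f x = ennreal (\<gamma> * \<bar>w x\<bar> powr (p / 2) * norm (G x))" for x
  have [measurable]: "f \<in> borel_measurable borel" unfolding f_def by measurable
  have "(\<integral>\<^sup>+x. ennreal (\<bar>w x\<bar> powr (\<gamma> / m)) ^ Suc m \<partial>lborel) ^ m \<le> (\<integral>\<^sup>+x. f x \<partial>lborel) ^ Suc m"
  proof (rule nn_integral_power_le_line_integrals[OF _ _ m])
    fix b :: 'a assume b: "b \<in> Basis"
    have "AE x in lborel. ennreal (\<bar>w x\<bar> powr \<gamma>)
        \<le> (\<integral>\<^sup>+s. ennreal (\<gamma> * \<bar>w (x + s *\<^sub>R b)\<bar> powr (\<gamma> - 1) * \<bar>G (x + s *\<^sub>R b) \<bullet> b\<bar>) \<partial>lborel)"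
      by (rule weak_derivative_powr_bound[where p = p])
         (use w_loc G_loc weak b \<gamma> p2 X in auto)
    then show "AE x in lborel. ennreal (\<bar>w x\<bar> powr (\<gamma> / m)) ^ m \<le> (\<integral>\<^sup>+s. f (x + s *\<^sub>R b) \<partial>lborel)"
    proof eventually_elim
      case (elim x)
      have "ennreal (\<bar>w x\<bar> powr (\<gamma> / m)) ^ m = ennreal (\<bar>w x\<bar> powr \<gamma>)"
        using m by (cases "w x = 0") (auto simp: ennreal_power powr_power)
      also note elim
      also have "(\<integral>\<^sup>+s. ennreal (\<gamma> * \<bar>w (x + s *\<^sub>R b)\<bar> powr (\<gamma> - 1) * \<bar>G (x + s *\<^sub>R b) \<bullet> b\<bar>) \<partial>lborel)
          \<le> (\<integral>\<^sup>+s. f (x + s *\<^sub>R b) \<partial>lborel)"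
        unfolding f_def \<gamma>(2)
        using \<gamma>(1) b by (intro nn_integral_mono ennreal_leI mult_left_mono) (auto simp: Basis_le_norm)
      finally show ?case .
    qed
  qed measurable
  also have "(\<integral>\<^sup>+x. ennreal (\<bar>w x\<bar> powr (\<gamma> / m)) ^ Suc m \<partial>lborel) = ennreal X"
  proof -
    have "ennreal (\<bar>w x\<bar> powr (\<gamma> / m)) ^ Suc m = ennreal (\<bar>w x\<bar> powr p)" for x
      using m by (cases "w x = 0") (auto simp: ennreal_power powr_power \<gamma>p[symmetric] mult.commute simp del: power_Suc)
    then show ?thesis using X by simp
  qed
  finally have grid: "ennreal X ^ m \<le> (\<integral>\<^sup>+x. f x \<partial>lborel) ^ Suc m" .
  have "(\<integral>\<^sup>+x. ennreal (\<bar>w x\<bar> powr (p / 2)) * ennreal (norm (G x)) \<partial>lborel)\<^sup>2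
      \<le> (\<integral>\<^sup>+x. (ennreal (\<bar>w x\<bar> powr (p / 2)))\<^sup>2 \<partial>lborel) * (\<integral>\<^sup>+x. (ennreal (norm (G x)))\<^sup>2 \<partial>lborel)"
    by (rule Cauchy_Schwarz_nn_integral) measurable
  also have "(\<integral>\<^sup>+x. (ennreal (\<bar>w x\<bar> powr (p / 2)))\<^sup>2 \<partial>lborel) = ennreal X"
  proof -
    have "(ennreal (\<bar>w x\<bar> powr (p / 2)))\<^sup>2 = ennreal (\<bar>w x\<bar> powr p)" for x
      by (cases "w x = 0") (auto simp: ennreal_power powr_power)
    then show ?thesis using X by simp
  qed
  also have "(\<integral>\<^sup>+x. (ennreal (norm (G x)))\<^sup>2 \<partial>lborel) = ennreal Y"
    using Y by (simp add: ennreal_power)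
  also have "ennreal X * ennreal Y = (ennreal (sqrt (X * Y)))\<^sup>2"
    using X0 Y0 by (simp add: ennreal_power ennreal_mult'')
  finally have CS: "(\<integral>\<^sup>+x. ennreal (\<bar>w x\<bar> powr (p / 2)) * ennreal (norm (G x)) \<partial>lborel) \<le> ennreal (sqrt (X * Y))"
    by (rule ennreal_power_le_imp_le) simp
  have "(\<integral>\<^sup>+x. f x \<partial>lborel) = (\<integral>\<^sup>+x. ennreal \<gamma> * (ennreal (\<bar>w x\<bar> powr (p / 2)) * ennreal (norm (G x))) \<partial>lborel)"
    using \<gamma>(1) by (intro nn_integral_cong) (simp add: f_def ennreal_mult'' mult.assoc)
  also have "\<dots> = ennreal \<gamma> * (\<integral>\<^sup>+x. ennreal (\<bar>w x\<bar> powr (p / 2)) * ennreal (norm (G x)) \<partial>lborel)"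
    by (rule nn_integral_cmult) measurable
  also have "\<dots> \<le> ennreal \<gamma> * ennreal (sqrt (X * Y))"
    by (intro mult_left_mono CS) auto
  also have "\<dots> = ennreal (\<gamma> * sqrt (X * Y))"
    using X0 Y0 by (simp add: ennreal_mult'')
  finally have "(\<integral>\<^sup>+x. f x \<partial>lborel) ^ Suc m \<le> ennreal (\<gamma> * sqrt (X * Y)) ^ Suc m"
    by (rule power_mono) simp
  with grid have "ennreal X ^ m \<le> ennreal (\<gamma> * sqrt (X * Y)) ^ Suc m" by (rule order_trans)
  then have "ennreal (X ^ m) \<le> ennreal ((\<gamma> * sqrt (X * Y)) ^ Suc m)"
    using X0 Y0 \<gamma> by (simp add: ennreal_power del: power_Suc)
  then have le: "X ^ m \<le> (\<gamma> * sqrt (X * Y)) ^ Suc m"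
    using X0 Y0 \<gamma> by (subst (asm) ennreal_le_iff) auto
  have "X powr (1 / p) \<le> \<gamma> * sqrt Y"
  proof (cases "X = 0")
    case True
    then show ?thesis using \<gamma> Y0 by simp
  next
    case False
    then have Xpos: "X > 0" using X0 by simp
    have "(X powr (1 / p)) ^ Suc m * sqrt X ^ Suc m = X ^ m"
    proof -
      have "(X powr (1 / p)) ^ Suc m * sqrt X ^ Suc m = X powr ((1 / p + 1 / 2) * Suc m)"
        using Xpos by (simp add: powr_half_sqrt[symmetric] powr_power powr_add[symmetric] distrib_right del: power_Suc of_nat_Suc)
      also have "(1 / p + 1 / 2) * Suc m = real m"
        using n m by (simp add: p field_simps)
      finally show ?thesis using Xpos by (simp add: powr_realpow)
    qed
    also have "\<dots> \<le> (\<gamma> * sqrt Y) ^ Suc m * sqrt X ^ Suc m"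
      using le by (simp add: real_sqrt_mult power_mult_distrib ac_simps del: power_Suc)
    finally have "(X powr (1 / p)) ^ Suc m \<le> (\<gamma> * sqrt Y) ^ Suc m"
      using Xpos by (simp del: power_Suc)
    then show ?thesis
      using \<gamma> Y0 by (intro power_le_imp_le_base[of "X powr (1 / p)" m "\<gamma> * sqrt Y"]) auto
  qed
  then show ?thesis by (simp add: X_def Y_def \<gamma>_def)
qed

section \<open>The homogeneous Sobolev space\<close>

lemma locally_integrable_imp_measurable:
  fixes f :: "'a::euclidean_space \<Rightarrow> 'b::euclidean_space"
  assumes "locally_integrable f"
  shows "f \<in> borel_measurable lebesgue"
proof (rule borel_measurable_LIMSEQ_metric)
  show "(\<lambda>x. indicator (cball 0 (real n)) x *\<^sub>R f x) \<in> borel_measurable lebesgue" for n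
    using assms unfolding locally_integrable_def set_integrable_def
    by (intro borel_measurable_integrable) auto
  fix x :: 'a
  obtain N :: nat where N: "norm x \<le> real N" using real_arch_simple by blast
  have "\<forall>\<^sub>F n in sequentially. indicator (cball 0 (real n)) x *\<^sub>R f x = f x"
    using eventually_ge_at_top[of N] by eventually_elim (use N in \<open>auto simp: indicator_def\<close>)
  then show "(\<lambda>n. indicator (cball 0 (real n)) x *\<^sub>R f x) \<longlonglongrightarrow> f x"
    by (rule tendsto_eventually)
qed

lemma
  fixes F F' :: "'a \<Rightarrow> 'b::{banach, second_countable_topology}"
  assumes "AE x in M. f x = f' x" "F \<in> borel_measurable M" "F' \<in> borel_measurable M"
    and "\<And>x. f x = f' x \<Longrightarrow> F x = F' x"
  shows integrable_AE_subst: "integrable M F \<longleftrightarrow> integrable M F'"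
    and integral_AE_subst: "integral\<^sup>L M F = integral\<^sup>L M F'"
proof -
  have ae: "AE x in M. F x = F' x" using assms(1) by eventually_elim (rule assms(4))
  show "integrable M F \<longleftrightarrow> integrable M F'" by (rule integrable_cong_AE[OF assms(2,3) ae])
  show "integral\<^sup>L M F = integral\<^sup>L M F'" by (rule integral_cong_AE[OF assms(2,3) ae])
qed

lemma in_Lp_AE_cong:
  assumes "in_Lp p f" "g \<in> borel_measurable lebesgue" "AE x in lebesgue. f x = g x"
  shows "in_Lp p g"
proof -
  have "integrable lebesgue (\<lambda>x. norm (f x) powr p) \<longleftrightarrow> integrable lebesgue (\<lambda>x. norm (g x) powr p)"
    by (rule integrable_AE_subst[OF assms(3)]) (use assms in \<open>auto simp: in_Lp_def\<close>)
  with assms show ?thesis by (simp add: in_Lp_def)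
qed

lemma in_Lp_add:
  assumes "in_Lp p f" "in_Lp p g" "0 \<le> p"
  shows "in_Lp p (\<lambda>x. f x + g x)"
proof -
  have m: "f \<in> borel_measurable lebesgue" "g \<in> borel_measurable lebesgue"
    and i: "integrable lebesgue (\<lambda>x. norm (f x) powr p)" "integrable lebesgue (\<lambda>x. norm (g x) powr p)"
    using assms by (auto simp: in_Lp_def)
  have "integrable lebesgue (\<lambda>x. norm (f x + g x) powr p)"
  proof (rule Bochner_Integration.integrable_bound)
    show "integrable lebesgue (\<lambda>x. 2 powr p * (norm (f x) powr p + norm (g x) powr p))"
      using i by (intro integrable_mult_right Bochner_Integration.integrable_add)
    show "(\<lambda>x. norm (f x + g x) powr p) \<in> borel_measurable lebesgue"
      using m by measurable
    have "norm (a + b) powr p \<le> 2 powr p * (norm a powr p + norm b powr p)" for a b :: 'b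
    proof -
      have "norm (a + b) \<le> 2 * max (norm a) (norm b)"
        using norm_triangle_ineq[of a b] by linarith
      then have "norm (a + b) powr p \<le> (2 * max (norm a) (norm b)) powr p"
        using assms(3) by (intro powr_mono2) auto
      also have "\<dots> = 2 powr p * max (norm a) (norm b) powr p"
        by (simp add: powr_mult)
      also have "\<dots> \<le> 2 powr p * (norm a powr p + norm b powr p)"
        by (intro mult_left_mono) (auto simp: max_def)
      finally show ?thesis .
    qed
    then show "AE x in lebesgue. norm (norm (f x + g x) powr p)
        \<le> norm (2 powr p * (norm (f x) powr p + norm (g x) powr p))"
      by (auto intro!: AE_I2)
  qed
  then show ?thesis using m by (simp add: in_Lp_def)
qed

lemma in_Lp_minus: "in_Lp p f \<Longrightarrow> in_Lp p (\<lambda>x. - f x)"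
  by (auto simp: in_Lp_def)

lemma locally_integrable_add:
  "locally_integrable f \<Longrightarrow> locally_integrable g \<Longrightarrow> locally_integrable (\<lambda>x. f x + g x)"
  unfolding locally_integrable_def by (auto intro: set_integral_add)

lemma locally_integrable_minus:
  "locally_integrable f \<Longrightarrow> locally_integrable (\<lambda>x. - f x)"
  unfolding locally_integrable_def set_integrable_def by (simp add: scaleR_minus_right)

lemma weak_gradient_add:
  assumes "weak_gradient f F" "weak_gradient g G"
  shows "weak_gradient (\<lambda>x. f x + g x) (\<lambda>x. F x + G x)"
proof -
  have l: "locally_integrable f" "locally_integrable g" "locally_integrable F" "locally_integrable G"
    using assms by (auto simp: weak_gradient_def)
  have "(LINT x|lebesgue. (f x + g x) * dir_deriv b \<phi> x) = - (LINT x|lebesgue. ((F x + G x) \<bullet> b) * \<phi> x)"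
    if t: "test_function UNIV \<phi>" and b: "b \<in> Basis" for b \<phi>
  proof -
    note d = test_function_dir_deriv[OF t b]
    have "(LINT x|lebesgue. (f x + g x) * dir_deriv b \<phi> x)
        = (LINT x|lebesgue. f x * dir_deriv b \<phi> x) + (LINT x|lebesgue. g x * dir_deriv b \<phi> x)"
      unfolding distrib_right
      by (intro Bochner_Integration.integral_add integrable_mult_test_function[OF _ d] l)
    also have "\<dots> = - ((LINT x|lebesgue. (F x \<bullet> b) * \<phi> x) + (LINT x|lebesgue. (G x \<bullet> b) * \<phi> x))"
      using assms t b by (simp add: weak_gradient_def)
    also have "(LINT x|lebesgue. (F x \<bullet> b) * \<phi> x) + (LINT x|lebesgue. (G x \<bullet> b) * \<phi> x)
        = (LINT x|lebesgue. ((F x + G x) \<bullet> b) * \<phi> x)"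
      unfolding inner_add_left distrib_right
      by (intro Bochner_Integration.integral_add[symmetric] integrable_mult_test_function[OF _ t]
          locally_integrable_inner l)
    finally show ?thesis .
  qed
  then show ?thesis using l by (simp add: weak_gradient_def locally_integrable_add)
qed

lemma weak_gradient_minus:
  "weak_gradient f F \<Longrightarrow> weak_gradient (\<lambda>x. - f x) (\<lambda>x. - F x)"
  by (simp add: weak_gradient_def locally_integrable_minus)

lemma in_Hdot1_add:
  assumes "in_Hdot1 f" "in_Hdot1 g"
  shows "in_Hdot1 (\<lambda>x. f x + g x)"
proof -
  obtain F G where "weak_gradient f F" "in_Lp 2 F" "weak_gradient g G" "in_Lp 2 G"
    using assms by (auto simp: in_Hdot1_def)
  then have "weak_gradient (\<lambda>x. f x + g x) (\<lambda>x. F x + G x)" "in_Lp 2 (\<lambda>x. F x + G x)"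
    by (simp_all add: weak_gradient_add in_Lp_add)
  moreover have "in_Lp (10/3) (\<lambda>x. f x + g x)"
    using assms by (intro in_Lp_add) (simp_all add: in_Hdot1_def)
  ultimately show ?thesis unfolding in_Hdot1_def by blast
qed

lemma in_Hdot1_minus:
  assumes "in_Hdot1 f"
  shows "in_Hdot1 (\<lambda>x. - f x)"
proof -
  obtain F where "weak_gradient f F" "in_Lp 2 F" "in_Lp (10/3) f"
    using assms by (auto simp: in_Hdot1_def)
  then have "weak_gradient (\<lambda>x. - f x) (\<lambda>x. - F x)" "in_Lp 2 (\<lambda>x. - F x)" "in_Lp (10/3) (\<lambda>x. - f x)"
    by (simp_all add: weak_gradient_minus in_Lp_minus)
  then show ?thesis unfolding in_Hdot1_def by blast
qed

lemma in_Hdot1_diff: "in_Hdot1 f \<Longrightarrow> in_Hdot1 g \<Longrightarrow> in_Hdot1 (\<lambda>x. f x - g x)"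
  using in_Hdot1_add[OF _ in_Hdot1_minus, of f g] by simp

lemma in_Hdot1_zero: "in_Hdot1 (\<lambda>x. 0)"
proof -
  have "weak_gradient (\<lambda>x::real^5. 0) (\<lambda>x. 0)"
    by (simp add: weak_gradient_def locally_integrable_def set_integrable_def)
  then show ?thesis by (auto simp: in_Hdot1_def in_Lp_def intro!: exI[of _ "\<lambda>x. 0"])
qed

lemma in_Hdot1_sum:
  "(\<And>i. i \<in> I \<Longrightarrow> in_Hdot1 (f i)) \<Longrightarrow> in_Hdot1 (\<lambda>x. \<Sum>i\<in>I. f i x)"
  by (induction I rule: infinite_finite_induct) (auto intro: in_Hdot1_zero in_Hdot1_add)

text \<open>
  The weak gradient selected in the norm agrees almost everywhere with a square integrable one.
\<close>

lemma Hdot1_norm_gradient: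
  assumes "in_Hdot1 f"
  obtains G where "weak_gradient f G" "in_Lp 2 G" "Hdot1_norm f = Lp_norm 2 G"
proof -
  define G where "G = (SOME G. weak_gradient f G)"
  obtain G' where G': "weak_gradient f G'" "in_Lp 2 G'"
    using assms by (auto simp: in_Hdot1_def)
  have G: "weak_gradient f G" unfolding G_def by (rule someI[of "weak_gradient f", OF G'(1)])
  have "in_Lp 2 G"
  proof (rule in_Lp_AE_cong[OF G'(2)])
    show "G \<in> borel_measurable lebesgue"
      using G by (intro locally_integrable_imp_measurable) (simp add: weak_gradient_def)
  qed (rule weak_gradient_unique[OF G'(1) G])
  with G show ?thesis by (rule that) (simp add: Hdot1_norm_def G_def)
qed

lemma Lp_norm_2: "Lp_norm 2 f = sqrt (LINT x|lebesgue. (norm (f x))\<^sup>2)"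
  by (simp add: Lp_norm_def powr_half_sqrt)

lemma Lp_norm_nonneg: "0 \<le> Lp_norm p f" by (simp add: Lp_norm_def)

lemma Hdot1_norm_nonneg: "0 \<le> Hdot1_norm f" by (simp add: Hdot1_norm_def Lp_norm_nonneg)

lemma in_Lp_2_iff:
  "in_Lp 2 f \<longleftrightarrow> f \<in> borel_measurable lebesgue \<and> integrable lebesgue (\<lambda>x. (norm (f x))\<^sup>2)"
  by (simp add: in_Lp_def)

lemma integral_Cauchy_Schwarz:
  fixes f g :: "'a \<Rightarrow> real"
  assumes [measurable]: "f \<in> borel_measurable M" "g \<in> borel_measurable M"
    and f: "integrable M (\<lambda>x. (f x)\<^sup>2)" and g: "integrable M (\<lambda>x. (g x)\<^sup>2)"
  shows "integrable M (\<lambda>x. f x * g x)"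
    and "\<bar>LINT x|M. f x * g x\<bar> \<le> sqrt (LINT x|M. (f x)\<^sup>2) * sqrt (LINT x|M. (g x)\<^sup>2)"
proof -
  define A B where "A = (LINT x|M. (f x)\<^sup>2)" and "B = (LINT x|M. (g x)\<^sup>2)"
  have AB: "0 \<le> A" "0 \<le> B" by (auto simp: A_def B_def)
  have "(\<integral>\<^sup>+x. ennreal \<bar>f x\<bar> * ennreal \<bar>g x\<bar> \<partial>M)\<^sup>2
      \<le> (\<integral>\<^sup>+x. (ennreal \<bar>f x\<bar>)\<^sup>2 \<partial>M) * (\<integral>\<^sup>+x. (ennreal \<bar>g x\<bar>)\<^sup>2 \<partial>M)"
    by (rule Cauchy_Schwarz_nn_integral) measurable
  also have "(\<integral>\<^sup>+x. (ennreal \<bar>f x\<bar>)\<^sup>2 \<partial>M) = ennreal A"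
    unfolding A_def using f by (simp add: ennreal_power nn_integral_eq_integral)
  also have "(\<integral>\<^sup>+x. (ennreal \<bar>g x\<bar>)\<^sup>2 \<partial>M) = ennreal B"
    unfolding B_def using g by (simp add: ennreal_power nn_integral_eq_integral)
  also have "ennreal A * ennreal B = (ennreal (sqrt A * sqrt B))\<^sup>2"
    using AB by (simp add: ennreal_power power_mult_distrib ennreal_mult'')
  finally have "(\<integral>\<^sup>+x. ennreal \<bar>f x\<bar> * ennreal \<bar>g x\<bar> \<partial>M) \<le> ennreal (sqrt A * sqrt B)"
    by (rule ennreal_power_le_imp_le) simp
  then have le: "(\<integral>\<^sup>+x. ennreal (norm (f x * g x)) \<partial>M) \<le> ennreal (sqrt A * sqrt B)"
    by (simp add: abs_mult ennreal_mult'')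
  show int: "integrable M (\<lambda>x. f x * g x)"
    by (rule integrableI_bounded) (use le in \<open>auto intro: le_less_trans\<close>)
  from order_trans[OF integral_norm_bound_ennreal[OF int] le]
  show "\<bar>LINT x|M. f x * g x\<bar> \<le> sqrt (LINT x|M. (f x)\<^sup>2) * sqrt (LINT x|M. (g x)\<^sup>2)"
    using AB by (subst (asm) ennreal_le_iff) (auto simp: A_def B_def)
qed

lemma test_function_square_integrable:
  assumes t: "test_function U \<phi>"
  shows "\<phi> \<in> borel_measurable lebesgue" "integrable lebesgue (\<lambda>x. (\<phi> x)\<^sup>2)"
proof -
  have c: "continuous_on UNIV \<phi>"
    using t by (simp add: test_function_def smooth_imp_continuous_on)
  then show "\<phi> \<in> borel_measurable lebesgue" by (rule continuous_borel_measurable_lebesgue)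
  show "integrable lebesgue (\<lambda>x. (\<phi> x)\<^sup>2)"
    unfolding power2_eq_square
    by (rule integrable_mult_test_function[OF continuous_imp_locally_integrable[OF c] t])
qed

lemma weak_gradient_pairing_bound:
  fixes f :: "'a::euclidean_space \<Rightarrow> real"
  assumes G: "weak_gradient f G" "in_Lp 2 G" and t: "test_function UNIV \<phi>" and b: "b \<in> Basis"
  shows "\<bar>LINT x|lebesgue. f x * dir_deriv b \<phi> x\<bar> \<le> Lp_norm 2 G * Lp_norm 2 \<phi>"
proof -
  have mG: "G \<in> borel_measurable lebesgue" and iG: "integrable lebesgue (\<lambda>x. (norm (G x))\<^sup>2)"
    using G by (auto simp: in_Lp_2_iff)
  have mGb: "(\<lambda>x. G x \<bullet> b) \<in> borel_measurable lebesgue" using mG by measurable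
  have le: "(G x \<bullet> b)\<^sup>2 \<le> (norm (G x))\<^sup>2" for x
    using Basis_le_norm[OF b, of "G x"] by (metis abs_ge_zero power2_abs power_mono)
  have iGb: "integrable lebesgue (\<lambda>x. (G x \<bullet> b)\<^sup>2)"
    by (rule Bochner_Integration.integrable_bound[OF iG]) (use mGb le in auto)
  have "\<bar>LINT x|lebesgue. f x * dir_deriv b \<phi> x\<bar> = \<bar>LINT x|lebesgue. (G x \<bullet> b) * \<phi> x\<bar>"
    using G t b by (simp add: weak_gradient_def)
  also have "\<dots> \<le> sqrt (LINT x|lebesgue. (G x \<bullet> b)\<^sup>2) * sqrt (LINT x|lebesgue. (\<phi> x)\<^sup>2)"
    by (rule integral_Cauchy_Schwarz(2)[OF mGb test_function_square_integrable(1)[OF t] iGb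
          test_function_square_integrable(2)[OF t]])
  also have "\<dots> \<le> sqrt (LINT x|lebesgue. (norm (G x))\<^sup>2) * sqrt (LINT x|lebesgue. (\<phi> x)\<^sup>2)"
    by (intro mult_right_mono real_sqrt_le_mono integral_mono iGb iG le) auto
  finally show ?thesis by (simp add: Lp_norm_2)
qed

text \<open>
  The Sobolev inequality in dimension 5, where \<open>p = 10/3\<close> and \<open>p / 2 + 1 = 8/3\<close>, transferred to
  Lebesgue measurable functions through Borel representatives.
\<close>

lemma sobolev_Hdot1:
  assumes "in_Hdot1 f"
  shows "Lp_norm (10/3) f \<le> 8/3 * Hdot1_norm f"
proof -
  obtain G where G: "weak_gradient f G" "in_Lp 2 G" "Hdot1_norm f = Lp_norm 2 G"
    using Hdot1_norm_gradient[OF assms] .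
  have mf: "f \<in> borel_measurable lebesgue" and intf: "integrable lebesgue (\<lambda>x. \<bar>f x\<bar> powr (10/3))"
    using assms by (auto simp: in_Hdot1_def in_Lp_def)
  have mG: "G \<in> borel_measurable lebesgue" and iG: "integrable lebesgue (\<lambda>x. (norm (G x))\<^sup>2)"
    using G by (auto simp: in_Lp_2_iff)
  obtain f' where f': "f' \<in> borel_measurable lborel" "AE x in lborel. f x = f' x"
    using completion_ex_borel_measurable_real[OF mf] by auto
  have "\<exists>g'\<in>borel_measurable lborel. AE x in lborel. G x \<bullet> b = g' x" for b
    by (rule completion_ex_borel_measurable_real) (use mG in measurable)
  then obtain g' where g': "\<And>b. g' b \<in> borel_measurable lborel" "\<And>b. AE x in lborel. G x \<bullet> b = g' b x"
    by metis
  define G' where "G' x = (\<Sum>b\<in>Basis. g' b x *\<^sub>R b)" for x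
  have mG': "G' \<in> borel_measurable lborel" unfolding G'_def using g'(1) by measurable
  have "AE x in lborel. \<forall>b\<in>Basis. G x \<bullet> b = g' b x"
    using g'(2) by (subst AE_finite_all) auto
  then have "AE x in lborel. G x = G' x"
  proof eventually_elim
    case (elim x)
    have "G x = (\<Sum>b\<in>Basis. (G x \<bullet> b) *\<^sub>R b)" by (simp add: euclidean_representation)
    also have "\<dots> = G' x" unfolding G'_def using elim by (intro sum.cong) auto
    finally show ?case .
  qed
  then have aeG: "AE x in lebesgue. G x = G' x" by (rule AE_completion)
  have aef: "AE x in lebesgue. f x = f' x" using f'(2) by (rule AE_completion)
  have mf'l: "f' \<in> borel_measurable lebesgue" and mG'l: "G' \<in> borel_measurable lebesgue"
    using f'(1) mG' by (auto intro: measurable_completion)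
  have [measurable]: "f' \<in> borel_measurable borel" "G' \<in> borel_measurable borel"
    using f'(1) mG' by simp_all
  have mF: "(\<lambda>x. \<bar>f x\<bar> powr (10/3)) \<in> borel_measurable lebesgue"
      "(\<lambda>x. \<bar>f' x\<bar> powr (10/3)) \<in> borel_measurable lebesgue"
    using mf mf'l by measurable
  have mN: "(\<lambda>x. (norm (G x))\<^sup>2) \<in> borel_measurable lebesgue"
      "(\<lambda>x. (norm (G' x))\<^sup>2) \<in> borel_measurable lebesgue"
    using mG mG'l by measurable
  have F1: "integrable lebesgue (\<lambda>x. \<bar>f' x\<bar> powr (10/3))"
    using intf integrable_AE_subst[OF aef mF] by simp
  have F2: "(LINT x|lebesgue. \<bar>f x\<bar> powr (10/3)) = (LINT x|lebesgue. \<bar>f' x\<bar> powr (10/3))"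
    by (rule integral_AE_subst[OF aef mF]) simp
  have G1: "integrable lebesgue (\<lambda>x. (norm (G' x))\<^sup>2)"
    using iG integrable_AE_subst[OF aeG mN] by simp
  have G2: "(LINT x|lebesgue. (norm (G x))\<^sup>2) = (LINT x|lebesgue. (norm (G' x))\<^sup>2)"
    by (rule integral_AE_subst[OF aeG mN]) simp
  have weak: "(LINT x|lborel. f' x * dir_deriv b \<phi> x) = - (LINT x|lborel. (G' x \<bullet> b) * \<phi> x)"
    if b: "b \<in> Basis" and t: "test_function UNIV \<phi>" for b \<phi>
  proof -
    note td = test_function_dir_deriv[OF t b]
    have [measurable]: "\<phi> \<in> borel_measurable borel" "dir_deriv b \<phi> \<in> borel_measurable borel"
      using t td by (auto simp: test_function_def)
    have "(LINT x|lborel. f' x * dir_deriv b \<phi> x) = (LINT x|lebesgue. f' x * dir_deriv b \<phi> x)"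
      by (intro integral_completion[symmetric]) measurable
    also have "\<dots> = (LINT x|lebesgue. f x * dir_deriv b \<phi> x)"
      using mf mf'l test_function_square_integrable(1)[OF td]
      by (intro integral_AE_subst[OF aef, symmetric] borel_measurable_times) auto
    also have "\<dots> = - (LINT x|lebesgue. (G x \<bullet> b) * \<phi> x)"
      using G(1) t b by (simp add: weak_gradient_def)
    also have "(LINT x|lebesgue. (G x \<bullet> b) * \<phi> x) = (LINT x|lebesgue. (G' x \<bullet> b) * \<phi> x)"
      using mG mG'l test_function_square_integrable(1)[OF t]
      by (intro integral_AE_subst[OF aeG] borel_measurable_times borel_measurable_inner) auto
    also have "\<dots> = (LINT x|lborel. (G' x \<bullet> b) * \<phi> x)"
      by (intro integral_completion) measurable
    finally show ?thesis .
  qed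
  have "(LINT x|lborel. \<bar>f' x\<bar> powr (10/3)) powr (1 / (10/3))
      \<le> (10/3 / 2 + 1) * sqrt (LINT x|lborel. (norm (G' x))\<^sup>2)"
  proof (rule sobolev_inequality_borel)
    show "integrable lborel (\<lambda>x. \<bar>f' x\<bar> powr (10/3))"
      using F1 f'(1) by (subst (asm) integrable_completion) auto
    show "integrable lborel (\<lambda>x. (norm (G' x))\<^sup>2)"
      using G1 mG' by (subst (asm) integrable_completion) auto
  qed (use f'(1) mG' weak in auto)
  also have "(LINT x|lborel. \<bar>f' x\<bar> powr (10/3)) = (LINT x|lebesgue. \<bar>f x\<bar> powr (10/3))"
    unfolding F2 by (intro integral_completion[symmetric]) measurable
  also have "(LINT x|lborel. (norm (G' x))\<^sup>2) = (LINT x|lebesgue. (norm (G x))\<^sup>2)"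
    unfolding G2 by (intro integral_completion[symmetric]) measurable
  finally show ?thesis unfolding G(3) Lp_norm_2 by (simp add: Lp_norm_def)
qed

section \<open>Bubbles\<close>

text \<open>
  All derivatives of a bubble are polynomials times powers of this function.
\<close>

definition bracket :: "real \<Rightarrow> 'a \<Rightarrow> 'a::euclidean_space \<Rightarrow> real" where
  "bracket l z x = 1 + (norm (x - z))\<^sup>2 / (15 * l\<^sup>2)"

lemma bracket_ge_1: "1 \<le> bracket l z x" by (simp add: bracket_def)

lemma bracket_pos: "0 < bracket l z x" using bracket_ge_1[of l z x] by linarith

lemma continuous_on_bracket_powr: "continuous_on S (\<lambda>x. bracket l z x powr r)"
proof -
  have "continuous_on S (bracket l z)"
    unfolding bracket_def[abs_def] divide_inverse
    by (intro continuous_on_add continuous_on_mult continuous_on_const continuous_on_power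
        continuous_on_norm continuous_on_diff continuous_on_id)
  then show ?thesis
    using bracket_pos[of l z]
    by (intro continuous_on_powr continuous_on_const) (auto simp: less_imp_neq[symmetric])
qed

lemma bracket_eq_unit:
  assumes "l > 0"
  shows "bracket l z x = bracket 1 0 ((x - z) /\<^sub>R l)"
proof -
  have "norm ((x - z) /\<^sub>R l) = norm (x - z) / l"
    using assms by (simp only: norm_scaleR) (simp add: divide_inverse mult.commute)
  then show ?thesis by (simp add: bracket_def power_divide mult.commute)
qed

lemma bubble_eq_bracket:
  assumes "l > 0"
  shows "bubble l z x = l powr (-3/2) * bracket l z x powr (-3/2)"
  unfolding bracket_eq_unit[OF assms] by (simp add: bubble_def W_def bracket_def)

lemma has_derivative_bracket_powr:
  fixes x :: "'a::euclidean_space"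
  shows "((\<lambda>x. bracket l z x powr r) has_derivative
    (\<lambda>h. (2 * r / (15 * l\<^sup>2)) * ((x - z) \<bullet> h) * bracket l z x powr (r - 1))) (at x)"
proof -
  have "((\<lambda>x. bracket l z x) has_derivative (\<lambda>h. 2 * ((x - z) \<bullet> h) / (15 * l\<^sup>2))) (at x)"
  proof -
    have eq: "bracket l z = (\<lambda>x. 1 + inverse (15 * l\<^sup>2) * ((x - z) \<bullet> (x - z)))"
      by (rule ext) (simp only: bracket_def power2_norm_eq_inner divide_inverse mult.commute)
    have "((\<lambda>x. x - z) has_derivative (\<lambda>h. h)) (at x)"
      by (auto intro!: derivative_eq_intros)
    from has_derivative_add[OF has_derivative_const
        has_derivative_mult_right[OF has_derivative_inner[OF this this], of "inverse (15 * l\<^sup>2)"], of 1]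
    have "(bracket l z has_derivative
        (\<lambda>h. 0 + inverse (15 * l\<^sup>2) * ((x - z) \<bullet> h + h \<bullet> (x - z)))) (at x)"
      unfolding eq .
    moreover have "0 + inverse (15 * l\<^sup>2) * ((x - z) \<bullet> h + h \<bullet> (x - z)) = 2 * ((x - z) \<bullet> h) / (15 * l\<^sup>2)" for h
      unfolding inner_commute[of h] by (simp only: divide_inverse add_0 mult_2[symmetric] mult.commute)
    ultimately show ?thesis by (simp only:)
  qed
  from has_derivative_powr[OF this has_derivative_const, of r] bracket_pos[of l z x]
  show ?thesis
    by (simp add: powr_diff field_simps)
qed

lemma dir_deriv_bubble:
  assumes "l > 0"
  shows "dir_deriv b (bubble l z) x
    = - (1/5) * l powr (-7/2) * ((x - z) \<bullet> b) * bracket l z x powr (-5/2)"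
    and "bubble l z differentiable (at x)"
proof -
  have eq: "bubble l z = (\<lambda>x. l powr (-3/2) * bracket l z x powr (-3/2))"
    using assms by (auto simp: bubble_eq_bracket)
  have l: "l powr (-3/2) / l\<^sup>2 = l powr (-7/2)"
    using assms by (simp add: powr_diff[symmetric] flip: powr_numeral)
  have d: "((\<lambda>x. l powr (-3/2) * bracket l z x powr (-3/2)) has_derivative
    (\<lambda>h. l powr (-3/2) * ((2 * (-3/2) / (15 * l\<^sup>2)) * ((x - z) \<bullet> h) * bracket l z x powr (-3/2 - 1)))) (at x)"
    by (rule has_derivative_mult_right[OF has_derivative_bracket_powr])
  show "bubble l z differentiable (at x)" unfolding eq differentiable_def using d by blast
  show "dir_deriv b (bubble l z) x
    = - (1/5) * l powr (-7/2) * ((x - z) \<bullet> b) * bracket l z x powr (-5/2)"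
    unfolding eq dir_deriv_eq[OF d] l[symmetric] by simp
qed

lemma continuous_dir_deriv_bubble:
  assumes "l > 0"
  shows "continuous_on UNIV (dir_deriv b (bubble l z))"
  unfolding dir_deriv_bubble(1)[OF assms, abs_def]
  by (intro continuous_intros continuous_on_bracket_powr)

lemma dir_deriv_dir_deriv_bubble:
  assumes l: "l > 0" and b: "b \<in> Basis"
  shows "dir_deriv b (dir_deriv b (bubble l z)) x
    = - (1/5) * l powr (-7/2) * (bracket l z x powr (-5/2)
        - ((x - z) \<bullet> b)\<^sup>2 / (3 * l\<^sup>2) * bracket l z x powr (-7/2))"
    and "dir_deriv b (bubble l z) differentiable (at x)"
proof -
  have eq: "dir_deriv b (bubble l z) = (\<lambda>x. (- (1/5) * l powr (-7/2)) * (((x - z) \<bullet> b) * bracket l z x powr (-5/2)))"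
    by (auto simp: dir_deriv_bubble(1)[OF l])
  have d1: "((\<lambda>x. (x - z) \<bullet> b) has_derivative (\<lambda>h. h \<bullet> b)) (at x)"
    by (auto intro!: derivative_eq_intros)
  note d = has_derivative_mult_right[OF has_derivative_mult[OF d1 has_derivative_bracket_powr[of l z "-5/2" x]],
      of "- (1/5) * l powr (-7/2)"]
  show "dir_deriv b (bubble l z) differentiable (at x)" unfolding eq differentiable_def using d by blast
  show "dir_deriv b (dir_deriv b (bubble l z)) x
    = - (1/5) * l powr (-7/2) * (bracket l z x powr (-5/2)
        - ((x - z) \<bullet> b)\<^sup>2 / (3 * l\<^sup>2) * bracket l z x powr (-7/2))"
    unfolding eq dir_deriv_eq[OF d] using b by (simp add: power2_eq_square field_simps)
qed

lemma continuous_dir_deriv_dir_deriv_bubble: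
  assumes "l > 0" "b \<in> Basis"
  shows "continuous_on UNIV (dir_deriv b (dir_deriv b (bubble l z)))"
  unfolding dir_deriv_dir_deriv_bubble(1)[OF assms, abs_def]
  using assms by (intro continuous_intros continuous_on_bracket_powr) auto

definition laplacian :: "('a::euclidean_space \<Rightarrow> real) \<Rightarrow> 'a \<Rightarrow> real" where
  "laplacian f x = (\<Sum>b\<in>Basis. dir_deriv b (dir_deriv b f) x)"

lemma bubble_powr: "l > 0 \<Longrightarrow> bubble l z x powr (7/3) = l powr (-7/2) * bracket l z x powr (-7/2)"
  using bracket_pos[of l z x] by (simp add: bubble_eq_bracket powr_mult powr_powr)

text \<open>
  The second derivatives add up to \<open>5 * q powr (-5/2) - (norm (x - z))\<^sup>2 / (3 * l\<^sup>2) * q powr (-7/2)\<close>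
  up to a factor, where \<open>q\<close> is the bracket, and \<open>(norm (x - z))\<^sup>2 = 15 * l\<^sup>2 * (q - 1)\<close>.
\<close>

lemma laplacian_bubble:
  assumes l: "l > 0"
  shows "laplacian (bubble l z) x = - (bubble l z x powr (7/3))"
proof -
  define q where "q = bracket l z x"
  have q: "q > 0" by (simp add: q_def bracket_pos)
  have n: "(\<Sum>b\<in>Basis. ((x - z) \<bullet> b)\<^sup>2) = (norm (x - z))\<^sup>2"
    unfolding norm_eq_sqrt_inner euclidean_inner[of "x - z" "x - z"] by (simp add: power2_eq_square sum_nonneg)
  have "laplacian (bubble l z) x
      = - (1/5) * l powr (-7/2) * (\<Sum>b\<in>(Basis :: (real^5) set). q powr (-5/2) - ((x - z) \<bullet> b)\<^sup>2 / (3 * l\<^sup>2) * q powr (-7/2))"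
    unfolding laplacian_def sum_distrib_left q_def
    by (intro sum.cong) (auto simp: dir_deriv_dir_deriv_bubble[OF l])
  also have "(\<Sum>b\<in>(Basis :: (real^5) set). q powr (-5/2) - ((x - z) \<bullet> b)\<^sup>2 / (3 * l\<^sup>2) * q powr (-7/2))
      = 5 * q powr (-5/2) - (norm (x - z))\<^sup>2 / (3 * l\<^sup>2) * q powr (-7/2)"
    unfolding sum_subtractf sum_distrib_right[symmetric] sum_divide_distrib[symmetric] n by simp
  also have "q powr (-5/2) = q * q powr (-7/2)"
    using q by (simp add: powr_mult_base)
  also have "5 * (q * q powr (-7/2)) - (norm (x - z))\<^sup>2 / (3 * l\<^sup>2) * q powr (-7/2) = 5 * q powr (-7/2)"
    using l by (simp add: q_def bracket_def field_simps)
  finally show ?thesis using l by (simp add: bubble_powr q_def)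
qed

lemma laplacian_integral_by_parts:
  fixes f :: "'a::euclidean_space \<Rightarrow> real"
  assumes t: "test_function UNIV \<phi>"
    and d: "\<And>x. f differentiable (at x)"
    and "\<And>b. b \<in> Basis \<Longrightarrow> continuous_on UNIV (dir_deriv b f)"
    and dd: "\<And>b x. b \<in> Basis \<Longrightarrow> dir_deriv b f differentiable (at x)"
    and "\<And>b. b \<in> Basis \<Longrightarrow> continuous_on UNIV (dir_deriv b (dir_deriv b f))"
  shows "(LINT x|lebesgue. f x * laplacian \<phi> x) = (LINT x|lebesgue. laplacian f x * \<phi> x)"
proof -
  have cf: "continuous_on UNIV f"
    using d differentiable_imp_continuous_within by (auto simp: continuous_on_eq_continuous_within)
  have "(LINT x|lebesgue. f x * laplacian \<phi> x)
      = (\<Sum>b\<in>Basis. LINT x|lebesgue. f x * dir_deriv b (dir_deriv b \<phi>) x)"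
    unfolding laplacian_def sum_distrib_left
    by (intro Bochner_Integration.integral_sum continuous_imp_locally_integrable cf
        integrable_mult_test_function[OF _ test_function_dir_deriv[OF test_function_dir_deriv[OF t]]])
  also have "\<dots> = (\<Sum>b\<in>Basis. LINT x|lebesgue. dir_deriv b (dir_deriv b f) x * \<phi> x)"
  proof (rule sum.cong[OF refl])
    fix b :: 'a assume b: "b \<in> Basis"
    have "(LINT x|lebesgue. f x * dir_deriv b (dir_deriv b \<phi>) x) = - (LINT x|lebesgue. dir_deriv b f x * dir_deriv b \<phi> x)"
      by (rule integral_by_parts_test_function) (use assms b test_function_dir_deriv in auto)
    also have "(LINT x|lebesgue. dir_deriv b f x * dir_deriv b \<phi> x) = - (LINT x|lebesgue. dir_deriv b (dir_deriv b f) x * \<phi> x)"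
      by (rule integral_by_parts_test_function) (use assms b in auto)
    finally show "(LINT x|lebesgue. f x * dir_deriv b (dir_deriv b \<phi>) x) = (LINT x|lebesgue. dir_deriv b (dir_deriv b f) x * \<phi> x)"
      by simp
  qed
  also have "\<dots> = (LINT x|lebesgue. laplacian f x * \<phi> x)"
    unfolding laplacian_def sum_distrib_right
    by (intro Bochner_Integration.integral_sum[symmetric] integrable_mult_test_function[OF _ t]
        continuous_imp_locally_integrable assms)
  finally show ?thesis .
qed

lemma bubble_pairing_laplacian:
  assumes l: "l > 0" and t: "test_function UNIV \<phi>"
  shows "(LINT x|lebesgue. bubble l z x * laplacian \<phi> x) = - (LINT x|lebesgue. bubble l z x powr (7/3) * \<phi> x)"
proof -
  have "(LINT x|lebesgue. bubble l z x * laplacian \<phi> x) = (LINT x|lebesgue. laplacian (bubble l z) x * \<phi> x)"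
    by (rule laplacian_integral_by_parts[OF t])
       (use l in \<open>simp_all add: dir_deriv_bubble(2) continuous_dir_deriv_bubble
          dir_deriv_dir_deriv_bubble(2) continuous_dir_deriv_dir_deriv_bubble\<close>)
  then show ?thesis by (simp add: laplacian_bubble[OF l])
qed

text \<open>
  The integrand decays like \<open>norm x powr (-7)\<close> in dimension 5. It is dominated by a product of five
  functions of one coordinate that decay like \<open>\<bar>s\<bar> powr (-7/5)\<close>.
\<close>

lemma nn_integral_bracket_unit:
  "(\<integral>\<^sup>+x. ennreal (bracket 1 (0::real^5) x powr (-7/2)) \<partial>lborel) < \<infinity>"
proof -
  \<comment> \<open>The constant comes from \<open>(1 + s)\<^sup>2 \<le> 2 + 2 * s\<^sup>2 \<le> 30 * q\<close>.\<close>
  define k where "k s = (30::real) powr (7/10) * (1 + \<bar>s\<bar>) powr (-7/5)" for s :: real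
  have half: "(\<integral>\<^sup>+s. ennreal ((1 + s) powr (-7/5)) * indicator {0..} s \<partial>lborel) = ennreal (0 - (- (5/2) * (1 + 0) powr (-2/5)))"
  proof (rule nn_integral_FTC_atLeast)
    fix s :: real assume "0 \<le> s"
    then show "((\<lambda>s. - (5/2) * (1 + s) powr (-2/5)) has_real_derivative (1 + s) powr (-7/5)) (at s)"
      by (auto intro!: derivative_eq_intros simp: powr_diff field_simps)
  next
    have "((\<lambda>s::real. (1 + s) powr (-2/5)) \<longlongrightarrow> 0) at_top"
      by (rule tendsto_neg_powr) (auto intro: filterlim_tendsto_add_at_top[OF tendsto_const filterlim_ident])
    from tendsto_mult_left[OF this, of "- (5/2)"]
    show "((\<lambda>s::real. - (5/2) * (1 + s) powr (-2/5)) \<longlongrightarrow> 0) at_top" by simp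
  qed auto
  have [measurable]: "k \<in> borel_measurable borel" unfolding k_def by measurable
  have split: "(\<integral>\<^sup>+s. ennreal (k s) \<partial>lborel) \<le>
      (\<integral>\<^sup>+s. ennreal (30 powr (7/10)) * (ennreal ((1 + s) powr (-7/5)) * indicator {0..} s)
        + ennreal (30 powr (7/10)) * (ennreal ((1 + - s) powr (-7/5)) * indicator {0..} (- s)) \<partial>lborel)"
    by (intro nn_integral_mono) (auto simp: k_def ennreal_mult'' indicator_def)
  also have "\<dots> = ennreal (30 powr (7/10)) * (\<integral>\<^sup>+s. ennreal ((1 + s) powr (-7/5)) * indicator {0..} s \<partial>lborel)
      + ennreal (30 powr (7/10)) * (\<integral>\<^sup>+s. ennreal ((1 + - s) powr (-7/5)) * indicator {0..} (- s) \<partial>lborel)"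
    by (simp add: nn_integral_add nn_integral_cmult)
  also have "(\<integral>\<^sup>+s. ennreal ((1 + - s) powr (-7/5)) * indicator {0..} (- s) \<partial>lborel)
      = (\<integral>\<^sup>+s. ennreal ((1 + s) powr (-7/5)) * indicator {0..} s \<partial>lborel)"
    using nn_integral_real_affine[of "\<lambda>s. ennreal ((1 + s) powr (-7/5)) * indicator {0..} s" "-1" 0] by simp
  also have "ennreal (30 powr (7/10)) * (\<integral>\<^sup>+s. ennreal ((1 + s) powr (-7/5)) * indicator {0..} s \<partial>lborel)
      + ennreal (30 powr (7/10)) * (\<integral>\<^sup>+s. ennreal ((1 + s) powr (-7/5)) * indicator {0..} s \<partial>lborel) < \<infinity>"
    unfolding half by (simp add: ennreal_mult_less_top)
  finally have k_fin: "(\<integral>\<^sup>+s. ennreal (k s) \<partial>lborel) < \<infinity>" .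
  have "(\<integral>\<^sup>+x. ennreal (bracket 1 (0::real^5) x powr (-7/2)) \<partial>lborel)
      \<le> (\<integral>\<^sup>+x. (\<Prod>b\<in>(Basis::(real^5) set). ennreal (k (x \<bullet> b))) \<partial>lborel)"
  proof (rule nn_integral_mono)
    fix x :: "real^5"
    define q where "q = bracket 1 0 x"
    have q: "q \<ge> 1" by (simp add: q_def bracket_ge_1)
    have fac: "q powr (-7/10) \<le> k (x \<bullet> b)" if b: "b \<in> Basis" for b
    proof -
      define s where "s = \<bar>x \<bullet> b\<bar>"
      have "s \<le> norm x" unfolding s_def by (rule Basis_le_norm[OF b])
      then have "s\<^sup>2 \<le> (norm x)\<^sup>2" by (intro power_mono) (auto simp: s_def)
      moreover have "(1 + s)\<^sup>2 \<le> 2 + 2 * s\<^sup>2"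
        using zero_le_power2[of "1 - s"] by (simp add: power2_eq_square algebra_simps)
      ultimately have "(1 + s)\<^sup>2 \<le> 30 * q" by (simp add: q_def bracket_def)
      then have "((1 + s)\<^sup>2 / 30) powr (7/10) \<le> q powr (7/10)" by (intro powr_mono2) auto
      then have "q powr (-7/10) \<le> ((1 + s)\<^sup>2 / 30) powr (-7/10)"
        using q by (simp add: powr_minus s_def le_imp_inverse_le)
      also have "((1 + s)\<^sup>2 / 30) powr (-7/10) = 30 powr (7/10) * (1 + s) powr (-7/5)"
      proof -
        have sq: "((1 + s)\<^sup>2) powr (-7/10) = (1 + s) powr (-7/5)"
          by (simp add: s_def powr_powr flip: powr_numeral)
        have inv: "30 powr (-7/10) = inverse (30 powr (7/10) :: real)"
          using powr_minus[of 30 "7/10 :: real"] by simp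
        have "((1 + s)\<^sup>2 / 30) powr (-7/10) = ((1 + s)\<^sup>2) powr (-7/10) / 30 powr (-7/10)"
          by (rule powr_divide)
        then show ?thesis unfolding sq inv by (simp only: divide_inverse inverse_inverse_eq mult.commute)
      qed
      finally show ?thesis by (simp add: k_def s_def)
    qed
    have "q powr (-7/2) = (\<Prod>b\<in>(Basis::(real^5) set). q powr (-7/10))"
      using q by (simp add: powr_power)
    also have "\<dots> \<le> (\<Prod>b\<in>(Basis::(real^5) set). k (x \<bullet> b))"
      using fac by (intro prod_mono) auto
    finally have "ennreal (q powr (-7/2)) \<le> ennreal (\<Prod>b\<in>(Basis::(real^5) set). k (x \<bullet> b))"
      by (rule ennreal_leI)
    then show "ennreal (bracket 1 0 x powr (-7/2)) \<le> (\<Prod>b\<in>Basis. ennreal (k (x \<bullet> b)))"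
      by (subst prod_ennreal) (auto simp: q_def k_def)
  qed
  also have "\<dots> = (\<Prod>b\<in>(Basis::(real^5) set). \<integral>\<^sup>+s. ennreal (k s) \<partial>lborel)"
    by (rule nn_integral_lborel_prod) auto
  also have "\<dots> < \<infinity>"
    using k_fin by (simp add: power_less_top_ennreal)
  finally show ?thesis .
qed

lemma nn_integral_lborel_affine:
  fixes f :: "'a::euclidean_space \<Rightarrow> ennreal"
  assumes [measurable]: "f \<in> borel_measurable borel" and "l > 0"
  shows "(\<integral>\<^sup>+x. f ((x - z) /\<^sub>R l) \<partial>lborel) = ennreal (l ^ DIM('a)) * (\<integral>\<^sup>+x. f x \<partial>lborel)"
proof -
  have "(\<integral>\<^sup>+x. f ((x - z) /\<^sub>R l) \<partial>lborel)
      = (\<integral>\<^sup>+x. f ((x - z) /\<^sub>R l) \<partial>density (distr lborel borel (\<lambda>x. z + l *\<^sub>R x)) (\<lambda>_. ennreal (\<bar>l\<bar> ^ DIM('a))))"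
    using lborel_affine[of l z] \<open>l > 0\<close> by simp
  also have "\<dots> = (\<integral>\<^sup>+x. ennreal (\<bar>l\<bar> ^ DIM('a)) * f ((z + l *\<^sub>R x - z) /\<^sub>R l) \<partial>lborel)"
    by (simp add: nn_integral_density nn_integral_distr)
  also have "\<dots> = ennreal (l ^ DIM('a)) * (\<integral>\<^sup>+x. f x \<partial>lborel)"
    using \<open>l > 0\<close> by (simp add: nn_integral_cmult)
  finally show ?thesis .
qed

definition bubble_mass :: real where
  "bubble_mass = enn2real (\<integral>\<^sup>+x. ennreal (bracket 1 (0::real^5) x powr (-7/2)) \<partial>lborel)"

lemma bracket_measurable [measurable]: "bracket l z \<in> borel_measurable borel"
  unfolding bracket_def[abs_def] by measurable

lemma nn_integral_bracket:
  fixes z :: "real^5"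
  assumes "l > 0"
  shows "(\<integral>\<^sup>+x. ennreal (bracket l z x powr (-7/2)) \<partial>lborel) = ennreal (l ^ 5 * bubble_mass)"
proof -
  have "(\<integral>\<^sup>+x. ennreal (bracket l z x powr (-7/2)) \<partial>lborel)
      = (\<integral>\<^sup>+x. ennreal (bracket 1 0 ((x - z) /\<^sub>R l) powr (-7/2)) \<partial>lborel)"
    by (simp only: bracket_eq_unit[OF assms])
  also have "\<dots> = ennreal (l ^ 5) * (\<integral>\<^sup>+x. ennreal (bracket 1 (0::real^5) x powr (-7/2)) \<partial>lborel)"
    using nn_integral_lborel_affine[of "\<lambda>x::real^5. ennreal (bracket 1 0 x powr (-7/2))" l z] assms by simp
  also have "(\<integral>\<^sup>+x. ennreal (bracket 1 (0::real^5) x powr (-7/2)) \<partial>lborel) = ennreal bubble_mass"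
    using nn_integral_bracket_unit by (simp add: bubble_mass_def less_top)
  finally show ?thesis
    using assms by (simp add: ennreal_mult'' bubble_mass_def)
qed

lemma integrable_bracket_powr:
  fixes z :: "real^5"
  assumes "l > 0" "r \<le> -7/2"
  shows "integrable lborel (\<lambda>x. bracket l z x powr r)"
proof -
  have i: "integrable lborel (\<lambda>x. bracket l z x powr (-7/2))"
    by (rule integrableI_bounded) (use nn_integral_bracket[OF assms(1), of z] in auto)
  show ?thesis
    by (rule Bochner_Integration.integrable_bound[OF i])
       (use assms bracket_ge_1 in \<open>auto intro!: AE_I2 powr_mono\<close>)
qed

text \<open>
  The squared gradient is a combination of the powers -4 and -5 of the bracket, and the critical
  power of the bubble is its power -5; powers up to \<open>-7/2\<close> are integrable.
\<close>

lemma in_Hdot1_bubble: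
  assumes l: "l > 0"
  shows "in_Hdot1 (bubble l z)"
proof -
  have cb: "continuous_on UNIV (bubble l z)"
    unfolding bubble_eq_bracket[OF l, abs_def] by (intro continuous_intros continuous_on_bracket_powr)
  define G where "G x = (- (1/5) * l powr (-7/2) * bracket l z x powr (-5/2)) *\<^sub>R (x - z)" for x
  have cG: "continuous_on UNIV G"
    unfolding G_def by (intro continuous_intros continuous_on_bracket_powr)
  have Gb: "G x \<bullet> b = dir_deriv b (bubble l z) x" for x b
    by (simp add: G_def dir_deriv_bubble(1)[OF l])
  have "weak_gradient (bubble l z) G"
    unfolding weak_gradient_def Gb
    using integral_by_parts_test_function[of "bubble l z"] l
    by (auto simp: continuous_imp_locally_integrable cb cG dir_deriv_bubble(2) continuous_dir_deriv_bubble)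
  moreover have "in_Lp 2 G"
    unfolding in_Lp_2_iff
  proof
    show "G \<in> borel_measurable lebesgue" by (rule continuous_borel_measurable_lebesgue[OF cG])
    have "(norm (G x))\<^sup>2 = 15 * l\<^sup>2 / 25 * l powr (-7) * (bracket l z x powr (-5) * (bracket l z x - 1))" for x
    proof -
      have "(norm (G x))\<^sup>2 = (1/25) * (l powr (-7/2))\<^sup>2 * (bracket l z x powr (-5/2))\<^sup>2 * (norm (x - z))\<^sup>2"
        by (simp add: G_def power_mult_distrib power_divide)
      also have "(l powr (-7/2))\<^sup>2 = l powr (-7)" using l by (simp add: powr_power)
      also have "(bracket l z x powr (-5/2))\<^sup>2 = bracket l z x powr (-5)"
        using bracket_pos[of l z x] by (simp add: powr_power)
      also have "(norm (x - z))\<^sup>2 = 15 * l\<^sup>2 * (bracket l z x - 1)"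
        using l by (simp add: bracket_def)
      finally show ?thesis by simp
    qed
    moreover have "bracket l z x powr (-5) * (bracket l z x - 1) = bracket l z x powr (-4) - bracket l z x powr (-5)" for x
      using bracket_pos[of l z x] powr_mult_base[of "bracket l z x" "-5"] by (simp add: algebra_simps)
    ultimately have "(\<lambda>x. (norm (G x))\<^sup>2)
        = (\<lambda>x. 15 * l\<^sup>2 / 25 * l powr (-7) * (bracket l z x powr (-4) - bracket l z x powr (-5)))"
      by (simp only:)
    moreover have "integrable lborel (\<lambda>x. 15 * l\<^sup>2 / 25 * l powr (-7) * (bracket l z x powr (-4) - bracket l z x powr (-5)))"
      by (intro integrable_mult_right Bochner_Integration.integrable_diff integrable_bracket_powr l) auto
    ultimately show "integrable lebesgue (\<lambda>x. (norm (G x))\<^sup>2)"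
      by (simp only:) (subst integrable_completion, measurable)
  qed
  moreover have "in_Lp (10/3) (bubble l z)"
    unfolding in_Lp_def
  proof
    show "bubble l z \<in> borel_measurable lebesgue" by (rule continuous_borel_measurable_lebesgue[OF cb])
    have "norm (bubble l z x) powr (10/3) = l powr (-5) * bracket l z x powr (-5)" for x
      using l bracket_pos[of l z x] by (simp add: bubble_eq_bracket powr_mult powr_powr)
    moreover have "integrable lborel (\<lambda>x. l powr (-5) * bracket l z x powr (-5))"
      by (intro integrable_mult_right integrable_bracket_powr l) auto
    ultimately show "integrable lebesgue (\<lambda>x. norm (bubble l z x) powr (10/3))"
      by (simp only:) (subst integrable_completion, measurable)
  qed
  ultimately show ?thesis by (auto simp: in_Hdot1_def)
qed

section \<open>Increments of functions with a bounded weak derivative\<close>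

text \<open>
  The integrand is the derivative of \<open>flat_exp 0\<close>, which increases from 0 to 1.
\<close>

lemma nn_integral_flat_exp_2: "(\<integral>\<^sup>+r. ennreal (flat_exp 2 r) \<partial>lborel) = 1"
proof -
  have d: "(flat_exp 0 has_real_derivative flat_exp 2 r) (at r)" for r
    using flat_exp_has_derivative[of 0 r] by (simp add: numeral_2_eq_2)
  have "((\<lambda>t::real. exp (- inverse t)) \<longlongrightarrow> exp (- 0)) at_top"
    by (intro tendsto_intros tendsto_inverse_0_at_top filterlim_ident)
  then have lim: "(flat_exp 0 \<longlongrightarrow> 1) at_top"
    unfolding minus_zero exp_zero
    by (rule Lim_transform_eventually)
       (auto simp: flat_exp_def intro!: eventually_mono[OF eventually_gt_at_top[of 0]])
  have "(\<integral>\<^sup>+r. ennreal (flat_exp 2 r) * indicator {0..} r \<partial>lborel) = ennreal (1 - flat_exp 0 0)"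
    by (rule nn_integral_FTC_atLeast[where F = "flat_exp 0", OF _ d _ lim])
       (use smooth_flat_exp[of 2] in \<open>auto simp: flat_exp_nonneg\<close>)
  moreover have "(\<integral>\<^sup>+r. ennreal (flat_exp 2 r) * indicator {0..} r \<partial>lborel) = (\<integral>\<^sup>+r. ennreal (flat_exp 2 r) \<partial>lborel)"
    by (intro nn_integral_cong) (auto simp: flat_exp_def indicator_def)
  ultimately show ?thesis by (simp add: flat_exp_def)
qed

lemma flat_exp_2_integral: "integrable lborel (flat_exp 2)" "(LINT r|lborel. flat_exp 2 r) = 1"
proof -
  have m: "flat_exp 2 \<in> borel_measurable borel" using smooth_flat_exp by (rule smooth_borel_measurable)
  show "integrable lborel (flat_exp 2)"
    by (rule integrableI_bounded) (use m nn_integral_flat_exp_2 flat_exp_nonneg in auto)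
  show "(LINT r|lborel. flat_exp 2 r) = 1"
    using m by (subst integral_eq_nn_integral) (auto simp: nn_integral_flat_exp_2 flat_exp_nonneg)
qed

text \<open>
  The substitution \<open>t = a + r / k n\<close> turns the integrals into means of \<open>g\<close> near \<open>a\<close> with respect to the
  probability density \<open>flat_exp 2\<close>.
\<close>

lemma peak_at_left_end:
  fixes g :: "real \<Rightarrow> real" and k :: "nat \<Rightarrow> real"
  assumes ab: "a < b" and cont: "continuous_on {a..b} g"
    and kpos: "\<And>n. 0 < k n" and ktop: "filterlim k at_top sequentially"
  shows "(\<lambda>n. LINT t|lborel. g t * (k n * flat_exp 2 (k n * (t - a)) * flat_exp 0 (k n * (b - t))))
    \<longlonglongrightarrow> g a"
proof -
  define G where "G t = (if t \<in> {a..b} then g t else 0)" for t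
  have [measurable]: "G \<in> borel_measurable borel"
    unfolding G_def by (rule borel_measurable_continuous_on_if[OF _ cont]) auto
  have [measurable]: "flat_exp i \<in> borel_measurable borel" for i
    using smooth_flat_exp by (rule smooth_borel_measurable)
  have "compact (g ` {a..b})" by (rule compact_continuous_image[OF cont]) simp
  then obtain B where "\<forall>t\<in>{a..b}. \<bar>g t\<bar> \<le> B"
    by (auto dest!: compact_imp_bounded simp: bounded_iff)
  then have B: "\<bar>g t\<bar> \<le> B" if "t \<in> {a..b}" for t using that by blast
  have B0: "0 \<le> B" using B[of a] ab by auto
  have GB: "\<bar>G t\<bar> \<le> B" for t using B B0 by (auto simp: G_def)
  define s where "s n r = G (a + r / k n) * (flat_exp 2 r * flat_exp 0 (k n * (b - a) - r))" for n r
  have eq: "(LINT t|lborel. g t * (k n * flat_exp 2 (k n * (t - a)) * flat_exp 0 (k n * (b - t))))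
      = (LINT r|lborel. s n r)" for n
  proof -
    have "(LINT t|lborel. g t * (k n * flat_exp 2 (k n * (t - a)) * flat_exp 0 (k n * (b - t))))
        = (LINT t|lborel. G t * (k n * flat_exp 2 (k n * (t - a)) * flat_exp 0 (k n * (b - t))))"
    proof (intro Bochner_Integration.integral_cong refl)
      fix t
      have "flat_exp 2 (k n * (t - a)) = 0" if "t < a"
        using that kpos[of n] by (simp add: flat_exp_eq_0_iff mult_le_0_iff)
      moreover have "flat_exp 0 (k n * (b - t)) = 0" if "b < t"
        using that kpos[of n] by (simp add: flat_exp_eq_0_iff mult_le_0_iff)
      ultimately show "g t * (k n * flat_exp 2 (k n * (t - a)) * flat_exp 0 (k n * (b - t)))
          = G t * (k n * flat_exp 2 (k n * (t - a)) * flat_exp 0 (k n * (b - t)))"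
        by (cases "t < a"; cases "b < t") (auto simp: G_def)
    qed
    also have "\<dots> = \<bar>1 / k n\<bar> *\<^sub>R (LINT r|lborel.
        G (a + (1 / k n) * r) * (k n * flat_exp 2 (k n * ((a + (1 / k n) * r) - a))
          * flat_exp 0 (k n * (b - (a + (1 / k n) * r)))))"
      by (rule lborel_integral_real_affine) (use kpos[of n] in simp)
    also have "\<dots> = (LINT r|lborel. (1 / k n) * (k n * s n r))"
    proof -
      have P: "G (a + (1 / k n) * r) * (k n * flat_exp 2 (k n * ((a + (1 / k n) * r) - a))
          * flat_exp 0 (k n * (b - (a + (1 / k n) * r)))) = k n * s n r" for r
      proof -
        have "k n * ((a + (1 / k n) * r) - a) = r"
          using kpos[of n] by simp
        moreover have "k n * (b - (a + (1 / k n) * r)) = k n * (b - a) - r"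
          using kpos[of n] by (simp add: field_simps)
        ultimately show ?thesis by (simp add: s_def)
      qed
      show ?thesis unfolding P using kpos[of n] by simp
    qed
    also have "\<dots> = (LINT r|lborel. s n r)" using kpos[of n] by simp
    finally show ?thesis .
  qed
  have "(\<lambda>n. LINT r|lborel. s n r) \<longlonglongrightarrow> (LINT r|lborel. g a * flat_exp 2 r)"
  proof (rule integral_dominated_convergence[where w = "\<lambda>r. B * flat_exp 2 r"])
    show "integrable lborel (\<lambda>r. B * flat_exp 2 r)"
      by (intro integrable_mult_right flat_exp_2_integral)
    show "AE r in lborel. (\<lambda>n. s n r) \<longlonglongrightarrow> g a * flat_exp 2 r"
    proof (rule AE_I2)
      fix r :: real
      show "(\<lambda>n. s n r) \<longlonglongrightarrow> g a * flat_exp 2 r"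
      proof (cases "r \<le> 0")
        case True
        then have "flat_exp 2 r = 0" by (simp add: flat_exp_eq_0_iff)
        then show ?thesis by (simp add: s_def)
      next
        case False
        have t0: "(\<lambda>n. a + r / k n) \<longlonglongrightarrow> a + 0"
          by (intro tendsto_add tendsto_const tendsto_divide_0[OF tendsto_const]
              filterlim_at_top_imp_at_infinity ktop)
        have "filterlim (\<lambda>n. (b - a) * k n) at_top sequentially"
          using ab by (intro filterlim_tendsto_pos_mult_at_top[OF tendsto_const _ ktop]) auto
        then have top: "filterlim (\<lambda>n. - r + (b - a) * k n) at_top sequentially"
          by (rule filterlim_tendsto_add_at_top[OF tendsto_const])
        have ev: "\<forall>\<^sub>F n in sequentially. 0 < - r + (b - a) * k n"
          using top by (rule filterlim_at_top_dense[THEN iffD1, rule_format])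
        then have inside: "\<forall>\<^sub>F n in sequentially. a + r / k n \<in> {a..b}"
        proof eventually_elim
          case (elim n)
          then have "r / k n \<le> b - a" using kpos[of n] by (simp add: field_simps)
          then show ?case using False kpos[of n] by simp
        qed
        have "(\<lambda>n. g (a + r / k n)) \<longlonglongrightarrow> g a"
          using cont[unfolded continuous_on_sequentially, rule_format, of a "\<lambda>n. a + r / k n"] t0 inside ab
          by (auto intro!: continuous_on_tendsto_compose[OF cont])
        then have G: "(\<lambda>n. G (a + r / k n)) \<longlonglongrightarrow> g a"
          by (rule Lim_transform_eventually)
             (use inside in eventually_elim, simp add: G_def)
        have "(\<lambda>n. exp (- inverse (- r + (b - a) * k n))) \<longlonglongrightarrow> exp (- 0)"
          by (intro tendsto_intros tendsto_inverse_0_at_top top)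
        then have "(\<lambda>n. flat_exp 0 (k n * (b - a) - r)) \<longlonglongrightarrow> exp (- 0)"
          by (rule Lim_transform_eventually)
             (use ev in eventually_elim, simp add: flat_exp_def mult.commute)
        then have "(\<lambda>n. s n r) \<longlonglongrightarrow> g a * (flat_exp 2 r * exp (- 0))"
          unfolding s_def by (intro tendsto_mult G tendsto_const)
        then show ?thesis by simp
      qed
    qed
    show "AE r in lborel. norm (s n r) \<le> B * flat_exp 2 r" for n
    proof (rule AE_I2)
      fix r
      have "norm (s n r) = \<bar>G (a + r / k n)\<bar> * (flat_exp 2 r * flat_exp 0 (k n * (b - a) - r))"
        by (simp add: s_def abs_mult flat_exp_nonneg)
      also have "\<dots> \<le> B * (flat_exp 2 r * 1)"
        using B0 by (intro mult_mono GB mult_left_mono flat_exp_0_le_1 flat_exp_nonneg mult_nonneg_nonneg) auto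
      finally show "norm (s n r) \<le> B * flat_exp 2 r" by simp
    qed
  qed (unfold s_def, measurable)
  then show ?thesis unfolding eq by (simp add: flat_exp_2_integral)
qed

text \<open>
  The test functions approximate the indicator of \<open>{a..b}\<close>. Their derivatives consist of a positive
  peak at \<open>a\<close> and a negative one at \<open>b\<close>, so the left-hand sides tend to \<open>g a - g b\<close>.
\<close>

lemma increment_bound_weak_derivative:
  fixes g h :: "real \<Rightarrow> real"
  assumes ab: "a < b" and cont: "continuous_on {a..b} g" and h: "\<And>t. t \<in> {a..b} \<Longrightarrow> \<bar>h t\<bar> \<le> \<epsilon>"
    and weak: "\<And>\<theta>. smooth \<theta> \<Longrightarrow> (\<And>t. t \<notin> {a..b} \<Longrightarrow> \<theta> t = 0) \<Longrightarrow>
      (LINT t|lebesgue. g t * dir_deriv 1 \<theta> t) = - (LINT t|lebesgue. h t * \<theta> t)"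
  shows "\<bar>g b - g a\<bar> \<le> \<epsilon> * (b - a)"
proof -
  define k where "k n = real (Suc n)" for n
  have kpos: "0 < k n" for n by (simp add: k_def)
  have ktop: "filterlim k at_top sequentially"
    unfolding k_def by (rule filterlim_compose[OF filterlim_real_sequentially filterlim_Suc])
  define \<theta> where "\<theta> n t = flat_exp 0 (- (k n * a) + k n * t) * flat_exp 0 (k n * b + - k n * t)" for n t
  have lin: "linear (\<lambda>t. c * t)" for c :: real by (auto intro!: linearI simp: algebra_simps)
  have sm: "smooth (\<theta> n)" for n
    unfolding \<theta>_def by (intro smooth_mult smooth_affine lin smooth_flat_exp)
  have \<theta>_eq: "\<theta> n t = flat_exp 0 (k n * (t - a)) * flat_exp 0 (k n * (b - t))" for n t
    by (simp add: \<theta>_def algebra_simps)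
  have \<theta>0: "\<theta> n t = 0" if "t \<notin> {a..b}" for n t
    using that kpos[of n] by (cases "t < a") (simp_all add: \<theta>_eq flat_exp_eq_0_iff mult_le_0_iff)
  have \<theta>1: "0 \<le> \<theta> n t \<and> \<theta> n t \<le> 1" for n t
    by (auto simp: \<theta>_eq flat_exp_nonneg flat_exp_0_le_1 mult_le_one)
  \<comment> \<open>The two peaks of the derivative, \<open>p\<close> at the left end and \<open>q\<close> at the right end.\<close>
  define p where "p n t = k n * flat_exp 2 (k n * (t - a)) * flat_exp 0 (k n * (b - t))" for n t
  define q where "q n t = k n * flat_exp 0 (k n * (t - a)) * flat_exp 2 (k n * (b - t))" for n t
  have d0: "(flat_exp 0 has_real_derivative flat_exp 2 r) (at r)" for r
    using flat_exp_has_derivative[of 0 r] by (simp add: numeral_2_eq_2)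
  have d\<theta>: "dir_deriv 1 (\<theta> n) t = p n t - q n t" for n t
  proof -
    have "((\<lambda>t. flat_exp 0 (k n * (t - a)) * flat_exp 0 (k n * (b - t))) has_real_derivative p n t - q n t) (at t)"
      unfolding p_def q_def
      by (auto intro!: derivative_eq_intros DERIV_chain2[OF d0] simp: algebra_simps)
    then have "(\<theta> n has_derivative (\<lambda>x. (p n t - q n t) * x)) (at t)"
      unfolding has_field_derivative_def \<theta>_eq[abs_def] .
    from dir_deriv_eq[OF this] show ?thesis by simp
  qed
  define B where "B = \<epsilon> * (b - a)"
  have hB: "\<bar>LINT t|lebesgue. h t * \<theta> n t\<bar> \<le> B" for n
  proof -
    have e0: "0 \<le> \<epsilon>" using h[of a] ab by auto
    have i: "integrable lebesgue (\<lambda>t. \<epsilon> * indicator {a..b} t)"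
      by (intro integrable_mult_right integrable_real_indicator) (auto simp: emeasure_lborel_Icc_eq)
    have "\<bar>LINT t|lebesgue. h t * \<theta> n t\<bar> \<le> (LINT t|lebesgue. norm (h t * \<theta> n t))"
      using integral_norm_bound[of lebesgue "\<lambda>t. h t * \<theta> n t"] by simp
    also have "\<dots> \<le> (LINT t|lebesgue. \<epsilon> * indicator {a..b} t)"
    proof (rule integral_mono'[OF i])
      fix t
      show "norm (h t * \<theta> n t) \<le> \<epsilon> * indicator {a..b} t"
      proof (cases "t \<in> {a..b}")
        case True
        have "\<bar>h t\<bar> * \<bar>\<theta> n t\<bar> \<le> \<epsilon> * 1" using \<theta>1[of n t] h[OF True] e0 by (intro mult_mono) auto
        then show ?thesis using True by (simp add: abs_mult)
      qed (use \<theta>0 in auto)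
    qed (use e0 in auto)
    also have "\<dots> = B" using ab by (simp add: B_def)
    finally show ?thesis .
  qed
  define Gp where "Gp n = (LINT t|lborel. g t * p n t)" for n
  define Gq where "Gq n = (LINT t|lborel. g t * q n t)" for n
  have [measurable]: "flat_exp i \<in> borel_measurable borel" for i
    using smooth_flat_exp by (rule smooth_borel_measurable)
  have pq_meas [measurable]: "p n \<in> borel_measurable borel" "q n \<in> borel_measurable borel" for n
    unfolding p_def q_def by measurable
  have pq0: "p n t = 0" "q n t = 0" if "t \<notin> {a..b}" for n t
    using that kpos[of n] by (cases "t < a"; simp add: p_def q_def flat_exp_eq_0_iff mult_le_0_iff)+
  have ip: "integrable lborel (\<lambda>t. g t * r t)" if r: "continuous_on {a..b} r" "\<And>t. t \<notin> {a..b} \<Longrightarrow> r t = 0" for r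
  proof -
    have "integrable lborel (\<lambda>t. indicator {a..b} t *\<^sub>R (g t * r t))"
      by (intro borel_integrable_compact continuous_intros cont r(1)) auto
    also have "(\<lambda>t. indicator {a..b} t *\<^sub>R (g t * r t)) = (\<lambda>t. g t * r t)"
      using r(2) by (force simp: fun_eq_iff indicator_def)
    finally show ?thesis .
  qed
  have cf: "continuous_on S (\<lambda>t. flat_exp i (c * (t - d)))" "continuous_on S (\<lambda>t. flat_exp i (c * (d - t)))" for S i c d
    by (rule continuous_on_compose2[OF smooth_imp_continuous_on[OF smooth_flat_exp, of UNIV i]];
        (intro continuous_intros | simp))+
  have ipq: "integrable lborel (\<lambda>t. g t * p n t)" "integrable lborel (\<lambda>t. g t * q n t)" for n
    by (rule ip; (use pq0 in \<open>auto simp: p_def q_def intro!: continuous_intros cf\<close>))+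
  have eq: "Gp n - Gq n = - (LINT t|lebesgue. h t * \<theta> n t)" for n
  proof -
    have "Gp n - Gq n = (LINT t|lborel. g t * p n t - g t * q n t)"
      unfolding Gp_def Gq_def by (rule Bochner_Integration.integral_diff[OF ipq, symmetric])
    also have "\<dots> = (LINT t|lebesgue. g t * p n t - g t * q n t)"
      using Bochner_Integration.integrable_diff[OF ipq(1)[of n] ipq(2)[of n]]
      by (intro integral_completion[symmetric]) (rule borel_measurable_integrable)
    also have "\<dots> = (LINT t|lebesgue. g t * dir_deriv 1 (\<theta> n) t)"
      by (simp add: d\<theta> right_diff_distrib)
    also have "\<dots> = - (LINT t|lebesgue. h t * \<theta> n t)"
      by (rule weak[OF sm \<theta>0])
    finally show ?thesis .
  qed
  have "Gp \<longlonglongrightarrow> g a"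
    unfolding Gp_def p_def by (rule peak_at_left_end[OF ab cont kpos ktop])
  moreover have "Gq \<longlonglongrightarrow> g b"
  proof -
    have "continuous_on {a..b} (\<lambda>t. g (a + b - t))"
      by (rule continuous_on_compose2[OF cont]) (auto intro!: continuous_intros)
    from peak_at_left_end[OF ab this kpos ktop]
    have "(\<lambda>n. LINT t|lborel. g (a + b - t) * (k n * flat_exp 2 (k n * (t - a)) * flat_exp 0 (k n * (b - t)))) \<longlonglongrightarrow> g b"
      by simp
    moreover have "(LINT t|lborel. g (a + b - t) * (k n * flat_exp 2 (k n * (t - a)) * flat_exp 0 (k n * (b - t)))) = Gq n" for n
    proof -
      have "Gq n = \<bar>-1\<bar> *\<^sub>R (LINT t|lborel. g ((a + b) + -1 * t) * q n ((a + b) + -1 * t))"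
        unfolding Gq_def by (rule lborel_integral_real_affine) simp
      also have "\<dots> = (LINT t|lborel. g (a + b - t) * (k n * flat_exp 2 (k n * (t - a)) * flat_exp 0 (k n * (b - t))))"
      proof -
        have "q n ((a + b) + -1 * t) = k n * flat_exp 2 (k n * (t - a)) * flat_exp 0 (k n * (b - t))" for t
        proof -
          have "(a + b) + -1 * t - a = b - t" "b - ((a + b) + -1 * t) = t - a" by auto
          then show ?thesis unfolding q_def by (simp only: mult.assoc mult.commute mult.left_commute)
        qed
        then show ?thesis by (simp)
      qed
      finally show ?thesis by simp
    qed
    ultimately show ?thesis by simp
  qed
  ultimately have "(\<lambda>n. \<bar>Gp n - Gq n\<bar>) \<longlonglongrightarrow> \<bar>g a - g b\<bar>"
    by (intro tendsto_intros)
  moreover have "\<bar>Gp n - Gq n\<bar> \<le> B" for n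
    unfolding eq using hB[of n] by simp
  ultimately have "\<bar>g a - g b\<bar> \<le> B"
    by (intro LIMSEQ_le_const2) auto
  then show ?thesis by (simp add: B_def abs_minus_commute)
qed

section \<open>Cut-off functions and the power nonlinearity\<close>

definition cutoff :: "real \<Rightarrow> real^5 \<Rightarrow> real" where
  "cutoff r x = box_bump 1 (- One) One (x /\<^sub>R r)"

lemma linear_inverse_scale: "linear (\<lambda>x::'a::real_vector. x /\<^sub>R r)"
  by (auto intro!: linearI simp: scaleR_add_right)

lemma smooth_cutoff: "smooth (cutoff r)"
  unfolding cutoff_def[abs_def]
  using smooth_linear[OF linear_inverse_scale, of "box_bump 1 (- One) One"] test_function_box_bump
  unfolding test_function_def by blast

lemma cutoff_bounds: "0 \<le> cutoff r x" "cutoff r x \<le> 1"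
  by (simp_all add: cutoff_def box_bump_bounds)

lemma cutoff_outside:
  assumes r: "r > 0" and x: "x \<notin> cbox (- (r *\<^sub>R One)) (r *\<^sub>R One)"
  shows "cutoff r x = 0"
proof -
  have "x /\<^sub>R r \<notin> cbox (- One) One"
    using x r by (auto simp: mem_box field_simps)
  then show ?thesis unfolding cutoff_def by (rule box_bump_outside)
qed

lemma test_function_cutoff: "r > 0 \<Longrightarrow> test_function UNIV (cutoff r)"
  by (rule test_functionI[OF smooth_cutoff, where C = "cbox (- (r *\<^sub>R One)) (r *\<^sub>R One)"])
     (auto intro: cutoff_outside)

lemma cutoff_norm:
  assumes "r > 0" "cutoff r x \<noteq> 0"
  shows "norm x \<le> 5 * r"
proof -
  have "x \<in> cbox (- (r *\<^sub>R One)) (r *\<^sub>R One)" using cutoff_outside assms by blast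
  then have "\<bar>x \<bullet> b\<bar> \<le> r" if "b \<in> Basis" for b using that by (auto simp: mem_box abs_le_iff minus_le_iff)
  then have "(\<Sum>b\<in>Basis. \<bar>x \<bullet> b\<bar>) \<le> (\<Sum>b\<in>(Basis::(real^5) set). r)" by (rule sum_mono)
  with norm_le_l1[of x] show ?thesis by simp
qed

lemma integral_dilate:
  fixes F :: "real^5 \<Rightarrow> real"
  assumes [measurable]: "F \<in> borel_measurable borel" and nn: "\<And>x. 0 \<le> F x" and r: "r > 0"
  shows "(LINT x|lebesgue. F (x /\<^sub>R r)) = r ^ 5 * (LINT x|lebesgue. F x)"
proof -
  have "(LINT x|lebesgue. F (x /\<^sub>R r)) = (LINT x|lborel. F (x /\<^sub>R r))"
    by (rule integral_completion) measurable
  also have "\<dots> = enn2real (\<integral>\<^sup>+x. ennreal (F (x /\<^sub>R r)) \<partial>lborel)"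
    using nn by (intro integral_eq_nn_integral) auto
  also have "(\<integral>\<^sup>+x. ennreal (F (x /\<^sub>R r)) \<partial>lborel) = ennreal (r ^ 5) * (\<integral>\<^sup>+x. ennreal (F x) \<partial>lborel)"
    using nn_integral_lborel_affine[of "\<lambda>x. ennreal (F x)" r 0] r by simp
  also have "enn2real (ennreal (r ^ 5) * (\<integral>\<^sup>+x. ennreal (F x) \<partial>lborel)) = r ^ 5 * enn2real (\<integral>\<^sup>+x. ennreal (F x) \<partial>lborel)"
    using r by (simp add: enn2real_mult)
  also have "enn2real (\<integral>\<^sup>+x. ennreal (F x) \<partial>lborel) = (LINT x|lborel. F x)"
    using nn by (intro integral_eq_nn_integral[symmetric]) auto
  also have "\<dots> = (LINT x|lebesgue. F x)"
    by (rule integral_completion[symmetric]) measurable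
  finally show ?thesis .
qed

lemma Lp_norm_dilate:
  fixes F :: "real^5 \<Rightarrow> real"
  assumes [measurable]: "F \<in> borel_measurable borel" and r: "r > 0"
  shows "Lp_norm 2 (\<lambda>x. c * F (x /\<^sub>R r)) = \<bar>c\<bar> * r powr (5/2) * Lp_norm 2 F"
proof -
  have "(LINT x|lebesgue. (norm (c * F (x /\<^sub>R r)))\<^sup>2) = c\<^sup>2 * (LINT x|lebesgue. (F (x /\<^sub>R r))\<^sup>2)"
    by (simp add: power_mult_distrib)
  also have "(LINT x|lebesgue. (F (x /\<^sub>R r))\<^sup>2) = r ^ 5 * (LINT x|lebesgue. (F x)\<^sup>2)"
    by (rule integral_dilate[of "\<lambda>x. (F x)\<^sup>2"]) (use r in auto)
  finally have eq: "(LINT x|lebesgue. (norm (c * F (x /\<^sub>R r)))\<^sup>2) = c\<^sup>2 * (r ^ 5 * (LINT x|lebesgue. (F x)\<^sup>2))" .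
  have "sqrt (r ^ 5) = r powr (5/2)"
    using r by (simp add: powr_half_sqrt[symmetric] powr_powr flip: powr_numeral)
  then show ?thesis unfolding Lp_norm_2 eq by (simp add: real_sqrt_mult)
qed

lemma dir_deriv_cutoff:
  "dir_deriv b (cutoff r) x = inverse r * dir_deriv b (cutoff 1) (x /\<^sub>R r)"
proof -
  have c: "cutoff r = (\<lambda>x. cutoff 1 (0 + x /\<^sub>R r))" by (simp add: cutoff_def fun_eq_iff)
  have d: "cutoff 1 differentiable (at y)" for y by (rule smooth_imp_differentiable[OF smooth_cutoff])
  have "dir_deriv b (cutoff r) x = dir_deriv (b /\<^sub>R r) (cutoff 1) (0 + x /\<^sub>R r)"
    unfolding c by (rule dir_deriv_affine[OF linear_inverse_scale d])
  also have "\<dots> = inverse r * dir_deriv b (cutoff 1) (x /\<^sub>R r)"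
    using linear_scale[OF has_derivative_linear[OF has_derivative_dir_deriv[OF d]]] by simp
  finally show ?thesis .
qed

lemma dir_deriv_dir_deriv_cutoff:
  assumes "b \<in> Basis"
  shows "dir_deriv b (dir_deriv b (cutoff r)) x = (inverse r)\<^sup>2 * dir_deriv b (dir_deriv b (cutoff 1)) (x /\<^sub>R r)"
proof -
  define h where "h = dir_deriv b (cutoff 1)"
  have d: "h differentiable (at y)" for y
    unfolding h_def by (rule smooth_imp_differentiable[OF smooth_dir_deriv[OF smooth_cutoff assms]])
  have "(dir_deriv b (cutoff r)) = (\<lambda>x. inverse r * h (0 + x /\<^sub>R r))"
    by (auto simp: h_def dir_deriv_cutoff[of b r])
  moreover have "dir_deriv b (\<lambda>x. inverse r * h (0 + x /\<^sub>R r)) x = inverse r * dir_deriv (b /\<^sub>R r) h (0 + x /\<^sub>R r)"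
    by (rule dir_deriv_eq[OF has_derivative_mult_right[OF has_derivative_affine[OF linear_inverse_scale d]]])
  moreover have "dir_deriv (b /\<^sub>R r) h (0 + x /\<^sub>R r) = inverse r * dir_deriv b h (x /\<^sub>R r)"
    using linear_scale[OF has_derivative_linear[OF has_derivative_dir_deriv[OF d]]] by simp
  ultimately show ?thesis by (simp add: h_def power2_eq_square)
qed

lemma laplacian_cutoff: "laplacian (cutoff r) x = (inverse r)\<^sup>2 * laplacian (cutoff 1) (x /\<^sub>R r)"
  unfolding laplacian_def sum_distrib_left
  by (intro sum.cong refl) (rule dir_deriv_dir_deriv_cutoff)

lemma test_function_laplacian:
  assumes "test_function U \<phi>"
  shows "test_function U (laplacian \<phi>)"
proof -
  obtain C where C: "compact C" "C \<subseteq> U" "\<And>x. x \<notin> C \<Longrightarrow> \<phi> x = 0" and s: "smooth \<phi>"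
    using test_function_support[OF assms] assms by (metis test_function_def)
  have cl: "closure {x. \<phi> x \<noteq> 0} \<subseteq> C"
    using C by (intro closure_minimal) (auto intro: compact_imp_closed)
  have 1: "dir_deriv b \<phi> x = 0" if "x \<notin> C" for x b
    using cl that by (intro dir_deriv_outside_support) auto
  have "closure {x. dir_deriv b \<phi> x \<noteq> 0} \<subseteq> C" for b
    using C 1 by (intro closure_minimal) (auto intro: compact_imp_closed)
  then have 2: "dir_deriv b (dir_deriv b \<phi>) x = 0" if "x \<notin> C" for x b
    using that by (intro dir_deriv_outside_support) auto
  have "smooth (laplacian \<phi>)"
    unfolding laplacian_def[abs_def] smooth_iff_times_differentiable
    using smooth_dir_deriv[OF smooth_dir_deriv[OF s]]
    by (auto intro!: times_differentiable_sum simp: smooth_iff_times_differentiable)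
  then show ?thesis by (rule test_functionI[OF _ C(1,2)]) (simp add: laplacian_def 2)
qed

text \<open>
  Sums of norms of partial derivatives are enough here; only the behaviour under dilations matters.
\<close>

definition cutoff_gradient_norm :: real where
  "cutoff_gradient_norm = (\<Sum>b\<in>Basis. Lp_norm 2 (dir_deriv b (cutoff 1)))"

lemma Lp_norm_cutoff:
  assumes "r > 0"
  shows "Lp_norm 2 (cutoff r) = r powr (5/2) * Lp_norm 2 (cutoff 1)"
proof -
  have "cutoff r = (\<lambda>x. 1 * cutoff 1 (x /\<^sub>R r))" by (simp add: cutoff_def fun_eq_iff)
  then show ?thesis
    using Lp_norm_dilate[OF smooth_borel_measurable[OF smooth_cutoff, of 1] assms, of 1] by simp
qed

lemma Lp_norm_laplacian_cutoff:
  assumes "r > 0"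
  shows "Lp_norm 2 (laplacian (cutoff r)) = r powr (1/2) * Lp_norm 2 (laplacian (cutoff 1))"
proof -
  have m: "laplacian (cutoff 1) \<in> borel_measurable borel"
    using test_function_laplacian[OF test_function_cutoff[of 1]] smooth_borel_measurable
    by (auto simp: test_function_def)
  have "r powr (5/2) = r powr (1/2) * r\<^sup>2"
    using assms by (simp add: powr_add[symmetric] flip: powr_numeral)
  then have "\<bar>(inverse r)\<^sup>2\<bar> * r powr (5/2) = r powr (1/2)"
    using assms by (simp add: power_inverse)
  with Lp_norm_dilate[OF m assms, of "(inverse r)\<^sup>2"] show ?thesis
    by (simp add: laplacian_cutoff[of r, abs_def])
qed

text \<open>
  One derivative of the cut-off is moved to \<open>w\<close>. The norm of the remaining gradient of the cut-off
  scales like \<open>r powr (3/2)\<close>, which is the common order of all terms in the argument.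
\<close>

lemma Hdot1_laplacian_cutoff_bound:
  assumes w: "in_Hdot1 w" and r: "r > 0"
  shows "\<bar>LINT x|lebesgue. w x * laplacian (cutoff r) x\<bar>
    \<le> r powr (3/2) * (Hdot1_norm w * cutoff_gradient_norm)"
proof -
  obtain G where G: "weak_gradient w G" "in_Lp 2 G" "Hdot1_norm w = Lp_norm 2 G"
    using Hdot1_norm_gradient[OF w] .
  have loc: "locally_integrable w" using G by (simp add: weak_gradient_def)
  note t = test_function_cutoff[OF r]
  have r32: "inverse r * r powr (5/2) = r powr (3/2)"
  proof -
    have "r powr (5/2) = r powr (3/2) * r powr 1"
      unfolding powr_add[symmetric] by simp
    then show ?thesis using r by simp
  qed
  have "(LINT x|lebesgue. w x * laplacian (cutoff r) x)
      = (\<Sum>b\<in>Basis. LINT x|lebesgue. w x * dir_deriv b (dir_deriv b (cutoff r)) x)"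
    unfolding laplacian_def sum_distrib_left
    by (intro Bochner_Integration.integral_sum
        integrable_mult_test_function[OF loc test_function_dir_deriv[OF test_function_dir_deriv[OF t]]])
  then have "\<bar>LINT x|lebesgue. w x * laplacian (cutoff r) x\<bar>
      \<le> (\<Sum>b\<in>Basis. \<bar>LINT x|lebesgue. w x * dir_deriv b (dir_deriv b (cutoff r)) x\<bar>)"
    by (simp only: sum_abs)
  also have "\<dots> \<le> (\<Sum>b\<in>(Basis::(real^5) set). r powr (3/2) * (Hdot1_norm w * Lp_norm 2 (dir_deriv b (cutoff 1))))"
  proof (rule sum_mono)
    fix b :: "real^5" assume b: "b \<in> Basis"
    have "\<bar>LINT x|lebesgue. w x * dir_deriv b (dir_deriv b (cutoff r)) x\<bar> \<le> Lp_norm 2 G * Lp_norm 2 (dir_deriv b (cutoff r))"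
      by (rule weak_gradient_pairing_bound[OF G(1,2) test_function_dir_deriv[OF t b] b])
    also have "Lp_norm 2 (dir_deriv b (cutoff r)) = r powr (3/2) * Lp_norm 2 (dir_deriv b (cutoff 1))"
      using Lp_norm_dilate[OF smooth_borel_measurable[OF smooth_dir_deriv[OF smooth_cutoff b, of 1]] r, of "inverse r"] r r32
      by (simp add: dir_deriv_cutoff[of b r, abs_def])
    finally show "\<bar>LINT x|lebesgue. w x * dir_deriv b (dir_deriv b (cutoff r)) x\<bar>
        \<le> r powr (3/2) * (Hdot1_norm w * Lp_norm 2 (dir_deriv b (cutoff 1)))"
      by (simp add: G(3) ac_simps)
  qed
  also have "\<dots> = r powr (3/2) * (Hdot1_norm w * cutoff_gradient_norm)"
    by (simp add: cutoff_gradient_norm_def sum_distrib_left)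
  finally show ?thesis .
qed

lemma L2_test_function_bound:
  fixes v :: "'a::euclidean_space \<Rightarrow> real"
  assumes v: "in_Lp 2 v" and t: "test_function U \<phi>"
  shows "\<bar>LINT x|lebesgue. v x * \<phi> x\<bar> \<le> Lp_norm 2 v * Lp_norm 2 \<phi>"
  using integral_Cauchy_Schwarz(2)[of v lebesgue \<phi>] v test_function_square_integrable[OF t]
  by (auto simp: in_Lp_2_iff Lp_norm_2)

definition power_nonlinearity :: "real \<Rightarrow> real" where
  "power_nonlinearity a = \<bar>a\<bar> powr (4/3) * a"

lemma power_nonlinearity_pos: "a > 0 \<Longrightarrow> power_nonlinearity a = a powr (7/3)"
  using powr_mult_base[of a "4/3"] by (simp add: power_nonlinearity_def mult.commute)

lemma abs_power_nonlinearity: "\<bar>power_nonlinearity a\<bar> = \<bar>a\<bar> powr (7/3)"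
  using powr_mult_base[of "\<bar>a\<bar>" "4/3"] by (cases "a = 0") (simp_all add: power_nonlinearity_def abs_mult mult.commute)

lemma power_nonlinearity_mult: "power_nonlinearity (a * b) = power_nonlinearity a * power_nonlinearity b"
  by (simp add: power_nonlinearity_def abs_mult powr_mult)

lemma continuous_power_nonlinearity: "continuous_on S power_nonlinearity"
  unfolding power_nonlinearity_def[abs_def] by (intro continuous_intros continuous_on_powr') auto

text \<open>
  By homogeneity the increment is \<open>\<bar>a\<bar> powr (7/3)\<close> times an increment at the point 1, which is small
  if \<open>b\<close> is small compared with \<open>a\<close>. Otherwise \<open>a\<close> itself is controlled by \<open>b\<close>.
\<close>

lemma power_nonlinearity_perturbation:
  assumes "\<eta> > 0"
  obtains C where "C > 0"
    "\<And>a b. \<bar>power_nonlinearity (a + b) - power_nonlinearity a\<bar> \<le> \<eta> * \<bar>a\<bar> powr (7/3) + C * \<bar>b\<bar> powr (7/3)"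
proof -
  have "isCont power_nonlinearity 1"
    using continuous_power_nonlinearity[of UNIV] by (simp add: continuous_on_eq_continuous_at)
  then obtain d where d: "d > 0" "\<And>s. \<bar>s\<bar> < d \<Longrightarrow> \<bar>power_nonlinearity (1 + s) - power_nonlinearity 1\<bar> < \<eta>"
    unfolding continuous_at_eps_delta using assms
    by (metis add.commute add_diff_cancel dist_real_def)
  define C where "C = (1 / d + 1) powr (7/3) + (1 / d) powr (7/3)"
  have "0 < 1 / d + 1" using d by (simp add: add_pos_pos)
  then have "C > 0" unfolding C_def by (intro add_pos_nonneg) auto
  moreover have "\<bar>power_nonlinearity (a + b) - power_nonlinearity a\<bar> \<le> \<eta> * \<bar>a\<bar> powr (7/3) + C * \<bar>b\<bar> powr (7/3)" for a b
  proof (cases "\<bar>b\<bar> < d * \<bar>a\<bar>")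
    case True
    then have a: "a \<noteq> 0" by auto
    then have "\<bar>b / a\<bar> < d" using True by (simp add: abs_divide field_simps)
    from d(2)[OF this] have s: "\<bar>power_nonlinearity (1 + b / a) - power_nonlinearity 1\<bar> \<le> \<eta>" by simp
    have "a + b = a * (1 + b / a)" using a by (simp add: field_simps)
    then have "power_nonlinearity (a + b) - power_nonlinearity a
        = power_nonlinearity a * (power_nonlinearity (1 + b / a) - power_nonlinearity 1)"
      by (simp add: power_nonlinearity_mult right_diff_distrib power_nonlinearity_def[of 1])
    then have "\<bar>power_nonlinearity (a + b) - power_nonlinearity a\<bar> \<le> \<bar>a\<bar> powr (7/3) * \<eta>"
      using s by (simp add: abs_mult abs_power_nonlinearity mult_left_mono)
    moreover have "0 \<le> C * \<bar>b\<bar> powr (7/3)" using \<open>C > 0\<close> by simp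
    ultimately show ?thesis by (simp add: mult.commute)
  next
    case False
    then have a: "\<bar>a\<bar> \<le> 1 / d * \<bar>b\<bar>" using d by (simp add: field_simps)
    then have ab: "\<bar>a + b\<bar> \<le> (1 / d + 1) * \<bar>b\<bar>"
      using abs_triangle_ineq[of a b] by (simp add: distrib_right)
    have "\<bar>power_nonlinearity (a + b) - power_nonlinearity a\<bar> \<le> \<bar>a + b\<bar> powr (7/3) + \<bar>a\<bar> powr (7/3)"
      unfolding abs_power_nonlinearity[symmetric] by (rule abs_triangle_ineq4)
    also have "\<dots> \<le> ((1 / d + 1) * \<bar>b\<bar>) powr (7/3) + (1 / d * \<bar>b\<bar>) powr (7/3)"
      using a ab by (intro add_mono powr_mono2) auto
    also have "\<dots> = C * \<bar>b\<bar> powr (7/3)"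
      using d by (simp add: C_def powr_mult[symmetric] distrib_right)
    finally show ?thesis using assms by (smt (verit) mult_nonneg_nonneg powr_ge_zero)
  qed
  ultimately show ?thesis by (rule that)
qed

text \<open>
  Every summand falls short of the sum by at least \<open>\<alpha>\<close>, hence by a fixed factor; this gains a factor
  in each product \<open>f i * S powr (4/3)\<close>, and these products add up to \<open>S powr (7/3)\<close>.
\<close>

lemma sum_powr_superadditive:
  fixes f :: "'i \<Rightarrow> real"
  assumes I: "finite I" "2 \<le> card I" and f: "\<And>i. i \<in> I \<Longrightarrow> \<alpha> \<le> f i \<and> f i \<le> \<beta>" and "0 < \<alpha>"
  shows "(1 + \<alpha> / \<beta>) * (\<Sum>i\<in>I. f i powr (7/3)) \<le> (\<Sum>i\<in>I. f i) powr (7/3)"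
proof -
  define S where "S = (\<Sum>i\<in>I. f i)"
  have pos: "0 < f i" if "i \<in> I" for i using f[OF that] \<open>0 < \<alpha>\<close> by linarith
  obtain i0 where "i0 \<in> I" using I by fastforce
  then have "\<alpha> \<le> \<beta>" using f by force
  with \<open>0 < \<alpha>\<close> have \<beta>: "0 < \<beta>" by linarith
  have summand: "(1 + \<alpha> / \<beta>) * f i powr (7/3) \<le> f i * S powr (4/3)" if i: "i \<in> I" for i
  proof -
    have "\<exists>j\<in>I. j \<noteq> i"
    proof (rule ccontr)
      assume "\<not> ?thesis"
      then have "I \<subseteq> {i}" by blast
      then have "card I \<le> 1" using card_mono[of "{i}" I] by simp
      with I show False by simp
    qed
    then obtain j where j: "j \<in> I" "j \<noteq> i" by blast
    have "f i + f j = (\<Sum>k\<in>{i, j}. f k)" using j by simp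
    also have "\<dots> \<le> S" unfolding S_def using i j I pos by (intro sum_mono2) (auto intro: less_imp_le)
    finally have "f i + \<alpha> \<le> S" using f[OF j(1)] by linarith
    moreover have "f i * (\<alpha> / \<beta>) \<le> \<alpha>" using f[OF i] \<beta> \<open>0 < \<alpha>\<close> by (simp add: field_simps)
    moreover have "(1 + \<alpha> / \<beta>) * f i = f i + f i * (\<alpha> / \<beta>)" by (simp add: algebra_simps)
    ultimately have "(1 + \<alpha> / \<beta>) * f i \<le> S" by linarith
    then have "((1 + \<alpha> / \<beta>) * f i) powr (4/3) \<le> S powr (4/3)"
      using pos[OF i] \<beta> \<open>0 < \<alpha>\<close> by (intro powr_mono2) auto
    moreover have "(1 + \<alpha> / \<beta>) powr 1 \<le> (1 + \<alpha> / \<beta>) powr (4/3)"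
      using \<beta> \<open>0 < \<alpha>\<close> by (intro powr_mono) auto
    then have "(1 + \<alpha> / \<beta>) * f i powr (4/3) \<le> ((1 + \<alpha> / \<beta>) * f i) powr (4/3)"
      using \<beta> \<open>0 < \<alpha>\<close> by (simp add: powr_mult mult_right_mono)
    ultimately have "(1 + \<alpha> / \<beta>) * f i powr (4/3) \<le> S powr (4/3)" by linarith
    then have le: "f i * ((1 + \<alpha> / \<beta>) * f i powr (4/3)) \<le> f i * S powr (4/3)"
      using pos[OF i] by (intro mult_left_mono) auto
    have "f i powr (7/3) = f i * f i powr (4/3)"
      using pos[OF i] by (simp add: powr_mult_base)
    then have "(1 + \<alpha> / \<beta>) * f i powr (7/3) = f i * ((1 + \<alpha> / \<beta>) * f i powr (4/3))"
      by (simp only: mult.left_commute)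
    with le show ?thesis by (simp only:)
  qed
  have "(1 + \<alpha> / \<beta>) * (\<Sum>i\<in>I. f i powr (7/3)) \<le> (\<Sum>i\<in>I. f i * S powr (4/3))"
    unfolding sum_distrib_left by (rule sum_mono) (rule summand)
  also have "\<dots> = S * S powr (4/3)" by (simp add: S_def sum_distrib_right)
  also have "\<dots> = S powr (7/3)"
    using pos by (simp add: powr_mult_base S_def sum_nonneg less_imp_le)
  finally show ?thesis by (simp add: S_def)
qed

text \<open>
  The integrand is at most \<open>\<tau> powr (7/3)\<close> where \<open>\<bar>w x\<bar> \<le> \<tau>\<close> and at most \<open>\<bar>w x\<bar> powr (10/3) / \<tau>\<close> elsewhere.
  The support of the cut-off lies in a cube of volume \<open>32 * r ^ 5\<close>.
\<close>

lemma integrable_power_cutoff: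
  assumes w: "w \<in> borel_measurable lebesgue" "integrable lebesgue (\<lambda>x. \<bar>w x\<bar> powr (10/3))" and r: "r > 0"
  shows "integrable lebesgue (\<lambda>x. \<bar>w x\<bar> powr (7/3) * cutoff r x)"
    and "\<tau> > 0 \<Longrightarrow> (LINT x|lebesgue. \<bar>w x\<bar> powr (7/3) * cutoff r x)
      \<le> \<tau> powr (7/3) * (32 * r ^ 5) + (LINT x|lebesgue. \<bar>w x\<bar> powr (10/3)) / \<tau>"
proof -
  define Q where "Q = cbox (- (r *\<^sub>R One)) (r *\<^sub>R (One :: real^5))"
  have mQ: "measure lebesgue Q = 32 * r ^ 5"
  proof -
    have ne: "cbox (- (r *\<^sub>R One)) (r *\<^sub>R (One :: real^5)) \<noteq> {}"
      using r by (simp add: box_ne_empty)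
    have "measure lebesgue Q = (\<Prod>b\<in>(Basis :: (real^5) set). (r *\<^sub>R One) \<bullet> b - (- (r *\<^sub>R One)) \<bullet> b)"
      using content_cbox'[OF ne] by (simp only: Q_def measure_completion sets_lborel borel_closed closed_cbox)
    also have "\<dots> = (\<Prod>b\<in>(Basis :: (real^5) set). 2 * r)"
      by (rule prod.cong) (simp_all add: inner_minus_left inner_scaleR_left inner_sum_left_Basis)
    finally show ?thesis by (simp add: power_mult_distrib)
  qed
  have Q: "integrable lebesgue (indicator Q :: real^5 \<Rightarrow> real)"
    by (intro integrable_real_indicator) (auto simp: Q_def emeasure_lborel_cbox_eq)
  have mc: "cutoff r \<in> borel_measurable lebesgue"
    using test_function_square_integrable(1)[OF test_function_cutoff[OF r]] .
  have dom: "\<bar>w x\<bar> powr (7/3) * cutoff r x \<le> \<tau> powr (7/3) * indicator Q x + \<bar>w x\<bar> powr (10/3) / \<tau>"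
    if \<tau>: "\<tau> > 0" for x \<tau>
  proof (cases "x \<in> Q")
    case False
    then show ?thesis using cutoff_outside[OF r, of x] \<tau> by (simp add: Q_def)
  next
    case True
    have "\<bar>w x\<bar> powr (7/3) * cutoff r x \<le> \<bar>w x\<bar> powr (7/3)"
      using cutoff_bounds[of r x] by (simp add: mult_left_le)
    also have "\<dots> \<le> \<tau> powr (7/3) + \<bar>w x\<bar> powr (10/3) / \<tau>"
    proof (cases "\<bar>w x\<bar> \<le> \<tau>")
      case True
      then have "\<bar>w x\<bar> powr (7/3) \<le> \<tau> powr (7/3)" by (intro powr_mono2) auto
      moreover have "0 \<le> \<bar>w x\<bar> powr (10/3) / \<tau>" using \<tau> by simp
      ultimately show ?thesis by linarith
    next
      case False
      have "\<bar>w x\<bar> powr (10/3) = \<bar>w x\<bar> * \<bar>w x\<bar> powr (7/3)" by (simp add: powr_mult_base)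
      moreover have "\<tau> * \<bar>w x\<bar> powr (7/3) \<le> \<bar>w x\<bar> * \<bar>w x\<bar> powr (7/3)"
        using False by (intro mult_right_mono) auto
      ultimately have "\<bar>w x\<bar> powr (7/3) \<le> \<bar>w x\<bar> powr (10/3) / \<tau>"
        using \<tau> by (simp add: field_simps)
      moreover have "0 \<le> \<tau> powr (7/3)" by simp
      ultimately show ?thesis by linarith
    qed
    finally show ?thesis using True by simp
  qed
  have int: "integrable lebesgue (\<lambda>x. \<tau> powr (7/3) * indicator Q x + \<bar>w x\<bar> powr (10/3) / \<tau>)" for \<tau>
    using Q w(2) by (intro Bochner_Integration.integrable_add integrable_mult_right integrable_divide)
  show i: "integrable lebesgue (\<lambda>x. \<bar>w x\<bar> powr (7/3) * cutoff r x)"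
  proof (rule Bochner_Integration.integrable_bound[OF int[of 1]])
    show "(\<lambda>x. \<bar>w x\<bar> powr (7/3) * cutoff r x) \<in> borel_measurable lebesgue"
      using w(1) mc by measurable
    show "AE x in lebesgue. norm (\<bar>w x\<bar> powr (7/3) * cutoff r x) \<le> norm (1 powr (7/3) * indicator Q x + \<bar>w x\<bar> powr (10/3) / 1)"
      using dom[of 1] cutoff_bounds by (intro AE_I2) (simp add: abs_mult)
  qed
  assume \<tau>: "\<tau> > 0"
  have "(LINT x|lebesgue. \<bar>w x\<bar> powr (7/3) * cutoff r x) \<le> (LINT x|lebesgue. \<tau> powr (7/3) * indicator Q x + \<bar>w x\<bar> powr (10/3) / \<tau>)"
    by (rule integral_mono[OF i int]) (rule dom[OF \<tau>])
  also have "\<dots> = \<tau> powr (7/3) * (32 * r ^ 5) + (LINT x|lebesgue. \<bar>w x\<bar> powr (10/3)) / \<tau>"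
    using Q w(2) by (subst Bochner_Integration.integral_add) (auto simp: mQ)
  finally show "(LINT x|lebesgue. \<bar>w x\<bar> powr (7/3) * cutoff r x)
      \<le> \<tau> powr (7/3) * (32 * r ^ 5) + (LINT x|lebesgue. \<bar>w x\<bar> powr (10/3)) / \<tau>" .
qed

text \<open>
  The Sobolev inequality bounds the critical norm of \<open>w\<close> by \<open>\<kappa> = 3 * \<epsilon>\<close>.
\<close>

lemma Hdot1_power_cutoff_bound:
  assumes w: "in_Hdot1 w" and r: "r > 0" and \<epsilon>: "Hdot1_norm w \<le> \<epsilon>" "\<epsilon> > 0"
  shows "(LINT x|lebesgue. \<bar>w x\<bar> powr (7/3) * cutoff r x) \<le> r powr (3/2) * (33 * (3 * \<epsilon>) powr (7/3))"
proof -
  define \<kappa> where "\<kappa> = 3 * \<epsilon>"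
  define X where "X = (LINT x|lebesgue. \<bar>w x\<bar> powr (10/3))"
  have \<kappa>: "\<kappa> > 0" using \<epsilon> by (simp add: \<kappa>_def)
  have wm: "w \<in> borel_measurable lebesgue" "integrable lebesgue (\<lambda>x. \<bar>w x\<bar> powr (10/3))"
    using w by (auto simp: in_Hdot1_def in_Lp_def)
  have X0: "0 \<le> X" by (simp add: X_def)
  have "X powr (3/10) \<le> \<kappa>"
    using sobolev_Hdot1[OF w] \<epsilon> by (simp add: Lp_norm_def X_def \<kappa>_def)
  then have "(X powr (3/10)) powr (10/3) \<le> \<kappa> powr (10/3)" by (intro powr_mono2) auto
  then have X: "X \<le> \<kappa> powr (10/3)" using X0 by (simp add: powr_powr)
  \<comment> \<open>This threshold gives both terms of the splitting the order \<open>r powr (3/2)\<close>.\<close>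
  define \<tau> where "\<tau> = \<kappa> * r powr (-3/2)"
  have \<tau>: "\<tau> > 0" using \<kappa> r by (simp add: \<tau>_def)
  have e1: "\<tau> powr (7/3) * (32 * r ^ 5) = r powr (3/2) * (32 * \<kappa> powr (7/3))"
  proof -
    have "\<tau> powr (7/3) = \<kappa> powr (7/3) * r powr (-7/2)" using \<kappa> r by (simp add: \<tau>_def powr_mult powr_powr)
    moreover have "r powr (-7/2) * r ^ 5 = r powr (3/2)"
      using r by (simp add: powr_add[symmetric] flip: powr_numeral)
    ultimately show ?thesis by (simp add: ac_simps)
  qed
  have e2: "X / \<tau> \<le> r powr (3/2) * \<kappa> powr (7/3)"
  proof -
    have "X / \<tau> \<le> \<kappa> powr (10/3) / \<tau>" using X \<tau> by (simp add: divide_right_mono)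
    also have "\<dots> = r powr (3/2) * \<kappa> powr (7/3)"
    proof -
      have "\<kappa> powr (10/3) = \<kappa> * \<kappa> powr (7/3)" using \<kappa> by (simp add: powr_mult_base)
      moreover have "r powr (-3/2) = inverse (r powr (3/2))" using powr_minus[of r "3/2"] by simp
      ultimately show ?thesis using \<kappa> r by (simp add: \<tau>_def field_simps)
    qed
    finally show ?thesis .
  qed
  have "(LINT x|lebesgue. \<bar>w x\<bar> powr (7/3) * cutoff r x) \<le> \<tau> powr (7/3) * (32 * r ^ 5) + X / \<tau>"
    unfolding X_def by (rule integrable_power_cutoff(2)[OF wm r \<tau>])
  also have "\<dots> \<le> r powr (3/2) * (32 * \<kappa> powr (7/3)) + r powr (3/2) * \<kappa> powr (7/3)"
    using e1 e2 by linarith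
  also have "\<dots> = r powr (3/2) * (33 * \<kappa> powr (7/3))" by (simp add: algebra_simps)
  finally show ?thesis by (simp add: \<kappa>_def)
qed

section \<open>The elliptic defect of a sum of bubbles\<close>

lemma integral_box_bump_pos:
  fixes l r :: "'a::euclidean_space"
  assumes "box l r \<noteq> {}" "k > 0"
  shows "0 < (LINT x|lebesgue. box_bump k l r x)"
proof -
  have i: "integrable lebesgue (box_bump k l r)"
    using integrable_mult_test_function[OF continuous_imp_locally_integrable[OF continuous_on_const[of UNIV 1]]
        test_function_box_bump[of k l r]] by simp
  have nn: "0 \<le> (LINT x|lebesgue. box_bump k l r x)"
    by (intro integral_nonneg_AE AE_I2 box_bump_bounds)
  moreover have "(LINT x|lebesgue. box_bump k l r x) \<noteq> 0"
  proof
    assume "(LINT x|lebesgue. box_bump k l r x) = 0"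
    then have "AE x in lebesgue. box_bump k l r x = 0"
      by (subst (asm) integral_nonneg_eq_0_iff_AE[OF i]) (auto simp: box_bump_bounds)
    then have "AE x in lebesgue. x \<notin> box l r"
    proof eventually_elim
      case (elim x)
      show ?case
      proof
        assume x: "x \<in> box l r"
        have "0 < box_bump k l r x" unfolding box_bump_def
          using x assms(2) by (intro prod_pos mult_pos_pos) (auto simp: flat_exp_pos_iff mem_box)
        with elim show False by simp
      qed
    qed
    then have "box l r \<in> null_sets lebesgue"
      by (simp add: AE_iff_null_sets)
    then have "negligible (box l r)" by (simp add: negligible_iff_null_sets)
    then show False using assms(1) negligible_interval(2) by blast
  qed
  ultimately show ?thesis by simp
qed

definition cutoff_mass :: real where
  "cutoff_mass = (LINT x|lebesgue. cutoff 1 x)"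

lemma cutoff_mass_pos: "0 < cutoff_mass"
proof -
  have "cutoff 1 = box_bump 1 (- One) (One :: real^5)" by (auto simp: cutoff_def)
  moreover have "box (- One) (One :: real^5) \<noteq> {}" by (simp add: box_ne_empty)
  ultimately show ?thesis using integral_box_bump_pos[of "- One" "One :: real^5" 1] by (simp add: cutoff_mass_def)
qed

lemma integral_cutoff:
  assumes "r > 0"
  shows "(LINT x|lebesgue. cutoff r x) = r ^ 5 * cutoff_mass" "integrable lebesgue (cutoff r)"
proof -
  have "(LINT x|lebesgue. cutoff 1 (x /\<^sub>R r)) = r ^ 5 * (LINT x|lebesgue. cutoff 1 x)"
    by (rule integral_dilate[OF smooth_borel_measurable[OF smooth_cutoff] cutoff_bounds(1) assms])
  then show "(LINT x|lebesgue. cutoff r x) = r ^ 5 * cutoff_mass"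
    by (simp add: cutoff_def cutoff_mass_def)
  show "integrable lebesgue (cutoff r)"
    using integrable_mult_test_function[OF continuous_imp_locally_integrable[OF continuous_on_const[of UNIV 1]]
        test_function_cutoff[OF assms]] by simp
qed

text \<open>
  By the equation for the bubble this is minus its pairing with the Laplacian of the cut-off.
\<close>

definition local_mass :: "real \<Rightarrow> real \<Rightarrow> real^5 \<Rightarrow> real" where
  "local_mass r l z = (LINT x|lebesgue. bubble l z x powr (7/3) * cutoff r x)"

lemma continuous_bubble_powr: "l > 0 \<Longrightarrow> continuous_on UNIV (\<lambda>x. bubble l z x powr (7/3))"
  unfolding bubble_powr by (intro continuous_intros continuous_on_bracket_powr)

lemma integrable_bubble_powr_cutoff:
  assumes "l > 0" "r > 0"
  shows "integrable lebesgue (\<lambda>x. bubble l z x powr (7/3) * cutoff r x)"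
  by (rule integrable_mult_test_function[OF continuous_imp_locally_integrable[OF continuous_bubble_powr]
        test_function_cutoff]) (use assms in auto)

lemma local_mass_le_concentrated:
  assumes l: "l > 0" and r: "r > 0"
  shows "local_mass r l z \<le> l powr (3/2) * bubble_mass"
proof -
  have i: "integrable lborel (\<lambda>x. bracket l z x powr (-7/2))" by (rule integrable_bracket_powr[OF l]) simp
  then have i': "integrable lebesgue (\<lambda>x. l powr (-7/2) * bracket l z x powr (-7/2))"
    by (intro integrable_mult_right) (subst integrable_completion, measurable)
  have m0: "0 \<le> bubble_mass" by (simp add: bubble_mass_def)
  have "local_mass r l z \<le> (LINT x|lebesgue. l powr (-7/2) * bracket l z x powr (-7/2))"
    unfolding local_mass_def bubble_powr[OF l]
    using integrable_bubble_powr_cutoff[OF l r, of z] cutoff_bounds i'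
    by (intro integral_mono) (auto simp: bubble_powr[OF l] mult_left_le)
  also have "\<dots> = l powr (-7/2) * (LINT x|lborel. bracket l z x powr (-7/2))"
    using integral_completion[of "\<lambda>x. bracket l z x powr (-7/2)" lborel] by simp
  also have "(LINT x|lborel. bracket l z x powr (-7/2)) = l ^ 5 * bubble_mass"
    by (subst integral_eq_nn_integral) (use l m0 nn_integral_bracket[OF l, of z] in auto)
  also have "l powr (-7/2) * (l ^ 5 * bubble_mass) = l powr (3/2) * bubble_mass"
    using l by (simp add: powr_add[symmetric] mult.assoc[symmetric] flip: powr_numeral)
  finally show ?thesis .
qed

lemma local_mass_le_spread:
  assumes l: "l > 0" and r: "r > 0"
  shows "local_mass r l z \<le> l powr (-7/2) * (r ^ 5 * cutoff_mass)"
proof -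
  have "bubble l z x powr (7/3) \<le> l powr (-7/2)" for x
  proof -
    have "bracket l z x powr (-7/2) \<le> bracket l z x powr 0"
      using bracket_ge_1[of l z x] by (intro powr_mono) auto
    then have "bracket l z x powr (-7/2) \<le> 1" using bracket_pos[of l z x] by simp
    then show ?thesis by (simp add: bubble_powr[OF l] mult_left_le)
  qed
  then have "local_mass r l z \<le> (LINT x|lebesgue. l powr (-7/2) * cutoff r x)"
    unfolding local_mass_def using integral_cutoff(2)[OF r]
    by (intro integral_mono integrable_bubble_powr_cutoff l r integrable_mult_right mult_right_mono cutoff_bounds)
  then show ?thesis by (simp add: integral_cutoff(1)[OF r])
qed

lemma bracket_le_near:
  assumes r: "r > 0" and l: "\<alpha> * r \<le> l" "\<alpha> > 0" and x: "norm x \<le> 5 * r" and z: "norm z \<le> \<rho> * r"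
  shows "bracket l z x \<le> 1 + (5 + \<rho>)\<^sup>2 / (15 * \<alpha>\<^sup>2)"
proof -
  have "norm (x - z) \<le> (5 + \<rho>) * r"
    using norm_triangle_ineq4[of x z] x z by (simp add: distrib_right)
  then have "(norm (x - z))\<^sup>2 \<le> ((5 + \<rho>) * r)\<^sup>2" by (intro power_mono) auto
  moreover have "15 * (\<alpha> * r)\<^sup>2 \<le> 15 * l\<^sup>2" using l r by (simp add: power_mono)
  ultimately have "(norm (x - z))\<^sup>2 / (15 * l\<^sup>2) \<le> ((5 + \<rho>) * r)\<^sup>2 / (15 * (\<alpha> * r)\<^sup>2)"
    using l r by (intro frac_le) auto
  also have "\<dots> = (5 + \<rho>)\<^sup>2 / (15 * \<alpha>\<^sup>2)" using r by (simp add: power_mult_distrib)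
  finally show ?thesis by (simp add: bracket_def)
qed

lemma local_mass_ge:
  assumes r: "r > 0" and z: "norm z \<le> \<rho> * r"
  shows "r powr (3/2) * ((1 + (5 + \<rho>)\<^sup>2 / 15) powr (-7/2) * cutoff_mass) \<le> local_mass r r z"
proof -
  define q where "q = (1 + (5 + \<rho>)\<^sup>2 / 15) powr (-7/2)"
  have "r powr (-7/2) * q * cutoff r x \<le> bubble r z x powr (7/3) * cutoff r x" for x
  proof (cases "cutoff r x = 0")
    case False
    have "bracket r z x \<le> 1 + (5 + \<rho>)\<^sup>2 / 15"
      using bracket_le_near[OF r _ _ cutoff_norm[OF r False] z, of 1 r] by simp
    then have "q \<le> bracket r z x powr (-7/2)"
      unfolding q_def using bracket_pos[of r z x] by (intro powr_mono2') auto
    then show ?thesis using cutoff_bounds[of r x] r by (simp add: bubble_powr mult_right_mono)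
  qed simp
  then have "(LINT x|lebesgue. r powr (-7/2) * q * cutoff r x) \<le> local_mass r r z"
    unfolding local_mass_def using integral_cutoff(2)[OF r]
    by (intro integral_mono integrable_bubble_powr_cutoff r integrable_mult_right)
  moreover have "(LINT x|lebesgue. r powr (-7/2) * q * cutoff r x) = r powr (3/2) * (q * cutoff_mass)"
  proof -
    have "r powr (-7/2) * r ^ 5 = r powr (3/2)" using r by (simp add: powr_add[symmetric] flip: powr_numeral)
    then have "r powr (-7/2) * q * (r ^ 5 * cutoff_mass) = r powr (3/2) * (q * cutoff_mass)"
      by (simp add: ac_simps)
    then show ?thesis by (simp add: integral_cutoff(1)[OF r])
  qed
  ultimately show ?thesis by (simp only: q_def)
qed

text \<open>
  The local mass of a bubble is at most of order \<open>l powr (3/2)\<close> by integrability of the bubble, and at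
  most of order \<open>l powr (-7/2) * r ^ 5\<close> by its height. A lower bound of order \<open>r powr (3/2)\<close> excludes
  scales that are much smaller or much larger than \<open>r\<close>.
\<close>

lemma scale_control:
  assumes r: "r > 0" and l: "l > 0" and c: "c > 0" and mass: "c * r powr (3/2) \<le> local_mass r l z"
  shows "(c / (bubble_mass + 1)) powr (2/3) * r \<le> l" "l \<le> (cutoff_mass / c) powr (2/7) * r"
proof -
  have m0: "0 \<le> bubble_mass" by (simp add: bubble_mass_def)
  have "c * r powr (3/2) \<le> l powr (3/2) * bubble_mass"
    using mass local_mass_le_concentrated[OF l r, of z] by linarith
  also have "\<dots> \<le> l powr (3/2) * (bubble_mass + 1)" by (intro mult_left_mono) auto
  finally have "c / (bubble_mass + 1) * r powr (3/2) \<le> l powr (3/2)"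
    using m0 by (simp add: field_simps)
  then have "(c / (bubble_mass + 1) * r powr (3/2)) powr (2/3) \<le> (l powr (3/2)) powr (2/3)"
    using m0 c by (intro powr_mono2) auto
  moreover have "(k * r powr (3/2)) powr (2/3) = k powr (2/3) * r" for k
    using r by (simp add: powr_mult powr_powr)
  moreover have "(l powr (3/2)) powr (2/3) = l" using l by (simp add: powr_powr)
  ultimately show "(c / (bubble_mass + 1)) powr (2/3) * r \<le> l" by (simp only:)
  have "c * r powr (3/2) \<le> l powr (-7/2) * (r ^ 5 * cutoff_mass)"
    using mass local_mass_le_spread[OF l r, of z] by linarith
  also have "l powr (-7/2) = inverse (l powr (7/2))" using powr_minus[of l "7/2"] by simp
  also have "r ^ 5 = r powr (3/2) * r powr (7/2)" using r by (simp add: powr_add[symmetric] flip: powr_numeral)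
  finally have "c * r powr (3/2) \<le> inverse (l powr (7/2)) * (r powr (3/2) * r powr (7/2) * cutoff_mass)" .
  then have "l powr (7/2) \<le> cutoff_mass / c * r powr (7/2)"
    using r l c by (simp add: field_simps)
  then have "(l powr (7/2)) powr (2/7) \<le> (cutoff_mass / c * r powr (7/2)) powr (2/7)"
    by (intro powr_mono2) auto
  moreover have "(k * r powr (7/2)) powr (2/7) = k powr (2/7) * r" for k
    using r by (simp add: powr_mult powr_powr)
  moreover have "(l powr (7/2)) powr (2/7) = l" using l by (simp add: powr_powr)
  ultimately show "l \<le> (cutoff_mass / c) powr (2/7) * r" by (simp only:)
qed

lemma integrable_power_nonlinearity_cutoff:
  assumes w: "in_Hdot1 w" and r: "r > 0"
  shows "integrable lebesgue (\<lambda>x. power_nonlinearity (w x) * cutoff r x)"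
proof -
  have wm: "w \<in> borel_measurable lebesgue" "integrable lebesgue (\<lambda>x. \<bar>w x\<bar> powr (10/3))"
    using w by (auto simp: in_Hdot1_def in_Lp_def)
  show ?thesis
  proof (rule Bochner_Integration.integrable_bound[OF integrable_power_cutoff(1)[OF wm r]])
    have "power_nonlinearity \<in> borel_measurable borel"
      by (intro borel_measurable_continuous_onI continuous_power_nonlinearity)
    from measurable_compose[OF wm(1) this]
    show "(\<lambda>x. power_nonlinearity (w x) * cutoff r x) \<in> borel_measurable lebesgue"
      using test_function_square_integrable(1)[OF test_function_cutoff[OF r]] by measurable
  qed (auto simp: abs_mult abs_power_nonlinearity intro!: AE_I2)
qed

lemma integrable_Hdot1_test:
  assumes "in_Hdot1 w" "test_function U \<phi>"
  shows "integrable lebesgue (\<lambda>x. w x * \<phi> x)"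
  using assms by (intro integrable_mult_test_function) (auto simp: in_Hdot1_def weak_gradient_def)

text \<open>
  The pairing of \<open>Laplacian w + \<bar>w\<bar> powr (4/3) * w\<close> with the cut-off, which vanishes for solutions of the
  elliptic equation.
\<close>

definition wave_defect :: "real \<Rightarrow> (real^5 \<Rightarrow> real) \<Rightarrow> real" where
  "wave_defect r w = (LINT x|lebesgue. w x * laplacian (cutoff r) x + power_nonlinearity (w x) * cutoff r x)"

lemma wave_defect_eq:
  assumes "in_Hdot1 w" "r > 0"
  shows "wave_defect r w = (LINT x|lebesgue. w x * laplacian (cutoff r) x)
    + (LINT x|lebesgue. power_nonlinearity (w x) * cutoff r x)"
  unfolding wave_defect_def
  by (intro Bochner_Integration.integral_add integrable_power_nonlinearity_cutoff assms
      integrable_Hdot1_test[OF assms(1) test_function_laplacian[OF test_function_cutoff[OF assms(2)]]])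

lemma sum_bubbles_pairing_laplacian:
  assumes r: "r > 0" and \<mu>: "\<And>k. k \<in> I \<Longrightarrow> \<mu> k > 0"
  shows "(LINT x|lebesgue. (\<Sum>k\<in>I. bubble (\<mu> k) (y k) x) * laplacian (cutoff r) x)
    = - (\<Sum>k\<in>I. local_mass r (\<mu> k) (y k))"
proof -
  have "(LINT x|lebesgue. (\<Sum>k\<in>I. bubble (\<mu> k) (y k) x) * laplacian (cutoff r) x)
      = (\<Sum>k\<in>I. LINT x|lebesgue. bubble (\<mu> k) (y k) x * laplacian (cutoff r) x)"
    unfolding sum_distrib_right
    by (intro Bochner_Integration.integral_sum integrable_Hdot1_test[OF in_Hdot1_bubble
          test_function_laplacian[OF test_function_cutoff[OF r]]] \<mu>)
  also have "\<dots> = (\<Sum>k\<in>I. - local_mass r (\<mu> k) (y k))"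
    unfolding local_mass_def
    by (intro sum.cong refl bubble_pairing_laplacian \<mu> test_function_cutoff r)
  finally show ?thesis by (simp add: sum_negf)
qed

text \<open>
  On the support of the cut-off all bubbles have comparable size, with ratio \<open>\<delta>\<close>, so the nonlinearity
  of their sum exceeds the sum of the nonlinearities by the factor \<open>1 + \<delta>\<close>. The constant \<open>\<eta>\<close> is chosen
  so that \<open>1 + \<delta> / 2\<close> is left when \<open>u\<close> replaces the sum, and the linear part uses up the 1.
\<close>

lemma wave_defect_lower_bound:
  fixes \<mu> :: "nat \<Rightarrow> real" and y :: "nat \<Rightarrow> real^5"
  assumes I: "finite I" "2 \<le> card I" and r: "r > 0" and \<alpha>: "\<alpha> > 0"
    and \<mu>: "\<And>k. k \<in> I \<Longrightarrow> \<alpha> * r \<le> \<mu> k \<and> \<mu> k \<le> \<beta> * r"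
    and y: "\<And>k. k \<in> I \<Longrightarrow> norm (y k) \<le> \<rho> * r"
    and u: "in_Hdot1 u" and \<epsilon>: "Hdot1_norm (\<lambda>x. u x - (\<Sum>k\<in>I. bubble (\<mu> k) (y k) x)) \<le> \<epsilon>" "\<epsilon> > 0"
    and \<delta>: "\<delta> = (\<alpha> / \<beta>) powr (3/2) * (1 + (5 + \<rho>)\<^sup>2 / (15 * \<alpha>\<^sup>2)) powr (-3/2)"
    and \<eta>: "\<eta> = \<delta> / (2 * (1 + \<delta>))" and C: "C > 0"
      "\<And>a b. \<bar>power_nonlinearity (a + b) - power_nonlinearity a\<bar> \<le> \<eta> * \<bar>a\<bar> powr (7/3) + C * \<bar>b\<bar> powr (7/3)"
  shows "\<delta> / 2 * (\<Sum>k\<in>I. local_mass r (\<mu> k) (y k))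
      - r powr (3/2) * (cutoff_gradient_norm * \<epsilon> + 33 * C * (3 * \<epsilon>) powr (7/3)) \<le> wave_defect r u"
proof -
  define S where "S x = (\<Sum>k\<in>I. bubble (\<mu> k) (y k) x)" for x
  define w where "w x = u x - S x" for x
  define D where "D = (\<Sum>k\<in>I. local_mass r (\<mu> k) (y k))"
  define q where "q = (1 + (5 + \<rho>)\<^sup>2 / (15 * \<alpha>\<^sup>2)) powr (-3/2)"
  have q: "q > 0" unfolding q_def by (simp add: add_pos_nonneg) (smt (verit) divide_nonneg_nonneg zero_le_power2)
  obtain i0 where "i0 \<in> I" using I by fastforce
  then have "\<alpha> * r \<le> \<beta> * r" using \<mu> by force
  then have "\<alpha> \<le> \<beta>" using r by simp
  with \<alpha> have \<beta>: "\<beta> > 0" by linarith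
  have \<mu>0: "\<mu> k > 0" if "k \<in> I" for k
  proof -
    have "0 < \<alpha> * r" using \<alpha> r by simp
    then show ?thesis using \<mu>[OF that] by linarith
  qed
  have \<delta>0: "\<delta> > 0" using \<alpha> \<beta> q by (simp add: \<delta> q_def)
  have H: "in_Hdot1 S" unfolding S_def by (intro in_Hdot1_sum in_Hdot1_bubble \<mu>0)
  have wH: "in_Hdot1 w" unfolding w_def by (rule in_Hdot1_diff[OF u H])
  have w\<epsilon>: "Hdot1_norm w \<le> \<epsilon>" using \<epsilon> by (simp add: w_def[abs_def] S_def)
  have wm: "w \<in> borel_measurable lebesgue" "integrable lebesgue (\<lambda>x. \<bar>w x\<bar> powr (10/3))"
    using wH by (auto simp: in_Hdot1_def in_Lp_def)
  have super: "(1 + \<delta>) * (\<Sum>k\<in>I. bubble (\<mu> k) (y k) x powr (7/3)) \<le> S x powr (7/3)"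
    if x: "norm x \<le> 5 * r" for x
  proof -
    have "(1 + (\<beta> * r) powr (-3/2) * q / (\<alpha> * r) powr (-3/2)) * (\<Sum>k\<in>I. bubble (\<mu> k) (y k) x powr (7/3)) \<le> S x powr (7/3)"
      unfolding S_def
    proof (rule sum_powr_superadditive[OF I])
      show "0 < (\<beta> * r) powr (-3/2) * q" using \<beta> r q by simp
      fix k assume k: "k \<in> I"
      have b: "bubble (\<mu> k) (y k) x = \<mu> k powr (-3/2) * bracket (\<mu> k) (y k) x powr (-3/2)"
        by (rule bubble_eq_bracket[OF \<mu>0[OF k]])
      have "bracket (\<mu> k) (y k) x powr (-3/2) \<le> bracket (\<mu> k) (y k) x powr 0"
        using bracket_ge_1 by (intro powr_mono) auto
      then have b1: "bracket (\<mu> k) (y k) x powr (-3/2) \<le> 1" using bracket_pos[of "\<mu> k" "y k" x] by simp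
      have b2: "q \<le> bracket (\<mu> k) (y k) x powr (-3/2)"
        unfolding q_def using bracket_pos bracket_le_near[OF r _ \<alpha> x y[OF k]] \<mu>[OF k]
        by (intro powr_mono2') auto
      have m1: "(\<beta> * r) powr (-3/2) \<le> \<mu> k powr (-3/2)"
        using \<mu>[OF k] \<mu>0[OF k] by (intro powr_mono2') auto
      have m2: "\<mu> k powr (-3/2) \<le> (\<alpha> * r) powr (-3/2)"
        using \<mu>[OF k] \<alpha> r by (intro powr_mono2') auto
      have "(\<beta> * r) powr (-3/2) * q \<le> bubble (\<mu> k) (y k) x"
        unfolding b using m1 b2 q by (intro mult_mono) auto
      moreover have "bubble (\<mu> k) (y k) x \<le> (\<alpha> * r) powr (-3/2) * 1"
        unfolding b using m2 b1 by (intro mult_mono) auto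
      ultimately show "(\<beta> * r) powr (-3/2) * q \<le> bubble (\<mu> k) (y k) x \<and> bubble (\<mu> k) (y k) x \<le> (\<alpha> * r) powr (-3/2)"
        by simp
    qed
    moreover have "(\<beta> * r) powr (-3/2) * q / (\<alpha> * r) powr (-3/2) = \<delta>"
    proof -
      have "(\<beta> * r) powr (-3/2) / (\<alpha> * r) powr (-3/2) = (\<beta> / \<alpha>) powr (-3/2)"
        using r by (simp add: powr_divide[symmetric])
      also have "\<dots> = (\<alpha> / \<beta>) powr (3/2)"
        using \<alpha> \<beta> powr_minus[of "\<beta> / \<alpha>" "3/2"] by (simp add: powr_divide)
      finally have "(\<beta> * r) powr (-3/2) / (\<alpha> * r) powr (-3/2) * q = \<delta>" by (simp only: \<delta> q_def)
      then show ?thesis by (simp only: times_divide_eq_left)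
    qed
    ultimately show ?thesis by simp
  qed
  have S0: "0 \<le> S x" for x
    unfolding S_def by (intro sum_nonneg) (simp add: bubble_def W_def)
  have pt: "((1 + \<delta> / 2) * (\<Sum>k\<in>I. bubble (\<mu> k) (y k) x powr (7/3)) - C * \<bar>w x\<bar> powr (7/3)) * cutoff r x
      \<le> power_nonlinearity (u x) * cutoff r x" for x
  proof (cases "cutoff r x = 0")
    case False
    have "\<eta> \<le> 1" "(1 - \<eta>) * (1 + \<delta>) = 1 + \<delta> / 2"
      using \<delta>0 by (simp_all add: \<eta> field_simps)
    note \<eta>1 = this
    have S73: "power_nonlinearity (S x) = S x powr (7/3)"
    proof (cases "S x = 0")
      case False
      then show ?thesis using S0[of x] by (intro power_nonlinearity_pos) linarith
    qed (simp add: power_nonlinearity_def)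
    have "\<bar>power_nonlinearity (S x + w x) - power_nonlinearity (S x)\<bar> \<le> \<eta> * S x powr (7/3) + C * \<bar>w x\<bar> powr (7/3)"
      using C(2)[of "S x" "w x"] S0[of x] by simp
    then have "(1 - \<eta>) * S x powr (7/3) - C * \<bar>w x\<bar> powr (7/3) \<le> power_nonlinearity (u x)"
      unfolding S73 by (simp add: w_def left_diff_distrib abs_le_iff)
    moreover have "(1 - \<eta>) * ((1 + \<delta>) * (\<Sum>k\<in>I. bubble (\<mu> k) (y k) x powr (7/3))) \<le> (1 - \<eta>) * S x powr (7/3)"
      using \<eta>1 by (intro mult_left_mono super cutoff_norm[OF r False]) auto
    ultimately have "(1 + \<delta> / 2) * (\<Sum>k\<in>I. bubble (\<mu> k) (y k) x powr (7/3)) - C * \<bar>w x\<bar> powr (7/3) \<le> power_nonlinearity (u x)"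
      unfolding mult.assoc[symmetric] \<eta>1(2) by linarith
    then show ?thesis using cutoff_bounds by (intro mult_right_mono)
  qed simp
  have iw: "integrable lebesgue (\<lambda>x. \<bar>w x\<bar> powr (7/3) * cutoff r x)"
    by (rule integrable_power_cutoff(1)[OF wm r])
  have ib: "integrable lebesgue (\<lambda>x. \<Sum>k\<in>I. bubble (\<mu> k) (y k) x powr (7/3) * cutoff r x)"
    by (intro Bochner_Integration.integrable_sum integrable_bubble_powr_cutoff \<mu>0 r)
  have "(LINT x|lebesgue. (1 + \<delta> / 2) * (\<Sum>k\<in>I. bubble (\<mu> k) (y k) x powr (7/3) * cutoff r x)
        - C * (\<bar>w x\<bar> powr (7/3) * cutoff r x)) \<le> (LINT x|lebesgue. power_nonlinearity (u x) * cutoff r x)"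
  proof (rule integral_mono)
    show "integrable lebesgue (\<lambda>x. (1 + \<delta> / 2) * (\<Sum>k\<in>I. bubble (\<mu> k) (y k) x powr (7/3) * cutoff r x)
        - C * (\<bar>w x\<bar> powr (7/3) * cutoff r x))"
      by (intro Bochner_Integration.integrable_diff integrable_mult_right iw ib)
    show "integrable lebesgue (\<lambda>x. power_nonlinearity (u x) * cutoff r x)"
      by (rule integrable_power_nonlinearity_cutoff[OF u r])
    show "(1 + \<delta> / 2) * (\<Sum>k\<in>I. bubble (\<mu> k) (y k) x powr (7/3) * cutoff r x)
        - C * (\<bar>w x\<bar> powr (7/3) * cutoff r x) \<le> power_nonlinearity (u x) * cutoff r x" for x
      using pt[of x] by (simp add: left_diff_distrib sum_distrib_right mult.assoc)
  qed
  also have "(LINT x|lebesgue. (1 + \<delta> / 2) * (\<Sum>k\<in>I. bubble (\<mu> k) (y k) x powr (7/3) * cutoff r x)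
        - C * (\<bar>w x\<bar> powr (7/3) * cutoff r x))
      = (1 + \<delta> / 2) * D - C * (LINT x|lebesgue. \<bar>w x\<bar> powr (7/3) * cutoff r x)"
  proof -
    have "(LINT x|lebesgue. (\<Sum>k\<in>I. bubble (\<mu> k) (y k) x powr (7/3) * cutoff r x)) = D"
      unfolding D_def local_mass_def
      by (intro Bochner_Integration.integral_sum integrable_bubble_powr_cutoff \<mu>0 r)
    then show ?thesis using iw ib by (subst Bochner_Integration.integral_diff) auto
  qed
  finally have nl: "(1 + \<delta> / 2) * D - C * (LINT x|lebesgue. \<bar>w x\<bar> powr (7/3) * cutoff r x)
      \<le> (LINT x|lebesgue. power_nonlinearity (u x) * cutoff r x)" .
  have "C * (LINT x|lebesgue. \<bar>w x\<bar> powr (7/3) * cutoff r x) \<le> C * (r powr (3/2) * (33 * (3 * \<epsilon>) powr (7/3)))"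
    using C(1) by (intro mult_left_mono Hdot1_power_cutoff_bound wH r w\<epsilon> \<epsilon>) auto
  moreover have "- D - r powr (3/2) * (\<epsilon> * cutoff_gradient_norm) \<le> (LINT x|lebesgue. u x * laplacian (cutoff r) x)"
  proof -
    note tl = test_function_laplacian[OF test_function_cutoff[OF r]]
    have "(LINT x|lebesgue. u x * laplacian (cutoff r) x)
        = (LINT x|lebesgue. S x * laplacian (cutoff r) x + w x * laplacian (cutoff r) x)"
      by (simp add: w_def left_diff_distrib)
    also have "\<dots> = (LINT x|lebesgue. S x * laplacian (cutoff r) x) + (LINT x|lebesgue. w x * laplacian (cutoff r) x)"
      by (intro Bochner_Integration.integral_add integrable_Hdot1_test[OF _ tl] H wH)
    also have "(LINT x|lebesgue. S x * laplacian (cutoff r) x) = - D"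
      unfolding S_def D_def by (rule sum_bubbles_pairing_laplacian[OF r \<mu>0])
    finally have "(LINT x|lebesgue. u x * laplacian (cutoff r) x) = - D + (LINT x|lebesgue. w x * laplacian (cutoff r) x)" .
    moreover have "\<bar>LINT x|lebesgue. w x * laplacian (cutoff r) x\<bar> \<le> r powr (3/2) * (\<epsilon> * cutoff_gradient_norm)"
    proof -
      have "r powr (3/2) * (Hdot1_norm w * cutoff_gradient_norm) \<le> r powr (3/2) * (\<epsilon> * cutoff_gradient_norm)"
        by (intro mult_left_mono mult_right_mono w\<epsilon>) (auto simp: cutoff_gradient_norm_def intro!: sum_nonneg Lp_norm_nonneg)
      with Hdot1_laplacian_cutoff_bound[OF wH r] show ?thesis by linarith
    qed
    ultimately show ?thesis by linarith
  qed
  moreover have "C * (r powr (3/2) * (33 * (3 * \<epsilon>) powr (7/3))) + r powr (3/2) * (\<epsilon> * cutoff_gradient_norm)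
      = r powr (3/2) * (cutoff_gradient_norm * \<epsilon> + 33 * C * (3 * \<epsilon>) powr (7/3))"
    by (simp add: algebra_simps)
  moreover have "(1 + \<delta> / 2) * D - D = \<delta> / 2 * D" by (simp add: algebra_simps)
  ultimately show ?thesis
    using nl unfolding wave_defect_eq[OF u r] D_def[symmetric] by linarith
qed

text \<open>
  For \<open>3 * \<epsilon> \<le> 1\<close> the power term is at most linear in \<open>\<epsilon>\<close>.
\<close>

lemma small_epsilon_exists:
  fixes A B c :: real
  assumes "0 \<le> A" "0 \<le> B" "0 < c"
  obtains \<epsilon> where "\<epsilon> > 0" "A * \<epsilon> + B * (3 * \<epsilon>) powr (7/3) < c"
proof -
  define \<epsilon> where "\<epsilon> = min (1/3) (c / (2 * (A + 3 * B + 1)))"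
  have \<epsilon>: "\<epsilon> > 0" "3 * \<epsilon> \<le> 1" using assms by (auto simp: \<epsilon>_def)
  have "(3 * \<epsilon>) powr (7/3) \<le> (3 * \<epsilon>) powr 1"
    using \<epsilon> by (intro powr_mono') auto
  then have "B * (3 * \<epsilon>) powr (7/3) \<le> B * (3 * \<epsilon>)" using \<epsilon> assms by (intro mult_left_mono) auto
  then have "A * \<epsilon> + B * (3 * \<epsilon>) powr (7/3) \<le> (A + 3 * B + 1) * \<epsilon>"
    using \<epsilon> by (simp add: algebra_simps)
  also have "\<dots> \<le> (A + 3 * B + 1) * (c / (2 * (A + 3 * B + 1)))"
    using assms by (intro mult_left_mono) (auto simp: \<epsilon>_def)
  also have "\<dots> = c / 2"
  proof -
    have "d * (c / (2 * d)) = c / 2" if "d > 0" for d :: real using that by simp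
    then show ?thesis using assms by (simp only: add_nonneg_pos)
  qed
  also have "\<dots> < c" using assms by simp
  finally show ?thesis using \<epsilon>(1) that by blast
qed

lemma cutoff_gradient_norm_nonneg: "0 \<le> cutoff_gradient_norm"
  by (auto simp: cutoff_gradient_norm_def intro!: sum_nonneg Lp_norm_nonneg)

lemma continuous_on_pairing_laplacian:
  assumes u: "\<And>t. t \<in> J \<Longrightarrow> in_Hdot1 (u t)" and r: "r > 0"
    and cont: "\<And>t. t \<in> J \<Longrightarrow> ((\<lambda>s. Hdot1_norm (\<lambda>x. u s x - u t x)) \<longlongrightarrow> 0) (at t within J)"
  shows "continuous_on J (\<lambda>t. LINT x|lebesgue. u t x * laplacian (cutoff r) x)"
  unfolding continuous_on_def
proof
  fix t assume t: "t \<in> J"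
  note tl = test_function_laplacian[OF test_function_cutoff[OF r]]
  have "((\<lambda>s. (LINT x|lebesgue. u s x * laplacian (cutoff r) x) - (LINT x|lebesgue. u t x * laplacian (cutoff r) x)) \<longlongrightarrow> 0) (at t within J)"
  proof (rule Lim_null_comparison)
    show "((\<lambda>s. r powr (3/2) * (Hdot1_norm (\<lambda>x. u s x - u t x) * cutoff_gradient_norm)) \<longlongrightarrow> 0) (at t within J)"
      using tendsto_mult_right_zero[OF tendsto_mult_left_zero[OF cont[OF t]]] .
    have "\<forall>\<^sub>F s in at t within J. s \<in> J"
      by (simp add: eventually_at_filter)
    then show "\<forall>\<^sub>F s in at t within J. norm ((LINT x|lebesgue. u s x * laplacian (cutoff r) x) - (LINT x|lebesgue. u t x * laplacian (cutoff r) x))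
        \<le> r powr (3/2) * (Hdot1_norm (\<lambda>x. u s x - u t x) * cutoff_gradient_norm)"
    proof eventually_elim
      case (elim s)
      have "(LINT x|lebesgue. u s x * laplacian (cutoff r) x) - (LINT x|lebesgue. u t x * laplacian (cutoff r) x)
          = (LINT x|lebesgue. (u s x - u t x) * laplacian (cutoff r) x)"
        unfolding left_diff_distrib
        by (intro Bochner_Integration.integral_diff[symmetric] integrable_Hdot1_test[OF _ tl] u t elim)
      with Hdot1_laplacian_cutoff_bound[OF in_Hdot1_diff[OF u[OF elim] u[OF t]] r] show ?case by simp
    qed
  qed
  then show "((\<lambda>s. LINT x|lebesgue. u s x * laplacian (cutoff r) x) \<longlongrightarrow> (LINT x|lebesgue. u t x * laplacian (cutoff r) x)) (at t within J)"
    by (simp add: LIM_zero_iff)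
qed

text \<open>
  Continuity in time is needed to integrate lower bounds: the Bochner integral of a function that is
  not integrable is 0, which would make the tested equation void.
\<close>

lemma continuous_on_nonlinear_pairing:
  assumes u: "\<And>t. t \<in> J \<Longrightarrow> in_Hdot1 (u t)" and r: "r > 0"
    and cont: "\<And>t. t \<in> J \<Longrightarrow> ((\<lambda>s. Hdot1_norm (\<lambda>x. u s x - u t x)) \<longlongrightarrow> 0) (at t within J)"
  shows "continuous_on J (\<lambda>t. LINT x|lebesgue. power_nonlinearity (u t x) * cutoff r x)"
  unfolding continuous_on_def
proof
  fix t assume t: "t \<in> J"
  define X where "X = (LINT x|lebesgue. \<bar>u t x\<bar> powr (7/3) * cutoff r x)"
  have ut: "u t \<in> borel_measurable lebesgue" "integrable lebesgue (\<lambda>x. \<bar>u t x\<bar> powr (10/3))"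
    using u[OF t] by (auto simp: in_Hdot1_def in_Lp_def)
  have X0: "0 \<le> X" unfolding X_def by (intro integral_nonneg_AE AE_I2 mult_nonneg_nonneg cutoff_bounds) auto
  show "((\<lambda>s. LINT x|lebesgue. power_nonlinearity (u s x) * cutoff r x) \<longlongrightarrow> (LINT x|lebesgue. power_nonlinearity (u t x) * cutoff r x)) (at t within J)"
  proof (rule tendstoI)
    fix e :: real assume e: "0 < e"
    define \<eta> where "\<eta> = e / (2 * (X + 1))"
    have \<eta>: "\<eta> > 0" using e X0 by (simp add: \<eta>_def)
    have \<eta>X: "\<eta> * X \<le> e / 2" using e X0 by (simp add: \<eta>_def field_simps)
    obtain C where C: "C > 0"
      "\<And>a b. \<bar>power_nonlinearity (a + b) - power_nonlinearity a\<bar> \<le> \<eta> * \<bar>a\<bar> powr (7/3) + C * \<bar>b\<bar> powr (7/3)"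
      using power_nonlinearity_perturbation[OF \<eta>] by metis
    obtain \<epsilon> where \<epsilon>: "\<epsilon> > 0" "0 * \<epsilon> + (C * r powr (3/2) * 33) * (3 * \<epsilon>) powr (7/3) < e / 2"
      using small_epsilon_exists[of 0 "C * r powr (3/2) * 33" "e / 2"] C(1) e by auto
    have "\<forall>\<^sub>F s in at t within J. s \<in> J"
      by (simp add: eventually_at_filter)
    moreover have "\<forall>\<^sub>F s in at t within J. dist (Hdot1_norm (\<lambda>x. u s x - u t x)) 0 < \<epsilon>"
      by (rule tendstoD[OF cont[OF t] \<epsilon>(1)])
    ultimately show "\<forall>\<^sub>F s in at t within J. dist (LINT x|lebesgue. power_nonlinearity (u s x) * cutoff r x)
        (LINT x|lebesgue. power_nonlinearity (u t x) * cutoff r x) < e"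
    proof eventually_elim
      case (elim s)
      define w where "w x = u s x - u t x" for x
      have wH: "in_Hdot1 w" unfolding w_def by (rule in_Hdot1_diff[OF u[OF elim(1)] u[OF t]])
      have wm: "w \<in> borel_measurable lebesgue" "integrable lebesgue (\<lambda>x. \<bar>w x\<bar> powr (10/3))"
        using wH by (auto simp: in_Hdot1_def in_Lp_def)
      have w\<epsilon>: "Hdot1_norm w \<le> \<epsilon>" using elim(2) by (simp add: w_def[abs_def] dist_real_def)
      have i1: "integrable lebesgue (\<lambda>x. power_nonlinearity (u s x) * cutoff r x)"
        and i2: "integrable lebesgue (\<lambda>x. power_nonlinearity (u t x) * cutoff r x)"
        by (intro integrable_power_nonlinearity_cutoff u elim t r)+
      have "\<bar>(LINT x|lebesgue. power_nonlinearity (u s x) * cutoff r x) - (LINT x|lebesgue. power_nonlinearity (u t x) * cutoff r x)\<bar>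
          = \<bar>LINT x|lebesgue. power_nonlinearity (u s x) * cutoff r x - power_nonlinearity (u t x) * cutoff r x\<bar>"
        by (simp add: Bochner_Integration.integral_diff[OF i1 i2])
      also have "\<dots> \<le> (LINT x|lebesgue. \<bar>power_nonlinearity (u s x) * cutoff r x - power_nonlinearity (u t x) * cutoff r x\<bar>)"
        by (rule integral_abs_bound)
      also have "\<dots> \<le> (LINT x|lebesgue. \<eta> * (\<bar>u t x\<bar> powr (7/3) * cutoff r x) + C * (\<bar>w x\<bar> powr (7/3) * cutoff r x))"
      proof (rule integral_mono)
        show "integrable lebesgue (\<lambda>x. \<bar>power_nonlinearity (u s x) * cutoff r x - power_nonlinearity (u t x) * cutoff r x\<bar>)"
          using i1 i2 by simp
        show "integrable lebesgue (\<lambda>x. \<eta> * (\<bar>u t x\<bar> powr (7/3) * cutoff r x) + C * (\<bar>w x\<bar> powr (7/3) * cutoff r x))"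
          by (intro Bochner_Integration.integrable_add integrable_mult_right integrable_power_cutoff(1) ut wm r)
        fix x
        have "\<bar>power_nonlinearity (u s x) * cutoff r x - power_nonlinearity (u t x) * cutoff r x\<bar>
            = \<bar>power_nonlinearity (u t x + w x) - power_nonlinearity (u t x)\<bar> * cutoff r x"
          using cutoff_bounds(1)[of r x] by (simp add: w_def left_diff_distrib[symmetric] abs_mult)
        also have "\<dots> \<le> (\<eta> * \<bar>u t x\<bar> powr (7/3) + C * \<bar>w x\<bar> powr (7/3)) * cutoff r x"
          by (intro mult_right_mono C cutoff_bounds)
        finally show "\<bar>power_nonlinearity (u s x) * cutoff r x - power_nonlinearity (u t x) * cutoff r x\<bar>
            \<le> \<eta> * (\<bar>u t x\<bar> powr (7/3) * cutoff r x) + C * (\<bar>w x\<bar> powr (7/3) * cutoff r x)"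
          by (simp add: algebra_simps)
      qed
      also have "\<dots> = \<eta> * X + C * (LINT x|lebesgue. \<bar>w x\<bar> powr (7/3) * cutoff r x)"
        unfolding X_def using integrable_power_cutoff(1)[OF ut r] integrable_power_cutoff(1)[OF wm r]
        by (subst Bochner_Integration.integral_add) auto
      also have "\<dots> \<le> e / 2 + C * (r powr (3/2) * (33 * (3 * \<epsilon>) powr (7/3)))"
        using C(1) by (intro add_mono \<eta>X mult_left_mono Hdot1_power_cutoff_bound wH r w\<epsilon> \<epsilon>) auto
      also have "\<dots> < e" using \<epsilon>(2) by (simp add: ac_simps)
      finally show ?case by (simp add: dist_real_def)
    qed
  qed
qed

lemma test_function_tensor:
  fixes \<theta> :: "real \<Rightarrow> real" and \<psi> :: "real^5 \<Rightarrow> real"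
  assumes \<theta>: "smooth \<theta>" "\<And>t. t \<notin> {a..b} \<Longrightarrow> \<theta> t = 0" and "0 < a" and \<psi>: "test_function UNIV \<psi>"
  shows "test_function (interior {0..} \<times> UNIV) (\<lambda>p. \<theta> (fst p) * \<psi> (snd p))"
proof -
  obtain C where C: "compact C" "\<And>x. x \<notin> C \<Longrightarrow> \<psi> x = 0"
    using test_function_support[OF \<psi>] by metis
  show ?thesis
  proof (rule test_functionI[where C = "{a..b} \<times> C"])
    show "smooth (\<lambda>p. \<theta> (fst p) * \<psi> (snd p))"
      using \<psi> by (intro smooth_mult smooth_linear[OF linear_fst] smooth_linear[OF linear_snd] \<theta>(1))
        (simp add: test_function_def)
    show "compact ({a..b} \<times> C)" by (intro compact_Times C compact_Icc)
    show "{a..b} \<times> C \<subseteq> interior {0..} \<times> UNIV"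
      using \<open>0 < a\<close> by (auto simp: interior_real_atLeast)
    show "\<theta> (fst p) * \<psi> (snd p) = 0" if "p \<notin> {a..b} \<times> C" for p
    proof -
      have "fst p \<notin> {a..b} \<or> snd p \<notin> C" using that by (cases p) auto
      then show ?thesis using \<theta>(2)[of "fst p"] C(2)[of "snd p"] by auto
    qed
  qed
qed

lemma dir_deriv_tensor:
  fixes \<theta> :: "real \<Rightarrow> real" and \<psi> :: "real^5 \<Rightarrow> real"
  assumes \<theta>: "\<And>t. \<theta> differentiable (at t)" and \<psi>: "\<And>x. \<psi> differentiable (at x)"
  shows "dir_deriv (1, 0) (\<lambda>p. \<theta> (fst p) * \<psi> (snd p)) = (\<lambda>p. dir_deriv 1 \<theta> (fst p) * \<psi> (snd p))"
    and "dir_deriv (0, b) (\<lambda>p. \<theta> (fst p) * \<psi> (snd p)) = (\<lambda>p. \<theta> (fst p) * dir_deriv b \<psi> (snd p))"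
proof -
  have "((\<lambda>p. \<theta> (fst p) * \<psi> (snd p)) has_derivative
      (\<lambda>h. \<theta> (fst p) * dir_deriv (snd h) \<psi> (snd p) + dir_deriv (fst h) \<theta> (fst p) * \<psi> (snd p))) (at p)" for p
    using has_derivative_mult[OF has_derivative_affine[OF linear_fst, of \<theta> 0 p] has_derivative_affine[OF linear_snd, of \<psi> 0 p]]
      \<theta> \<psi> by simp
  note d = dir_deriv_eq[OF this]
  have "dir_deriv 0 \<psi> x = 0" for x
    using linear_0[OF has_derivative_linear[OF has_derivative_dir_deriv[OF \<psi>]]] .
  then show "dir_deriv (1, 0) (\<lambda>p. \<theta> (fst p) * \<psi> (snd p)) = (\<lambda>p. dir_deriv 1 \<theta> (fst p) * \<psi> (snd p))"
    by (auto simp: d)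
  have "dir_deriv 0 \<theta> x = 0" for x
    using linear_0[OF has_derivative_linear[OF has_derivative_dir_deriv[OF \<theta>]]] .
  then show "dir_deriv (0, b) (\<lambda>p. \<theta> (fst p) * \<psi> (snd p)) = (\<lambda>p. \<theta> (fst p) * dir_deriv b \<psi> (snd p))"
    by (auto simp: d)
qed

lemma space_laplacian_tensor:
  assumes \<theta>: "smooth \<theta>" and \<psi>: "smooth \<psi>"
  shows "space_laplacian (\<lambda>p. \<theta> (fst p) * \<psi> (snd p)) (t, x) = \<theta> t * laplacian \<psi> x"
proof -
  note d\<theta> = smooth_imp_differentiable[OF \<theta>]
  have "dir_deriv (0, b) (dir_deriv (0, b) (\<lambda>p. \<theta> (fst p) * \<psi> (snd p))) (t, x) = \<theta> t * dir_deriv b (dir_deriv b \<psi>) x"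
    if b: "b \<in> Basis" for b
    unfolding dir_deriv_tensor(2)[OF d\<theta> smooth_imp_differentiable[OF \<psi>]]
      dir_deriv_tensor(2)[OF d\<theta> smooth_imp_differentiable[OF smooth_dir_deriv[OF \<psi> b]]] by simp
  then show ?thesis
    by (simp add: space_laplacian_def laplacian_def sum_distrib_left)
qed

section \<open>Testing the wave equation\<close>

text \<open>
  The first relation of the definition of solutions, tested with a product.
\<close>

lemma weak_time_derivative:
  assumes sol: "energy_wave_solution {0..} u v" and \<psi>: "test_function UNIV \<psi>"
    and \<theta>: "smooth \<theta>" "\<And>t. t \<notin> {a..b} \<Longrightarrow> \<theta> t = 0" and a: "0 < a"
  shows "(LINT t|lebesgue. (LINT x|lebesgue. u t x * \<psi> x) * dir_deriv 1 \<theta> t)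
    = - (LINT t|lebesgue. (LINT x|lebesgue. v t x * \<psi> x) * \<theta> t)"
proof -
  define \<phi> where "\<phi> = (\<lambda>p. \<theta> (fst p) * \<psi> (snd p))"
  have t: "test_function (interior {0..} \<times> UNIV) \<phi>"
    unfolding \<phi>_def by (rule test_function_tensor[OF \<theta> a \<psi>])
  have \<psi>s: "smooth \<psi>" using \<psi> by (simp add: test_function_def)
  have d: "time_deriv \<phi> = (\<lambda>p. dir_deriv 1 \<theta> (fst p) * \<psi> (snd p))"
    unfolding time_deriv_def \<phi>_def
    by (rule dir_deriv_tensor(1)[OF smooth_imp_differentiable[OF \<theta>(1)] smooth_imp_differentiable[OF \<psi>s]])
  have "(LINT t|lebesgue. LINT x|lebesgue. u t x * time_deriv \<phi> (t, x))
      = - (LINT t|lebesgue. LINT x|lebesgue. v t x * \<phi> (t, x))"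
    using sol t unfolding energy_wave_solution_def by blast
  moreover have "(LINT x|lebesgue. u t x * time_deriv \<phi> (t, x)) = (LINT x|lebesgue. u t x * \<psi> x) * dir_deriv 1 \<theta> t" for t
  proof -
    have "u t x * time_deriv \<phi> (t, x) = (u t x * \<psi> x) * dir_deriv 1 \<theta> t" for x by (simp add: d)
    then show ?thesis by (simp only: integral_mult_left_zero)
  qed
  moreover have "(LINT x|lebesgue. v t x * \<phi> (t, x)) = (LINT x|lebesgue. v t x * \<psi> x) * \<theta> t" for t
  proof -
    have "v t x * \<phi> (t, x) = (v t x * \<psi> x) * \<theta> t" for x by (simp add: \<phi>_def)
    then show ?thesis by (simp only: integral_mult_left_zero)
  qed
  ultimately show ?thesis by (simp only:)
qed

text \<open>
  Replacing \<open>\<phi>\<close> by its time derivative in the relation between \<open>u\<close> and \<open>v\<close> removes one of the two time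
  derivatives in the wave equation.
\<close>

lemma wave_equation_tested:
  assumes sol: "energy_wave_solution {0..} u v" and r: "r > 0"
    and \<theta>: "smooth \<theta>" "\<And>t. t \<notin> {a..b} \<Longrightarrow> \<theta> t = 0" and a: "0 < a"
  shows "(LINT t|lebesgue. \<theta> t * wave_defect r (u t))
    = - (LINT t|lebesgue. (LINT x|lebesgue. v t x * cutoff r x) * dir_deriv 1 \<theta> t)"
proof -
  note \<psi> = test_function_cutoff[OF r]
  define \<phi> where "\<phi> = (\<lambda>p. \<theta> (fst p) * cutoff r (snd p))"
  have t: "test_function (interior {0..} \<times> UNIV) \<phi>"
    unfolding \<phi>_def by (rule test_function_tensor[OF \<theta> a \<psi>])
  have b10: "(1, 0) \<in> (Basis :: (real \<times> (real^5)) set)" by (auto simp: Basis_prod_def)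
  have d: "time_deriv \<phi> = (\<lambda>p. dir_deriv 1 \<theta> (fst p) * cutoff r (snd p))"
    unfolding time_deriv_def \<phi>_def
    by (rule dir_deriv_tensor(1)[OF smooth_imp_differentiable[OF \<theta>(1)] smooth_imp_differentiable[OF smooth_cutoff]])
  have t': "test_function (interior {0..} \<times> UNIV) (time_deriv \<phi>)"
    unfolding time_deriv_def by (rule test_function_dir_deriv[OF t b10])
  have "(LINT t|lebesgue. LINT x|lebesgue. u t x * time_deriv (time_deriv \<phi>) (t, x))
      = - (LINT t|lebesgue. LINT x|lebesgue. v t x * time_deriv \<phi> (t, x))"
    using sol t' unfolding energy_wave_solution_def by blast
  moreover have "(LINT t|lebesgue. LINT x|lebesgue. u t x * time_deriv (time_deriv \<phi>) (t, x))
      = (LINT t|lebesgue. LINT x|lebesgue.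
               u t x * space_laplacian \<phi> (t, x) + \<bar>u t x\<bar> powr (4/3) * u t x * \<phi> (t, x))"
    using sol t unfolding energy_wave_solution_def by blast
  moreover have "(LINT x|lebesgue. u t x * space_laplacian \<phi> (t, x) + \<bar>u t x\<bar> powr (4/3) * u t x * \<phi> (t, x))
      = \<theta> t * wave_defect r (u t)" for t
  proof -
    have "u t x * space_laplacian \<phi> (t, x) + \<bar>u t x\<bar> powr (4/3) * u t x * \<phi> (t, x)
        = \<theta> t * (u t x * laplacian (cutoff r) x + power_nonlinearity (u t x) * cutoff r x)" for x
      unfolding \<phi>_def space_laplacian_tensor[OF \<theta>(1) smooth_cutoff] power_nonlinearity_def
      by (simp add: algebra_simps)
    then show ?thesis unfolding wave_defect_def by (simp only: integral_mult_right_zero)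
  qed
  moreover have "(LINT x|lebesgue. v t x * time_deriv \<phi> (t, x)) = (LINT x|lebesgue. v t x * cutoff r x) * dir_deriv 1 \<theta> t" for t
  proof -
    have "v t x * time_deriv \<phi> (t, x) = (v t x * cutoff r x) * dir_deriv 1 \<theta> t" for x by (simp add: d)
    then show ?thesis by (simp only: integral_mult_left_zero)
  qed
  ultimately show ?thesis by (simp only:)
qed

text \<open>
  The pairing of \<open>u\<close> with a fixed test function has the weak time derivative given by the pairing with
  \<open>v\<close>, which is small in \<open>L\<^sup>2\<close>.
\<close>

lemma pairing_laplacian_increment:
  assumes sol: "energy_wave_solution {0..} u v" and r: "r > 0" and t: "0 < t" "t \<le> s"
    and v: "\<And>\<sigma>. \<sigma> \<in> {t..s} \<Longrightarrow> Lp_norm 2 (v \<sigma>) \<le> \<epsilon>"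
  shows "\<bar>(LINT x|lebesgue. u s x * laplacian (cutoff r) x) - (LINT x|lebesgue. u t x * laplacian (cutoff r) x)\<bar>
    \<le> \<epsilon> * (r powr (1/2) * Lp_norm 2 (laplacian (cutoff 1))) * (s - t)"
proof (cases "t = s")
  case False
  then have ts: "t < s" using t by simp
  note tl = test_function_laplacian[OF test_function_cutoff[OF r]]
  show ?thesis
  proof (rule increment_bound_weak_derivative[where h = "\<lambda>\<sigma>. LINT x|lebesgue. v \<sigma> x * laplacian (cutoff r) x", OF ts])
    have "continuous_on {0..} (\<lambda>t. LINT x|lebesgue. u t x * laplacian (cutoff r) x)"
      using sol by (intro continuous_on_pairing_laplacian r) (auto simp: energy_wave_solution_def)
    then show "continuous_on {t..s} (\<lambda>t. LINT x|lebesgue. u t x * laplacian (cutoff r) x)"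
      by (rule continuous_on_subset) (use t in auto)
    fix \<sigma> assume \<sigma>: "\<sigma> \<in> {t..s}"
    have "in_Lp 2 (v \<sigma>)" using sol \<sigma> t by (auto simp: energy_wave_solution_def)
    from L2_test_function_bound[OF this tl]
    have "\<bar>LINT x|lebesgue. v \<sigma> x * laplacian (cutoff r) x\<bar> \<le> Lp_norm 2 (v \<sigma>) * Lp_norm 2 (laplacian (cutoff r))" .
    also have "\<dots> \<le> \<epsilon> * Lp_norm 2 (laplacian (cutoff r))"
      by (intro mult_right_mono v \<sigma> Lp_norm_nonneg)
    finally show "\<bar>LINT x|lebesgue. v \<sigma> x * laplacian (cutoff r) x\<bar> \<le> \<epsilon> * (r powr (1/2) * Lp_norm 2 (laplacian (cutoff 1)))"
      by (simp only: Lp_norm_laplacian_cutoff[OF r])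
  qed (rule weak_time_derivative[OF sol tl _ _ t(1)])
qed simp

text \<open>
  The time cut-off \<open>\<theta>\<close> lives on the window \<open>{t..t + r}\<close>. Its integral is of order \<open>r\<close> and so is the
  reciprocal of its derivative; both sides of the tested equation are therefore of order
  \<open>r powr (5/2)\<close>, and the side with \<open>v\<close> carries the factor \<open>\<epsilon>\<close>.
\<close>

lemma time_average_bound:
  assumes sol: "energy_wave_solution {0..} u v" and r: "r > 0" and t: "0 < t"
    and v: "\<And>s. s \<in> {t..t + r} \<Longrightarrow> Lp_norm 2 (v s) \<le> \<epsilon>" and \<epsilon>: "0 < \<epsilon>"
    and low: "\<And>s. s \<in> {t..t + r} \<Longrightarrow> c * r powr (3/2) \<le> wave_defect r (u s)"
    and M: "\<And>s. \<bar>dir_deriv 1 (box_bump 1 0 (1::real)) s\<bar> \<le> M"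
  shows "c * (LINT s|lebesgue. box_bump 1 0 (1::real) s) \<le> M * Lp_norm 2 (cutoff 1) * \<epsilon>"
proof -
  define B where "B = box_bump 1 0 (1::real)"
  define \<theta> where "\<theta> s = B (- (t / r) + inverse r * s)" for s
  have Bs: "smooth B" using test_function_box_bump[of 1 0 "1::real"] by (simp add: B_def test_function_def)
  have lin: "linear (\<lambda>s::real. inverse r * s)" by (auto intro!: linearI simp: algebra_simps)
  have \<theta>s: "smooth \<theta>" unfolding \<theta>_def by (rule smooth_affine[OF lin Bs])
  have arg: "- (t / r) + inverse r * s = (s - t) / r" for s
    by (simp add: divide_inverse algebra_simps)
  have \<theta>0: "\<theta> s = 0" if "s \<notin> {t..t + r}" for s
  proof -
    have "- (t / r) + inverse r * s \<notin> cbox 0 1" using that r by (auto simp: arg field_simps)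
    then show ?thesis unfolding \<theta>_def B_def by (rule box_bump_outside)
  qed
  have \<theta>n: "0 \<le> \<theta> s" for s by (simp add: \<theta>_def B_def box_bump_bounds)
  have d\<theta>: "\<bar>dir_deriv 1 \<theta> s\<bar> \<le> M / r * indicator {t..t + r} s" for s
  proof (cases "s \<in> {t..t + r}")
    case True
    have "dir_deriv 1 \<theta> s = dir_deriv (inverse r * 1) B (- (t / r) + inverse r * s)"
      unfolding \<theta>_def by (rule dir_deriv_affine[OF lin smooth_imp_differentiable[OF Bs]])
    also have "\<dots> = inverse r * dir_deriv 1 B (- (t / r) + inverse r * s)"
      using linear_scale[OF has_derivative_linear[OF has_derivative_dir_deriv[OF smooth_imp_differentiable[OF Bs]]], of "inverse r" 1]
      by simp
    finally show ?thesis using True M[of "- (t / r) + inverse r * s"] r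
      by (simp add: abs_mult B_def divide_inverse mult.commute mult_left_mono)
  next
    case False
    have "closure {s. \<theta> s \<noteq> 0} \<subseteq> {t..t + r}"
      using \<theta>0 by (intro closure_minimal closed_atLeastAtMost) blast
    then have "dir_deriv 1 \<theta> s = 0" using False by (intro dir_deriv_outside_support) auto
    then show ?thesis using False by simp
  qed
  have cw: "continuous_on {0..} (\<lambda>s. wave_defect r (u s))"
  proof -
    have "continuous_on {0..} (\<lambda>s. (LINT x|lebesgue. u s x * laplacian (cutoff r) x)
        + (LINT x|lebesgue. power_nonlinearity (u s x) * cutoff r x))"
      using sol by (intro continuous_on_add continuous_on_pairing_laplacian continuous_on_nonlinear_pairing r)
        (auto simp: energy_wave_solution_def)
    then show ?thesis
      by (rule continuous_on_cong[THEN iffD1, rotated -1, OF _ refl])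
         (use sol r in \<open>auto simp: energy_wave_solution_def wave_defect_eq\<close>)
  qed
  have ind: "integrable lebesgue (\<lambda>s. k * indicator {t..t + r} s)" for k :: real
    by (intro integrable_mult_right integrable_real_indicator) (auto simp: emeasure_lborel_Icc_eq)
  have i\<theta>: "integrable lebesgue \<theta>"
  proof -
    have "integrable lborel \<theta>"
      by (rule integrable_compact_support[OF smooth_imp_continuous_on[OF \<theta>s] compact_Icc \<theta>0])
    then show ?thesis by (simp add: integrable_completion borel_measurable_integrable)
  qed
  have i\<theta>w: "integrable lebesgue (\<lambda>s. \<theta> s * wave_defect r (u s))"
  proof -
    have "integrable lborel (\<lambda>s. indicator {t..t + r} s *\<^sub>R (\<theta> s * wave_defect r (u s)))"
      using t by (intro borel_integrable_compact continuous_on_mult smooth_imp_continuous_on[OF \<theta>s]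
          continuous_on_subset[OF cw]) auto
    also have "(\<lambda>s. indicator {t..t + r} s *\<^sub>R (\<theta> s * wave_defect r (u s))) = (\<lambda>s. \<theta> s * wave_defect r (u s))"
    proof
      show "indicator {t..t + r} s *\<^sub>R (\<theta> s * wave_defect r (u s)) = \<theta> s * wave_defect r (u s)" for s
        using \<theta>0[of s] by (cases "s \<in> {t..t + r}") (simp_all only: indicator_simps, simp_all)
    qed
    finally show ?thesis by (simp add: integrable_completion borel_measurable_integrable)
  qed
  have \<theta>int: "(LINT s|lebesgue. \<theta> s) = r * (LINT s|lebesgue. B s)"
  proof -
    have [measurable]: "B \<in> borel_measurable borel" "\<theta> \<in> borel_measurable borel"
      using Bs \<theta>s by (auto intro: smooth_borel_measurable)
    have "(LINT s|lborel. B s) = \<bar>inverse r\<bar> *\<^sub>R (LINT s|lborel. B (- (t / r) + inverse r * s))"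
      by (rule lborel_integral_real_affine) (use r in simp)
    then have "(LINT s|lborel. \<theta> s) = r * (LINT s|lborel. B s)"
      using r by (simp add: \<theta>_def[abs_def] field_simps)
    moreover have "(LINT s|lborel. \<theta> s) = (LINT s|lebesgue. \<theta> s)" "(LINT s|lborel. B s) = (LINT s|lebesgue. B s)"
      by (simp_all add: integral_completion)
    ultimately show ?thesis by simp
  qed
  have "c * r powr (3/2) * (r * (LINT s|lebesgue. B s)) = (LINT s|lebesgue. c * r powr (3/2) * \<theta> s)"
    by (simp add: \<theta>int)
  also have "\<dots> \<le> (LINT s|lebesgue. \<theta> s * wave_defect r (u s))"
  proof (rule integral_mono[OF integrable_mult_right[OF i\<theta>] i\<theta>w])
    fix s
    show "c * r powr (3/2) * \<theta> s \<le> \<theta> s * wave_defect r (u s)"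
    proof (cases "s \<in> {t..t + r}")
      case True
      show ?thesis using mult_right_mono[OF low[OF True] \<theta>n[of s]] by (simp add: mult.commute)
    qed (simp add: \<theta>0)
  qed
  also have "\<dots> = - (LINT s|lebesgue. (LINT x|lebesgue. v s x * cutoff r x) * dir_deriv 1 \<theta> s)"
    by (rule wave_equation_tested[OF sol r \<theta>s \<theta>0 t])
  also have "\<dots> \<le> (LINT s|lebesgue. norm ((LINT x|lebesgue. v s x * cutoff r x) * dir_deriv 1 \<theta> s))"
    using integral_norm_bound[of lebesgue "\<lambda>s. (LINT x|lebesgue. v s x * cutoff r x) * dir_deriv 1 \<theta> s"]
    unfolding real_norm_def by linarith
  also have "\<dots> \<le> (LINT s|lebesgue. (\<epsilon> * (r powr (5/2) * Lp_norm 2 (cutoff 1))) * (M / r) * indicator {t..t + r} s)"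
  proof (rule integral_mono'[OF ind])
    have M0: "0 \<le> M" using M[of 0] by linarith
    fix s
    show "0 \<le> (\<epsilon> * (r powr (5/2) * Lp_norm 2 (cutoff 1))) * (M / r) * indicator {t..t + r} s"
      using \<epsilon> r M0 by (simp add: Lp_norm_nonneg)
    show "norm ((LINT x|lebesgue. v s x * cutoff r x) * dir_deriv 1 \<theta> s)
        \<le> (\<epsilon> * (r powr (5/2) * Lp_norm 2 (cutoff 1))) * (M / r) * indicator {t..t + r} s"
    proof (cases "s \<in> {t..t + r}")
      case True
      have "in_Lp 2 (v s)" using sol True t by (auto simp: energy_wave_solution_def)
      from L2_test_function_bound[OF this test_function_cutoff[OF r]]
      have "\<bar>LINT x|lebesgue. v s x * cutoff r x\<bar> \<le> Lp_norm 2 (v s) * Lp_norm 2 (cutoff r)" .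
      also have "\<dots> \<le> \<epsilon> * Lp_norm 2 (cutoff r)"
        by (intro mult_right_mono v True Lp_norm_nonneg)
      also have "\<dots> = \<epsilon> * (r powr (5/2) * Lp_norm 2 (cutoff 1))" by (simp only: Lp_norm_cutoff[OF r])
      finally have "\<bar>LINT x|lebesgue. v s x * cutoff r x\<bar> * \<bar>dir_deriv 1 \<theta> s\<bar>
          \<le> \<epsilon> * (r powr (5/2) * Lp_norm 2 (cutoff 1)) * (M / r)"
        using d\<theta>[of s] True \<epsilon> by (intro mult_mono) (auto simp: Lp_norm_nonneg)
      then show ?thesis using True by (simp add: abs_mult)
    next
      case False
      then have "dir_deriv 1 \<theta> s = 0" using d\<theta>[of s] by simp
      then show ?thesis using False by simp
    qed
  qed
  also have "\<dots> = (\<epsilon> * (r powr (5/2) * Lp_norm 2 (cutoff 1))) * M"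
    using r by simp
  finally have "c * r powr (3/2) * (r * (LINT s|lebesgue. B s)) \<le> \<epsilon> * (r powr (5/2) * Lp_norm 2 (cutoff 1)) * M" .
  moreover have "r powr (5/2) = r powr (3/2) * r"
  proof -
    have "r powr (5/2) = r powr (3/2) * r powr 1" unfolding powr_add[symmetric] by simp
    then show ?thesis using r by simp
  qed
  ultimately have "(r powr (3/2) * r) * (c * (LINT s|lebesgue. B s)) \<le> (r powr (3/2) * r) * (M * Lp_norm 2 (cutoff 1) * \<epsilon>)"
    by (simp add: ac_simps)
  then show ?thesis using r by (simp add: B_def)
qed

text \<open>
  The comparability of the scales reduces the claim to the first one. If that scale does not tend to
  zero, it is at least \<open>m\<close> at arbitrarily late times \<open>t\<close>. The constants below depend only on \<open>m\<close> and on
  bounds for the data, not on \<open>t\<close>. In units of \<open>r powr (3/2)\<close>, \<open>c0\<close> bounds the local mass at time \<open>t\<close> from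
  below, \<open>c1\<close> is the share of half of it that at least one bubble must have throughout the window, and
  \<open>c2\<close> is the resulting lower bound for the elliptic defect; \<open>\<alpha>\<close> and \<open>\<beta>\<close> bound all scales in units of \<open>r\<close>.
  Finally \<open>\<epsilon>\<close> is chosen small, and then \<open>t\<close> large.
\<close>

theorem lemmaB1:
  fixes u v :: "real \<Rightarrow> real^5 \<Rightarrow> real"
    and K :: nat
    and \<mu> :: "nat \<Rightarrow> real \<Rightarrow> real"
    and y :: "nat \<Rightarrow> real \<Rightarrow> real^5"
    and z :: "nat \<Rightarrow> real^5"
    and C1 C2 :: real
  assumes "energy_wave_solution {0..} u v"
    and "K \<ge> 2"
    and "\<And>k. k \<in> {1..K} \<Longrightarrow> continuous_on {0..} (\<mu> k)"
    and "\<And>k t. k \<in> {1..K} \<Longrightarrow> t \<ge> 0 \<Longrightarrow> \<mu> k t > 0"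
    and "\<And>k. k \<in> {1..K} \<Longrightarrow> continuous_on {0..} (y k)"
    and "((\<lambda>t. Hdot1_norm (\<lambda>x. u t x - (\<Sum>k=1..K. bubble (\<mu> k t) (y k t) x))
            + Lp_norm 2 (v t)) \<longlongrightarrow> 0) at_top"
    and "C1 > 0" and "C2 > 0"
    and "\<And>j k t. j \<in> {1..K} \<Longrightarrow> k \<in> {1..K} \<Longrightarrow> t \<ge> 0 \<Longrightarrow>
           C1 \<le> \<mu> k t / \<mu> j t \<and> \<mu> k t / \<mu> j t \<le> C2"
    and "\<And>k. k \<in> {1..K} \<Longrightarrow> (y k \<longlongrightarrow> z k) at_top"
    and "inj_on z {1..K}"
  shows "\<forall>k\<in>{1..K}. (\<mu> k \<longlongrightarrow> 0) at_top"
proof -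
  note sol = assms(1) and \<mu>pos = assms(4) and ratio = assms(9)
  have one: "1 \<in> {1..K}" using assms(2) by simp
  have I: "finite {1..K}" "2 \<le> card {1..K}" using assms(2) by auto
  have \<mu>1: "(\<mu> 1 \<longlongrightarrow> 0) at_top"
  proof (rule ccontr)
    assume "\<not> ?thesis"
    then obtain m where m: "m > 0" "\<not> (\<forall>\<^sub>F t in at_top. dist (\<mu> 1 t) 0 < m)"
      by (auto simp: tendsto_iff)
    define w where "w t x = u t x - (\<Sum>k=1..K. bubble (\<mu> k t) (y k t) x)" for t x
    have large: "\<exists>t\<ge>T. m \<le> \<mu> 1 t" if "0 \<le> T" for T
    proof -
      obtain t where "t \<ge> T" "\<not> dist (\<mu> 1 t) 0 < m"
        using m(2) unfolding eventually_at_top_linorder by blast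
      then show ?thesis using \<mu>pos[OF one, of t] that by (auto simp: dist_real_def)
    qed
    define Y where "Y = (\<Sum>k\<in>{1..K}. norm (z k) + 1)"
    define \<rho> where "\<rho> = Y / m"
    have Y: "\<forall>\<^sub>F t in at_top. \<forall>k\<in>{1..K}. norm (y k t) \<le> Y"
    proof (subst eventually_ball_finite_distrib)
      show "\<forall>k\<in>{1..K}. \<forall>\<^sub>F t in at_top. norm (y k t) \<le> Y"
      proof
        fix k assume k: "k \<in> {1..K}"
        have "norm (z k) + 1 \<le> Y" unfolding Y_def
          by (rule member_le_sum[OF k]) auto
        moreover have "\<forall>\<^sub>F t in at_top. norm (y k t) < norm (z k) + 1"
          using order_tendstoD(2)[OF tendsto_norm[OF assms(10)[OF k]], of "norm (z k) + 1"] by simp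
        ultimately show "\<forall>\<^sub>F t in at_top. norm (y k t) \<le> Y"
          by (elim eventually_mono) linarith
      qed
    qed simp
    define c0 where "c0 = (1 + (5 + \<rho>)\<^sup>2 / 15) powr (-7/2) * cutoff_mass"
    have c0: "c0 > 0"
    proof -
      have "0 < 1 + (5 + \<rho>)\<^sup>2 / 15" by (intro add_pos_nonneg) auto
      then show ?thesis using cutoff_mass_pos by (simp add: c0_def)
    qed
    define c1 where "c1 = c0 / (2 * K)"
    have c1: "c1 > 0" using c0 assms(2) by (simp add: c1_def)
    have bm: "0 \<le> bubble_mass" by (simp add: bubble_mass_def)
    define \<alpha> where "\<alpha> = C1 * (c1 / (bubble_mass + 1)) powr (2/3)"
    define \<beta> where "\<beta> = C2 * (cutoff_mass / c1) powr (2/7)"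
    have \<alpha>: "\<alpha> > 0" using assms(7) c1 bm by (simp add: \<alpha>_def)
    have \<beta>: "\<beta> > 0" using assms(8) c1 cutoff_mass_pos by (simp add: \<beta>_def)
    define \<delta> where "\<delta> = (\<alpha> / \<beta>) powr (3/2) * (1 + (5 + \<rho>)\<^sup>2 / (15 * \<alpha>\<^sup>2)) powr (-3/2)"
    have \<delta>: "\<delta> > 0"
    proof -
      have "0 < 1 + (5 + \<rho>)\<^sup>2 / (15 * \<alpha>\<^sup>2)" by (intro add_pos_nonneg) auto
      then show ?thesis using \<alpha> \<beta> by (simp add: \<delta>_def)
    qed
    define \<eta> where "\<eta> = \<delta> / (2 * (1 + \<delta>))"
    have "\<eta> > 0" using \<delta> by (simp add: \<eta>_def)
    then obtain C where C: "C > 0"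
      "\<And>a b. \<bar>power_nonlinearity (a + b) - power_nonlinearity a\<bar> \<le> \<eta> * \<bar>a\<bar> powr (7/3) + C * \<bar>b\<bar> powr (7/3)"
      using power_nonlinearity_perturbation by metis
    define \<Theta> where "\<Theta> = (LINT s|lebesgue. box_bump 1 0 (1::real) s)"
    have \<Theta>: "\<Theta> > 0" unfolding \<Theta>_def by (rule integral_box_bump_pos) auto
    have "test_function UNIV (dir_deriv 1 (box_bump 1 0 (1::real)))"
      by (rule test_function_dir_deriv[OF test_function_box_bump]) simp
    then obtain M where M: "M > 0" "\<And>s. \<bar>dir_deriv 1 (box_bump 1 0 (1::real)) s\<bar> \<le> M"
      using test_function_bounded by metis
    define A0 where "A0 = M * Lp_norm 2 (cutoff 1)"
    define A1 where "A1 = cutoff_gradient_norm"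
    define A2 where "A2 = Lp_norm 2 (laplacian (cutoff 1))"
    have A: "0 \<le> A0" "0 \<le> A1" "0 \<le> A2"
      using M(1) by (auto simp: A0_def A1_def A2_def Lp_norm_nonneg cutoff_gradient_norm_nonneg)
    define c2 where "c2 = \<delta> * c0 / 8"
    have c2: "c2 > 0" using \<delta> c0 by (simp add: c2_def)
    have "0 \<le> A0 + 2 * A1 + A2" "0 \<le> 33 * C" "0 < min (c0 / 2) (min c2 (c2 * \<Theta>))"
      using A C(1) c0 c2 \<Theta> by simp_all
    from small_epsilon_exists[OF this] obtain \<epsilon> where \<epsilon>: "\<epsilon> > 0"
      "(A0 + 2 * A1 + A2) * \<epsilon> + (33 * C) * (3 * \<epsilon>) powr (7/3) < min (c0 / 2) (min c2 (c2 * \<Theta>))"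
      by blast
    have nn: "0 \<le> A0 * \<epsilon>" "0 \<le> A1 * \<epsilon>" "0 \<le> A2 * \<epsilon>" "0 \<le> (33 * C) * (3 * \<epsilon>) powr (7/3)"
      using A \<epsilon>(1) C(1) by simp_all
    \<comment> \<open>These bounds keep, in this order, half of the local mass, half of the elliptic defect, and a
      contradiction in the time average.\<close>
    have sm1: "(A2 + 2 * A1) * \<epsilon> \<le> c0 / 2"
      and sm2: "A1 * \<epsilon> + (33 * C) * (3 * \<epsilon>) powr (7/3) \<le> c2"
      and sm3: "A0 * \<epsilon> < c2 * \<Theta>"
      using \<epsilon>(2) nn by (simp_all add: distrib_right)
    have "\<forall>\<^sub>F t in at_top. Hdot1_norm (w t) + Lp_norm 2 (v t) < \<epsilon>"
      using order_tendstoD(2)[OF assms(6) \<epsilon>(1)] by (simp only: w_def[abs_def])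
    from eventually_conj[OF Y this] obtain T where
      "\<forall>t\<ge>T. (\<forall>k\<in>{1..K}. norm (y k t) \<le> Y)
        \<and> Hdot1_norm (w t) + Lp_norm 2 (v t) < \<epsilon>"
      unfolding eventually_at_top_linorder by blast
    then have T: "\<And>t. t \<ge> T \<Longrightarrow> \<forall>k\<in>{1..K}. norm (y k t) \<le> Y"
      "\<And>t. t \<ge> T \<Longrightarrow> Hdot1_norm (w t) + Lp_norm 2 (v t) < \<epsilon>"
      by blast+
    have "0 \<le> max T 1" by (simp add: le_max_iff_disj)
    from large[OF this] obtain t where t: "t \<ge> max T 1" "m \<le> \<mu> 1 t" by blast
    \<comment> \<open>The first scale at time \<open>t\<close> is the unit of length and of time from here on.\<close>
    define r where "r = \<mu> 1 t"
    have r: "r > 0" "m \<le> r" using t m by (auto simp: r_def)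
    have t1: "0 < t" "T \<le> t" using t by auto
    have Y\<rho>: "Y \<le> \<rho> * r"
    proof -
      have "0 \<le> Y" unfolding Y_def by (intro sum_nonneg) auto
      then have "Y * m \<le> Y * r" using r by (intro mult_left_mono) auto
      then show ?thesis using m(1) by (simp add: \<rho>_def field_simps)
    qed
    define D where "D s = (\<Sum>k\<in>{1..K}. local_mass r (\<mu> k s) (y k s))" for s
    define g where "g s = (LINT x|lebesgue. u s x * laplacian (cutoff r) x)" for s
    have vs: "Lp_norm 2 (v s) \<le> \<epsilon>" and ws: "Hdot1_norm (w s) \<le> \<epsilon>"
      and ys: "\<And>k. k \<in> {1..K} \<Longrightarrow> norm (y k s) \<le> \<rho> * r" if "s \<ge> t" for s
    proof -
      have "s \<ge> T" using that t1 by simp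
      from T(2)[OF this] show "Lp_norm 2 (v s) \<le> \<epsilon>"
        and "Hdot1_norm (w s) \<le> \<epsilon>"
        using Lp_norm_nonneg[of 2 "v s"]
          Hdot1_norm_nonneg[of "w s"] by linarith+
      show "norm (y k s) \<le> \<rho> * r" if "k \<in> {1..K}" for k
        using T(1)[OF \<open>s \<ge> T\<close>] that Y\<rho> by force
    qed
    \<comment> \<open>Up to the error \<open>w\<close>, the pairing \<open>g\<close> is minus the total local mass \<open>D\<close>.\<close>
    have gD: "\<bar>g s + D s\<bar> \<le> r powr (3/2) * (A1 * \<epsilon>)" if s: "s \<ge> t" for s
    proof -
      note tl = test_function_laplacian[OF test_function_cutoff[OF r(1)]]
      have \<mu>s: "\<mu> k s > 0" if "k \<in> {1..K}" for k using \<mu>pos[OF that] s t1 by simp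
      have uH: "in_Hdot1 (u s)" using sol s t1 by (simp add: energy_wave_solution_def)
      have SH: "in_Hdot1 (\<lambda>x. \<Sum>k=1..K. bubble (\<mu> k s) (y k s) x)"
        by (intro in_Hdot1_sum in_Hdot1_bubble \<mu>s)
      have "g s + D s = g s - (LINT x|lebesgue. (\<Sum>k=1..K. bubble (\<mu> k s) (y k s) x) * laplacian (cutoff r) x)"
        using sum_bubbles_pairing_laplacian[OF r(1), of "{1..K}" "\<lambda>k. \<mu> k s" "\<lambda>k. y k s"] \<mu>s by (simp add: D_def)
      also have "\<dots> = (LINT x|lebesgue. w s x * laplacian (cutoff r) x)"
        unfolding g_def w_def left_diff_distrib
        by (intro Bochner_Integration.integral_diff[symmetric] integrable_Hdot1_test[OF _ tl] uH SH)
      finally have eq: "g s + D s = (LINT x|lebesgue. w s x * laplacian (cutoff r) x)" .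
      have "\<bar>g s + D s\<bar> \<le> r powr (3/2) * (Hdot1_norm (w s) * cutoff_gradient_norm)"
        unfolding eq w_def[abs_def] by (rule Hdot1_laplacian_cutoff_bound[OF in_Hdot1_diff[OF uH SH] r(1)])
      also have "\<dots> \<le> r powr (3/2) * (\<epsilon> * cutoff_gradient_norm)"
        by (intro mult_left_mono mult_right_mono ws s cutoff_gradient_norm_nonneg) auto
      finally show ?thesis by (simp add: A1_def mult.commute)
    qed
    have Dt: "c0 * r powr (3/2) \<le> D t"
    proof -
      have "r powr (3/2) * c0 \<le> local_mass r (\<mu> 1 t) (y 1 t)"
        unfolding c0_def r_def[symmetric] by (rule local_mass_ge[OF r(1) ys[OF order_refl one]])
      also have "\<dots> \<le> D t"
        unfolding D_def
      proof (rule member_le_sum[OF one])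
        fix k assume "k \<in> {1..K} - {1}"
        show "0 \<le> local_mass r (\<mu> k t) (y k t)" unfolding local_mass_def
          by (intro integral_nonneg_AE AE_I2 mult_nonneg_nonneg cutoff_bounds) auto
      qed simp
      finally show ?thesis by (simp add: mult.commute)
    qed
    have Ds: "c0 / 2 * r powr (3/2) \<le> D s" if s: "s \<in> {t..t + r}" for s
    proof -
      have "\<bar>g s - g t\<bar> \<le> \<epsilon> * (r powr (1/2) * A2) * (s - t)"
        unfolding g_def A2_def
        by (rule pairing_laplacian_increment[OF sol r(1) t1(1)]) (use s vs in auto)
      also have "\<dots> \<le> \<epsilon> * (r powr (1/2) * A2) * r"
        using s \<epsilon>(1) A by (intro mult_left_mono) auto
      also have "\<dots> = r powr (3/2) * (A2 * \<epsilon>)"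
      proof -
        have "r powr (3/2) = r powr (1/2) * r powr 1" unfolding powr_add[symmetric] by simp
        then show ?thesis using r by simp
      qed
      finally have "\<bar>g s - g t\<bar> \<le> r powr (3/2) * (A2 * \<epsilon>)" .
      then have "D t - D s \<le> r powr (3/2) * (A2 * \<epsilon>) + 2 * (r powr (3/2) * (A1 * \<epsilon>))"
        using gD[of s] gD[of t] s by (auto simp: abs_le_iff)
      also have "\<dots> = r powr (3/2) * ((A2 + 2 * A1) * \<epsilon>)" by (simp add: algebra_simps)
      also have "\<dots> \<le> r powr (3/2) * (c0 / 2)" using sm1 by (intro mult_left_mono) auto
      finally show ?thesis using Dt by (simp add: algebra_simps)
    qed
    have low: "c2 * r powr (3/2) \<le> wave_defect r (u s)" if s: "s \<in> {t..t + r}" for s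
    proof -
      have s0: "s \<ge> 0" "s \<ge> t" using s t1 by auto
      \<comment> \<open>One of the \<open>K\<close> bubbles has at least the mean local mass, and the others have comparable scales.\<close>
      have "\<exists>k\<in>{1..K}. c1 * r powr (3/2) \<le> local_mass r (\<mu> k s) (y k s)"
      proof (rule ccontr)
        assume "\<not> ?thesis"
        then have "D s < (\<Sum>k\<in>{1..K}. c1 * r powr (3/2))"
          unfolding D_def using one by (intro sum_strict_mono) (auto simp: not_le)
        also have "\<dots> = c0 / 2 * r powr (3/2)" using assms(2) by (simp add: c1_def)
        finally show False using Ds[OF s] by simp
      qed
      then obtain k where k: "k \<in> {1..K}" "c1 * r powr (3/2) \<le> local_mass r (\<mu> k s) (y k s)" by blast
      note sc = scale_control[OF r(1) \<mu>pos[OF k(1) s0(1)] c1 k(2)]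
      have scales: "\<alpha> * r \<le> \<mu> j s \<and> \<mu> j s \<le> \<beta> * r" if j: "j \<in> {1..K}" for j
      proof -
        have pos: "\<mu> k s > 0" by (rule \<mu>pos[OF k(1) s0(1)])
        have ra: "C1 * \<mu> k s \<le> \<mu> j s" "\<mu> j s \<le> C2 * \<mu> k s"
          using ratio[OF k(1) j s0(1)] pos by (simp_all add: field_simps)
        have "C1 * ((c1 / (bubble_mass + 1)) powr (2/3) * r) \<le> C1 * \<mu> k s"
          using sc(1) assms(7) by (intro mult_left_mono) auto
        moreover have "C2 * \<mu> k s \<le> C2 * ((cutoff_mass / c1) powr (2/7) * r)"
          using sc(2) assms(8) by (intro mult_left_mono) auto
        ultimately show ?thesis using ra unfolding \<alpha>_def \<beta>_def mult.assoc by linarith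
      qed
      have "\<delta> / 2 * D s - r powr (3/2) * (cutoff_gradient_norm * \<epsilon> + 33 * C * (3 * \<epsilon>) powr (7/3)) \<le> wave_defect r (u s)"
        unfolding D_def
        by (rule wave_defect_lower_bound[OF I r(1) \<alpha> scales ys[OF s0(2)] _ ws[OF s0(2), unfolded w_def[abs_def]] \<epsilon>(1) \<delta>_def \<eta>_def C])
           (use sol s0 in \<open>auto simp: energy_wave_solution_def\<close>)
      moreover have "\<delta> / 2 * (c0 / 2 * r powr (3/2)) \<le> \<delta> / 2 * D s"
        using Ds[OF s] \<delta> by (intro mult_left_mono) auto
      moreover have "r powr (3/2) * (A1 * \<epsilon> + (33 * C) * (3 * \<epsilon>) powr (7/3)) \<le> r powr (3/2) * c2"
        using sm2 by (intro mult_left_mono) auto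
      moreover have "\<delta> / 2 * (c0 / 2 * r powr (3/2)) = 2 * (r powr (3/2) * c2)" by (simp add: c2_def)
      ultimately show ?thesis unfolding A1_def mult.commute[of c2] by linarith
    qed
    have "c2 * \<Theta> \<le> M * Lp_norm 2 (cutoff 1) * \<epsilon>"
      unfolding \<Theta>_def
      by (rule time_average_bound[OF sol r(1) t1(1) _ \<epsilon>(1) low M(2)]) (use vs in auto)
    with sm3 show False by (simp add: A0_def)
  qed
  show ?thesis
  proof
    fix k assume k: "k \<in> {1..K}"
    show "(\<mu> k \<longlongrightarrow> 0) at_top"
    proof (rule tendsto_sandwich[OF _ _ tendsto_const tendsto_mult_right_zero[OF \<mu>1, of C2]])
      show "\<forall>\<^sub>F t in at_top. 0 \<le> \<mu> k t"
        using eventually_ge_at_top[of 0] by eventually_elim (use \<mu>pos[OF k] in \<open>auto intro: less_imp_le\<close>)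
      show "\<forall>\<^sub>F t in at_top. \<mu> k t \<le> C2 * \<mu> 1 t"
        using eventually_ge_at_top[of 0]
      proof eventually_elim
        case (elim t)
        then show ?case using ratio[OF one k elim] \<mu>pos[OF one elim] by (simp add: field_simps)
      qed
    qed
  qed
qed

end
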